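(* Let $\rho:\Gamma\to GL_3(\mathbb{C})$ be a $T$-determined, $T$-unitarizable representation and $\upsilon$ any multiplier system for $\Gamma$ with cusp parameter $m$. Write the eigenvalues of $\rho(T)$ as $\mathbf{e}(r_1),\mathbf{e}(r_2),\mathbf{e}(r_3)$ with $r_j\in[0,1)$, let $\lambda_j\in[0,1)$ be the unique number with $\lambda_j\equiv r_j+\frac{m}{12}\pmod{\mathbb{Z}}$, $\lambda_0=\lambda_1+\lambda_2+\lambda_3$, and $k_0=4\lambda_0-2$. Suppose $\mathcal{H}(\rho,\upsilon)=\bigoplus_{k\ge0}\mathcal{H}(k_0+2k,\rho,\upsilon)$ and let $F_0\in\mathcal{H}(k_0,\rho,\upsilon)$ be a nonzero vector whose components form a fundamental system of solutions of a third order MLDE in weight $k_0$. Then: (i) $\mathcal{H}(\rho,\upsilon)$ is a free $\mathcal{M}$-module of rank 3 with basis $\{F_0,DF_0,D^2F_0\}$; (ii) $\mathcal{H}(\rho,\upsilon)=\mathcal{R}F_0$ is a cyclic $\mathcal{R}$-module; (iii) for all integers $k\ge0$, $\dim\mathcal{H}(k_0+2k,\rho,\upsilon)=\left[\frac{k}{2}\right]+1$.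
   Context: $\Gamma=SL(2,\mathbb{Z})$ acts on the upper half-plane $\mathbb{H}$ by Möbius transformations; $T=\begin{pmatrix}1&1\\0&1\end{pmatrix}$; $q=e^{2\pi iz}$, $\mathbf{e}(r)=e^{2\pi ir}$; $[x]$ is the greatest integer $\le x$. Complex powers use the principal branch of $\log$. For $k\in\mathbb{R}$, a multiplier system of weight $k$ is a map $\upsilon:\Gamma\to\{|w|=1\}$ such that $\nu(\gamma,z)=\upsilon(\gamma)(cz+d)^k$ ($\gamma=\begin{pmatrix}a&b\\c&d\end{pmatrix}$) satisfies $\nu(\gamma\sigma,z)=\nu(\gamma,\sigma z)\nu(\sigma,z)$; it is then also one of weight $k+n$ for all $n\in\mathbb{Z}$. Its cusp parameter is the $m\in[0,12)$ with $\upsilon(T)=\mathbf{e}(m/12)$. Slash action: $(f|_k^\upsilon\gamma)(z)=\upsilon(\gamma)^{-1}(cz+d)^{-k}f(\gamma z)$. Moderate growth of holomorphic $f$ on $\mathbb{H}$: $|f(x+iy)|\le y^N$ for $y>c$, some $N,c>0$. $\mathcal{H}(k,\rho,\upsilon)$: column vectors $F$ of holomorphic moderate-growth functions with $F|_k^\upsilon\gamma=\rho(\gamma)F$ for all $\gamma\in\Gamma$; $\mathcal{H}(\rho,\upsilon)=\bigoplus_{n\in\mathbb{Z}}\mathcal{H}(k+n,\rho,\upsilon)$. $\mathcal{M}=\bigoplus_j\mathcal{M}_j=\mathbb{C}[E_4,E_6]$ is the graded ring of holomorphic integral-weight modular forms for $\Gamma$ (trivial multiplier), acting by componentwise multiplication.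 $T$-unitarizable: $\rho(T)$ conjugate to a unitary matrix. An irreducible $\rho$ of dimension $d$ is $T$-determined if every indecomposable $\rho':\Gamma\to GL_d(\mathbb{C})$ with $\rho'(T)$ having the same eigenvalues as $\rho(T)$ is irreducible. With $\eta=q^{1/24}\prod_{n\ge1}(1-q^n)$, $P=\frac{i}{\pi}\frac{\eta'}{\eta}$ and $D_kf=\frac{1}{2\pi i}\frac{df}{dz}+kPf$, $D$ acts on $\mathcal{H}(k,\rho,\upsilon)$ componentwise as $D_k$, and $D^n=D_{k+2(n-1)}\circ\cdots\circ D_k$ on weight $k$. An MLDE of order $n$ in weight $k$ is $D_k^nf+M_4D_k^{n-2}f+\cdots+M_{2n}f=0$ with $M_{2j}\in\mathcal{M}_{2j}$; a fundamental system of solutions is a basis of its solution space. $\mathcal{R}$ is the skew polynomial ring $\mathcal{M}[d]$ with $dM=Md+DM$, acting on $\mathcal{H}(\rho,\upsilon)$ by $d\cdot F=DF$; $\mathcal{H}(\rho,\upsilon)=\mathcal{R}F_0$ means every element is a finite sum $\sum_jM_jD^jF_0$, $M_j\in\mathcal{M}$. *)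

theory Defs
  imports "HOL-Complex_Analysis.Complex_Analysis" "HOL-Library.Function_Algebras"
begin

type_synonym mat2 = "int^2^2"

definition SL2Z :: "mat2 set" where
  "SL2Z = {g. det g = 1}"

abbreviation ea :: "mat2 \<Rightarrow> int" where "ea g \<equiv> g$1$1"
abbreviation eb :: "mat2 \<Rightarrow> int" where "eb g \<equiv> g$1$2"
abbreviation ec :: "mat2 \<Rightarrow> int" where "ec g \<equiv> g$2$1"
abbreviation ed :: "mat2 \<Rightarrow> int" where "ed g \<equiv> g$2$2"

definition Tmat :: mat2 where
  "Tmat = (\<chi> i j. if i = 2 \<and> j = 1 then 0 else 1)"

definition Hup :: "complex set" where
  "Hup = {z. Im z > 0}"

definition mob :: "mat2 \<Rightarrow> complex \<Rightarrow> complex" where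
  "mob g z = (of_int (ea g) * z + of_int (eb g)) / (of_int (ec g) * z + of_int (ed g))"

definition jfac :: "mat2 \<Rightarrow> complex \<Rightarrow> complex" where
  "jfac g z = of_int (ec g) * z + of_int (ed g)"

definition ee :: "real \<Rightarrow> complex" where
  "ee r = exp (2 * pi * \<i> * of_real r)"

definition nu :: "(mat2 \<Rightarrow> complex) \<Rightarrow> real \<Rightarrow> mat2 \<Rightarrow> complex \<Rightarrow> complex" where
  "nu v k g z = v g * (jfac g z) powr (of_real k)"

definition multiplier_system :: "real \<Rightarrow> (mat2 \<Rightarrow> complex) \<Rightarrow> bool" where
  "multiplier_system k v \<longleftrightarrow>
     (\<forall>g\<in>SL2Z. norm (v g) = 1) \<and>
     (\<forall>g\<in>SL2Z. \<forall>s\<in>SL2Z. \<forall>z\<in>Hup. nu v k (g ** s) z = nu v k g (mob s z) * nu v k s z)"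

definition cusp_parameter :: "(mat2 \<Rightarrow> complex) \<Rightarrow> real \<Rightarrow> bool" where
  "cusp_parameter v m \<longleftrightarrow> 0 \<le> m \<and> m < 12 \<and> v Tmat = ee (m / 12)"

type_synonym cmat3 = "complex^3^3"

definition representation3 :: "(mat2 \<Rightarrow> cmat3) \<Rightarrow> bool" where
  "representation3 \<rho> \<longleftrightarrow> \<rho> (mat 1) = mat 1 \<and>
     (\<forall>g\<in>SL2Z. \<forall>s\<in>SL2Z. \<rho> (g ** s) = \<rho> g ** \<rho> s)"

definition csubspace3 :: "(complex^3) set \<Rightarrow> bool" where
  "csubspace3 W \<longleftrightarrow> 0 \<in> W \<and> (\<forall>x\<in>W. \<forall>y\<in>W. x + y \<in> W) \<and> (\<forall>c. \<forall>x\<in>W. c *s x \<in> W)"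

definition invariant3 :: "(mat2 \<Rightarrow> cmat3) \<Rightarrow> (complex^3) set \<Rightarrow> bool" where
  "invariant3 \<rho> W \<longleftrightarrow> csubspace3 W \<and> (\<forall>g\<in>SL2Z. \<forall>x\<in>W. \<rho> g *v x \<in> W)"

definition irreducible3 :: "(mat2 \<Rightarrow> cmat3) \<Rightarrow> bool" where
  "irreducible3 \<rho> \<longleftrightarrow> (\<forall>W. invariant3 \<rho> W \<longrightarrow> W = {0} \<or> W = UNIV)"

definition indecomposable3 :: "(mat2 \<Rightarrow> cmat3) \<Rightarrow> bool" where
  "indecomposable3 \<rho> \<longleftrightarrow> \<not> (\<exists>W1 W2. invariant3 \<rho> W1 \<and> invariant3 \<rho> W2 \<and>
      W1 \<noteq> {0} \<and> W2 \<noteq> {0} \<and> W1 \<inter> W2 = {0} \<and> {x + y | x y. x \<in> W1 \<and> y \<in> W2} = UNIV)"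

text \<open>Characteristic polynomial, as a polynomial function; equality of these functions
  means equality of eigenvalues counted with algebraic multiplicity.\<close>
definition charpoly3 :: "cmat3 \<Rightarrow> complex \<Rightarrow> complex" where
  "charpoly3 A x = det (mat x - A)"

definition T_determined :: "(mat2 \<Rightarrow> cmat3) \<Rightarrow> bool" where
  "T_determined \<rho> \<longleftrightarrow> irreducible3 \<rho> \<and>
     (\<forall>\<rho>'. representation3 \<rho>' \<and> indecomposable3 \<rho>' \<and> charpoly3 (\<rho>' Tmat) = charpoly3 (\<rho> Tmat)
            \<longrightarrow> irreducible3 \<rho>')"

definition cadj3 :: "cmat3 \<Rightarrow> cmat3" where
  "cadj3 U = (\<chi> i j. cnj (U $ j $ i))"

definition unitary3 :: "cmat3 \<Rightarrow> bool" where
  "unitary3 U \<longleftrightarrow> U ** cadj3 U = mat 1"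

definition T_unitarizable :: "(mat2 \<Rightarrow> cmat3) \<Rightarrow> bool" where
  "T_unitarizable \<rho> \<longleftrightarrow> (\<exists>P. invertible P \<and> unitary3 (P ** \<rho> Tmat ** matrix_inv P))"

definition moderate_growth :: "(complex \<Rightarrow> complex) \<Rightarrow> bool" where
  "moderate_growth f \<longleftrightarrow> (\<exists>N>0. \<exists>c>0. \<forall>x y. y > c \<longrightarrow> norm (f (Complex x y)) \<le> y powr N)"

text \<open>Functions are represented on all of \<open>\<complex>\<close>, normalised to vanish off the upper half-plane.\<close>
definition Hk :: "real \<Rightarrow> (mat2 \<Rightarrow> cmat3) \<Rightarrow> (mat2 \<Rightarrow> complex) \<Rightarrow> (complex \<Rightarrow> complex^3) set" where
  "Hk k \<rho> v = {F. (\<forall>z. z \<notin> Hup \<longrightarrow> F z = 0) \<and>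
      (\<forall>i. (\<lambda>z. F z $ i) holomorphic_on Hup) \<and>
      (\<forall>i. moderate_growth (\<lambda>z. F z $ i)) \<and>
      (\<forall>g\<in>SL2Z. \<forall>z\<in>Hup.
          (inverse (v g) * inverse ((jfac g z) powr (of_real k))) *s F (mob g z) = \<rho> g *v F z)}"

definition MF :: "int \<Rightarrow> (complex \<Rightarrow> complex) set" where
  "MF j = {f. (\<forall>z. z \<notin> Hup \<longrightarrow> f z = 0) \<and> f holomorphic_on Hup \<and> moderate_growth f \<and>
      (\<forall>g\<in>SL2Z. \<forall>z\<in>Hup. f (mob g z) = (jfac g z) powi j * f z)}"

definition Mring :: "(int \<Rightarrow> complex \<Rightarrow> complex) set" where
  "Mring = {a. finite {j. a j \<noteq> 0} \<and> (\<forall>j. a j \<in> MF j)}"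

definition Hmod :: "real \<Rightarrow> (mat2 \<Rightarrow> cmat3) \<Rightarrow> (mat2 \<Rightarrow> complex) \<Rightarrow> (int \<Rightarrow> complex \<Rightarrow> complex^3) set" where
  "Hmod k \<rho> v = {G. finite {n. G n \<noteq> 0} \<and> (\<forall>n. G n \<in> Hk (k + of_int n) \<rho> v)}"

definition act :: "(int \<Rightarrow> complex \<Rightarrow> complex) \<Rightarrow> (int \<Rightarrow> complex \<Rightarrow> complex^3) \<Rightarrow> (int \<Rightarrow> complex \<Rightarrow> complex^3)" where
  "act a G = (\<lambda>n z. \<Sum>j\<in>{j. a j \<noteq> 0}. a j z *s G (n - j) z)"

definition eta :: "complex \<Rightarrow> complex" where
  "eta z = exp (2 * pi * \<i> * z / 24) * (\<Prod>n. (1 - exp (2 * pi * \<i> * of_nat (Suc n) * z)))"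

definition Pfun :: "complex \<Rightarrow> complex" where
  "Pfun z = (\<i> / pi) * (deriv eta z / eta z)"

definition Dsc :: "real \<Rightarrow> (complex \<Rightarrow> complex) \<Rightarrow> complex \<Rightarrow> complex" where
  "Dsc k f z = deriv f z / (2 * pi * \<i>) + of_real k * Pfun z * f z"

fun Dsc_pow :: "real \<Rightarrow> nat \<Rightarrow> (complex \<Rightarrow> complex) \<Rightarrow> complex \<Rightarrow> complex" where
  "Dsc_pow k 0 f = f"
| "Dsc_pow k (Suc n) f = Dsc (k + 2 * of_nat n) (Dsc_pow k n f)"

definition Dvec :: "real \<Rightarrow> (complex \<Rightarrow> complex^3) \<Rightarrow> complex \<Rightarrow> complex^3" where
  "Dvec k F z = (if z \<in> Hup then (\<chi> i. Dsc k (\<lambda>w. F w $ i) z) else 0)"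

definition Dmod :: "real \<Rightarrow> (int \<Rightarrow> complex \<Rightarrow> complex^3) \<Rightarrow> (int \<Rightarrow> complex \<Rightarrow> complex^3)" where
  "Dmod k G = (\<lambda>n. Dvec (k + of_int (n - 2)) (G (n - 2)))"

definition mlde3_sol :: "real \<Rightarrow> (complex \<Rightarrow> complex) \<Rightarrow> (complex \<Rightarrow> complex) \<Rightarrow> (complex \<Rightarrow> complex) \<Rightarrow> bool" where
  "mlde3_sol k M4 M6 f \<longleftrightarrow> f holomorphic_on Hup \<and>
     (\<forall>z\<in>Hup. Dsc_pow k 3 f z + M4 z * Dsc_pow k 1 f z + M6 z * f z = 0)"

definition fundamental_system3 :: "real \<Rightarrow> (complex \<Rightarrow> complex) \<Rightarrow> (complex \<Rightarrow> complex) \<Rightarrow> (3 \<Rightarrow> complex \<Rightarrow> complex) \<Rightarrow> bool" where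
  "fundamental_system3 k M4 M6 fs \<longleftrightarrow>
     (\<forall>i. mlde3_sol k M4 M6 (fs i)) \<and>
     (\<forall>c :: 3 \<Rightarrow> complex. (\<forall>z\<in>Hup. (\<Sum>i\<in>UNIV. c i * fs i z) = 0) \<longrightarrow> (\<forall>i. c i = 0)) \<and>
     (\<forall>f. mlde3_sol k M4 M6 f \<longrightarrow> (\<exists>c :: 3 \<Rightarrow> complex. \<forall>z\<in>Hup. f z = (\<Sum>i\<in>UNIV. c i * fs i z)))"

definition fscale :: "complex \<Rightarrow> (complex \<Rightarrow> complex^3) \<Rightarrow> complex \<Rightarrow> complex^3" where
  "fscale c F = (\<lambda>z. c *s F z)"

definition cdim :: "(complex \<Rightarrow> complex^3) set \<Rightarrow> nat" where
  "cdim S = vector_space.dim fscale S"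

end

theory Submission
  imports Defs "HOL-Real_Asymp.Real_Asymp"
begin

text \<open>Let \<open>W = det (F\<^sub>0, D F\<^sub>0, D\<^sup>2 F\<^sub>0)\<close>. Because the equation has no \<open>D\<^sup>2\<close> term, \<open>D W = 0\<close>; as
  the components of \<open>F\<^sub>0\<close> are a fundamental system, \<open>W\<close> vanishes nowhere, and \<open>D W = 0\<close>
  forces its order at the cusp to be exactly \<open>\<lambda>\<^sub>0\<close>. For any form \<open>F\<close>, Cramer's rule gives
  \<open>F = a F\<^sub>0 + b D F\<^sub>0 + c D\<^sup>2 F\<^sub>0\<close> with \<open>a = det (F, D F\<^sub>0, D\<^sup>2 F\<^sub>0) / W\<close> and so on. After diagonalising
  \<open>\<rho>(T)\<close> the numerators have order at least \<open>\<lambda>\<^sub>0\<close>, so the coefficients are holomorphic modular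
  forms. The dimension formula follows from that of the spaces of level one forms.

  The transformation law of \<open>P\<close> is not taken from the theory of \<open>\<eta>\<close>: \<open>W\<close> is modular of weight
  \<open>12 \<lambda>\<^sub>0\<close> whatever \<open>P\<close> is, and \<open>D W = 0\<close> exhibits \<open>P\<close> as its logarithmic derivative up to a constant.
  This needs \<open>\<lambda>\<^sub>0 \<noteq> 0\<close>; otherwise \<open>\<rho>(T)\<close>, and hence all of \<open>\<rho>\<close>, would be scalar.\<close>

text \<open>The choice of weight ties the argument together: \<open>k0 = 4 * lam0 - 2\<close> means
  \<open>3 * k0 + 6 = 12 * lam0\<close>, and the power \<open>24 * lam0\<close> of eta has weight
  \<open>12 * lam0\<close> and order \<open>lam0\<close> at the cusp. So the weight of the Wronskian
  leaves no room for zeros beyond those forced at the cusp.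

  Orders of determinants are bounded below for two reasons. \<open>D\<close> acts as
  \<open>q d/dq\<close> plus a multiple holomorphic in \<open>q\<close>, so it keeps the exponent of
  each eigencoordinate; and every term of a determinant uses each eigencoordinate exactly once.

  The main obstacle is the order of deductions. Modularity of \<open>D\<close>,
  \<open>Delta\<close>, \<open>E4\<close> and \<open>E6\<close> rests on the law of
  \<open>P\<close>, which is available only once a vector \<open>F0\<close> with nonzero exponent
  sum is given. It is therefore carried as the predicate \<open>quasimodular_P\<close> through the
  level one theory and discharged in the final proof. That theory avoids the valence formula: it
  rests on the maximum principle, uniqueness for linear differential equations, and division by
  \<open>Delta\<close>.\<close>

no_notation fps_nth (infixl "$" 75)

section \<open>The modular group\<close>

definition Smat :: mat2 where
  "Smat = (\<chi> i j. if i = j then 0 else if i = 1 then - 1 else 1)"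

definition Tinv :: mat2 where
  "Tinv = (\<chi> i j. if i = 2 \<and> j = 1 then 0 else if i = j then 1 else - 1)"

lemma mat2_eq_iff: "g = h \<longleftrightarrow> ea g = ea h \<and> eb g = eb h \<and> ec g = ec h \<and> ed g = ed h" for g h :: mat2
  by (auto simp: vec_eq_iff forall_2)

lemma Tmat_entries [simp]: "ea Tmat = 1" "eb Tmat = 1" "ec Tmat = 0" "ed Tmat = 1"
  by (auto simp: Tmat_def)

lemma Smat_entries [simp]: "ea Smat = 0" "eb Smat = - 1" "ec Smat = 1" "ed Smat = 0"
  by (auto simp: Smat_def)

lemma Tinv_entries [simp]: "ea Tinv = 1" "eb Tinv = - 1" "ec Tinv = 0" "ed Tinv = 1"
  by (auto simp: Tinv_def)

lemma mat2_mult_entries [simp]: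
  fixes g h :: mat2
  shows "ea (g ** h) = ea g * ea h + eb g * ec h" "eb (g ** h) = ea g * eb h + eb g * ed h"
        "ec (g ** h) = ec g * ea h + ed g * ec h" "ed (g ** h) = ec g * eb h + ed g * ed h"
  by (simp_all add: matrix_matrix_mult_def sum_2)

lemma mat2_one_entries [simp]: "ea (mat 1) = 1" "eb (mat 1) = 0" "ec (mat 1) = 0" "ed (mat 1) = 1"
  by (simp_all add: mat_def)

lemma SL2Z_iff: "g \<in> SL2Z \<longleftrightarrow> ea g * ed g - eb g * ec g = 1"
  by (simp add: SL2Z_def det_2)

lemma SL2Z_mult: "g \<in> SL2Z \<Longrightarrow> h \<in> SL2Z \<Longrightarrow> g ** h \<in> SL2Z"
  by (simp add: SL2Z_def det_mul)

lemma SL2Z_generators [simp]: "Tmat \<in> SL2Z" "Smat \<in> SL2Z" "Tinv \<in> SL2Z" "mat 1 \<in> SL2Z"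
  by (simp_all add: SL2Z_iff)

text \<open>Euclid's algorithm on the bottom row.\<close>

lemma SL2Z_induct [consumes 1, case_names T Tinv S mult]:
  assumes g: "g \<in> SL2Z"
    and T: "Q Tmat" and Ti: "Q Tinv" and S: "Q Smat"
    and mult: "\<And>g h. g \<in> SL2Z \<Longrightarrow> h \<in> SL2Z \<Longrightarrow> Q g \<Longrightarrow> Q h \<Longrightarrow> Q (g ** h)"
  shows "Q g"
proof -
  \<comment> \<open>\<open>Smat ** Smat\<close> is minus the identity: it supplies the sign in the
    base case and the inverse \<open>S^3\<close> of \<open>S\<close> in the step.\<close>
  have SS: "Smat ** Smat \<in> SL2Z" "Q (Smat ** Smat)"
    using S by (auto intro: SL2Z_mult mult)
  have one: "Q (mat 1)"
  proof -
    have "mat 1 = Tmat ** Tinv" by (simp add: mat2_eq_iff)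
    then show ?thesis using mult[OF _ _ T Ti] by simp
  qed
  define U :: "int \<Rightarrow> mat2" where "U = (\<lambda>b. \<chi> i j. if i = 2 \<and> j = 1 then 0 else if i = j then 1 else b)"
  have Ue [simp]: "ea (U b) = 1" "eb (U b) = b" "ec (U b) = 0" "ed (U b) = 1" for b
    by (auto simp: U_def)
  have USL [simp]: "U b \<in> SL2Z" for b by (simp add: SL2Z_iff)
  have QUn: "Q (U (int n)) \<and> Q (U (- int n))" for n
  proof (induction n)
    case 0
    have "U 0 = mat 1" by (simp add: mat2_eq_iff)
    then show ?case using one by simp
  next
    case (Suc n)
    have "U (int (Suc n)) = Tmat ** U (int n)" "U (- int (Suc n)) = Tinv ** U (- int n)"
      by (simp_all add: mat2_eq_iff)
    then show ?case using Suc mult T Ti by simp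
  qed
  have QU: "Q (U b)" for b
    using QUn[of "nat b"] QUn[of "nat (- b)"] by (cases "b \<ge> 0") auto
  show ?thesis using g
  proof (induction "nat \<bar>ec g\<bar>" arbitrary: g rule: less_induct)
    case less
    show ?case
    proof (cases "ec g = 0")
      case True
      then have "ea g * ed g = 1" using less.prems by (simp add: SL2Z_iff)
      then have "ea g = 1 \<and> ed g = 1 \<or> ea g = -1 \<and> ed g = -1"
        using zmult_eq_1_iff by blast
      then consider "ea g = 1" "ed g = 1" | "ea g = -1" "ed g = -1" by blast
      then show ?thesis
      proof cases
        case 1
        then have "g = U (eb g)" using True by (simp add: mat2_eq_iff)
        then show ?thesis using QU by metis
      next
        case 2
        then have "g = (Smat ** Smat) ** U (- eb g)" using True by (simp add: mat2_eq_iff)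
        then show ?thesis using QU SS mult[of "Smat ** Smat" "U (- eb g)"] USL by metis
      qed
    next
      case False
      define b where "b = ed g div ec g"
      \<comment> \<open>Right multiplication by \<open>T^(-b)\<close> reduces the bottom right entry
        modulo \<open>ec g\<close>; \<open>S\<close> then moves the remainder to the bottom left,
        where the induction measures it.\<close>
      define h where "h = (g ** U (- b)) ** Smat"
      have ech: "ec h = ed g mod ec g"
        by (simp add: h_def b_def algebra_simps minus_div_mult_eq_mod [symmetric])
      have hSL: "h \<in> SL2Z" unfolding h_def using less.prems by (intro SL2Z_mult) auto
      have "nat \<bar>ec h\<bar> < nat \<bar>ec g\<bar>"
        unfolding ech using False abs_mod_less[of "ec g" "ed g"] by simp
      then have Qh: "Q h" using less.hyps hSL by blast
      \<comment> \<open>\<open>S^3 T^b\<close> is the inverse of \<open>T^(-b) S\<close>.\<close>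
      have "g = h ** ((Smat ** Smat) ** (Smat ** U b))"
        by (simp add: mat2_eq_iff h_def algebra_simps)
      moreover have "Q ((Smat ** Smat) ** (Smat ** U b))"
        by (intro mult SL2Z_mult S QU) auto
      moreover have "(Smat ** Smat) ** (Smat ** U b) \<in> SL2Z"
        by (intro SL2Z_mult) auto
      ultimately show ?thesis using Qh hSL mult by metis
    qed
  qed
qed

section \<open>The action on the upper half-plane\<close>

lemma open_Hup [simp]: "open Hup"
  unfolding Hup_def by (simp add: open_halfspace_Im_gt)

lemma convex_Hup: "convex Hup"
  unfolding Hup_def by (rule convex_halfspace_Im_gt)

lemma connected_Hup [simp]: "connected Hup"
  using convex_Hup convex_connected by blast

lemma Hup_nonzero: "z \<in> Hup \<Longrightarrow> z \<noteq> 0"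
  by (auto simp: Hup_def)

lemma i_in_Hup [simp]: "\<i> \<in> Hup"
  by (simp add: Hup_def)

lemma jfac_nonzero: 
  assumes "g \<in> SL2Z" "z \<in> Hup"
  shows "jfac g z \<noteq> 0"
proof
  assume 0: "jfac g z = 0"
  then have "Im (jfac g z) = 0" by simp
  then have "ec g = 0" using assms by (simp add: jfac_def Hup_def)
  with 0 have "ed g = 0" by (simp add: jfac_def)
  with \<open>ec g = 0\<close> show False using assms by (simp add: SL2Z_iff)
qed

text \<open>The imaginary part is \<open>ec g * Im z\<close>, so the principal branch is never
  evaluated on its cut.\<close>

lemma jfac_not_nonpos:
  assumes "ec g \<noteq> 0" "z \<in> Hup"
  shows "jfac g z \<notin> \<real>\<^sub>\<le>\<^sub>0"
  using assms by (auto simp: jfac_def Hup_def complex_nonpos_Reals_iff)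

lemma Im_mob:
  assumes "g \<in> SL2Z" "z \<in> Hup"
  shows "Im (mob g z) = Im z / (norm (jfac g z))\<^sup>2"
proof -
  have nz: "jfac g z \<noteq> 0" using jfac_nonzero assms by auto
  have d: "real_of_int (ea g) * of_int (ed g) - of_int (eb g) * of_int (ec g) = 1"
    using assms(1) unfolding SL2Z_iff by (metis of_int_1 of_int_diff of_int_mult)
  have "mob g z = (of_int (ea g) * z + of_int (eb g)) * cnj (jfac g z) / of_real ((norm (jfac g z))\<^sup>2)"
    unfolding mob_def jfac_def[symmetric] complex_norm_square using nz by simp
  then have "Im (mob g z) = Im ((of_int (ea g) * z + of_int (eb g)) * cnj (jfac g z)) / (norm (jfac g z))\<^sup>2"
    by (metis Im_divide_of_real)
  also have "Im ((of_int (ea g) * z + of_int (eb g)) * cnj (jfac g z)) = (real_of_int (ea g) * of_int (ed g) - of_int (eb g) * of_int (ec g)) * Im z"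
    by (simp add: jfac_def algebra_simps)
  finally show ?thesis using d by simp
qed

lemma mob_in_Hup: "g \<in> SL2Z \<Longrightarrow> z \<in> Hup \<Longrightarrow> mob g z \<in> Hup"
  using Im_mob[of g z] jfac_nonzero[of g z] by (simp add: Hup_def)

lemma mob_T [simp]: "mob Tmat z = z + 1" and mob_Tinv [simp]: "mob Tinv z = z - 1"
  and mob_S: "mob Smat z = - 1 / z"
  and jfac_T [simp]: "jfac Tmat z = 1" and jfac_Tinv [simp]: "jfac Tinv z = 1"
  and jfac_S [simp]: "jfac Smat z = z"
  by (simp_all add: mob_def jfac_def)

lemma jfac_mult:
  assumes "g \<in> SL2Z" "h \<in> SL2Z" "z \<in> Hup"
  shows "jfac (g ** h) z = jfac g (mob h z) * jfac h z"
proof -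
  have "jfac h z \<noteq> 0" using jfac_nonzero assms by auto
  then show ?thesis unfolding mob_def jfac_def by (simp add: field_simps)
qed

lemma mob_mult:
  assumes "g \<in> SL2Z" "h \<in> SL2Z" "z \<in> Hup"
  shows "mob (g ** h) z = mob g (mob h z)"
proof -
  have h: "jfac h z \<noteq> 0" using jfac_nonzero assms by auto
  have "mob g (mob h z) = ((of_int (ea g) * mob h z + of_int (eb g)) * jfac h z) / (jfac g (mob h z) * jfac h z)"
    using h unfolding mob_def[of g] jfac_def[of g] by simp
  also have "jfac g (mob h z) * jfac h z = jfac (g ** h) z" using jfac_mult assms by simp
  also have "(of_int (ea g) * mob h z + of_int (eb g)) * jfac h z = of_int (ea (g ** h)) * z + of_int (eb (g ** h))"
    using h unfolding mob_def jfac_def by (simp add: field_simps)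
  finally show ?thesis by (simp add: mob_def jfac_def)
qed

lemma mob_has_derivative:
  assumes "g \<in> SL2Z" "z \<in> Hup"
  shows "(mob g has_field_derivative 1 / (jfac g z)\<^sup>2) (at z)"
proof -
  have nz: "of_int (ec g) * z + of_int (ed g) \<noteq> 0" using jfac_nonzero assms by (auto simp: jfac_def)
  have d: "complex_of_int (ea g) * of_int (ed g) - of_int (eb g) * of_int (ec g) = 1"
    using assms(1) unfolding SL2Z_iff by (metis of_int_1 of_int_diff of_int_mult)
  have eq: "(of_int (ea g) * (of_int (ec g) * z + of_int (ed g)) - (of_int (ea g) * z + of_int (eb g)) * of_int (ec g))
     = complex_of_int (ea g) * of_int (ed g) - of_int (eb g) * of_int (ec g)"
    by (simp add: algebra_simps)
  have "((\<lambda>z. (of_int (ea g) * z + of_int (eb g)) / (of_int (ec g) * z + of_int (ed g))) has_field_derivative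
     (of_int (ea g) * (of_int (ec g) * z + of_int (ed g)) - (of_int (ea g) * z + of_int (eb g)) * of_int (ec g))
      / ((of_int (ec g) * z + of_int (ed g)) * (of_int (ec g) * z + of_int (ed g)))) (at z)"
    using nz by (auto intro!: derivative_eq_intros)
  then show ?thesis unfolding eq d by (simp add: mob_def[abs_def] jfac_def power2_eq_square)
qed

lemma jfac_powr_has_derivative:
  assumes "g \<in> SL2Z" "z \<in> Hup"
  shows "((\<lambda>w. jfac g w powr of_real k) has_field_derivative
           of_real k * of_int (ec g) * (jfac g z powr of_real k / jfac g z)) (at z)"
proof (cases "ec g = 0")
  case True
  then show ?thesis by (simp add: jfac_def)
next
  case False
  have nz: "jfac g z \<noteq> 0" using jfac_nonzero assms by auto
  have 1: "(jfac g has_field_derivative of_int (ec g)) (at z)"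
    unfolding jfac_def[abs_def] by (auto intro!: derivative_eq_intros)
  have 2: "((\<lambda>w. w powr of_real k) has_field_derivative of_real k * jfac g z powr (of_real k - 1)) (at (jfac g z))"
    by (rule has_field_derivative_powr) (rule jfac_not_nonpos[OF False assms(2)])
  have 3: "jfac g z powr (of_real k - 1) = jfac g z powr of_real k / jfac g z"
    using nz by (simp add: powr_diff)
  show ?thesis using DERIV_chain2[OF 2 1] unfolding 3 by (simp add: mult_ac)
qed

section \<open>Linear differential equations with holomorphic coefficients\<close>

lemma higher_deriv_sum:
  assumes "finite A" "\<And>i. i \<in> A \<Longrightarrow> f i holomorphic_on S" "open S" "z \<in> S"
  shows "(deriv ^^ n) (\<lambda>w. \<Sum>i\<in>A. f i w) z = (\<Sum>i\<in>A. (deriv ^^ n) (f i) z)"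
  using assms(1,2)
proof (induction A)
  case empty
  then show ?case by simp
next
  case (insert a A)
  have "(deriv ^^ n) (\<lambda>w. f a w + (\<Sum>i\<in>A. f i w)) z = (deriv ^^ n) (f a) z + (deriv ^^ n) (\<lambda>w. \<Sum>i\<in>A. f i w) z"
    using insert.prems assms(3,4) by (intro higher_deriv_add[where S = S] holomorphic_intros) auto
  then show ?case using insert by simp
qed

text \<open>By Leibniz' rule the equation expresses each derivative at \<open>z0\<close> through
  lower ones, so all Taylor coefficients vanish; the identity theorem does the rest. No path or
  existence theory is involved.\<close>

lemma linear_ode_zero:
  fixes Y :: "'n::finite \<Rightarrow> complex \<Rightarrow> complex"
  assumes S: "open S" "connected S"
    and Y: "\<And>i. Y i holomorphic_on S" and m: "\<And>i j. m i j holomorphic_on S"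
    and ode: "\<And>i z. z \<in> S \<Longrightarrow> deriv (Y i) z = (\<Sum>j\<in>UNIV. m i j z * Y j z)"
    and z0: "z0 \<in> S" "\<And>i. Y i z0 = 0" and z: "z \<in> S"
  shows "Y i z = 0"
proof -
  have "\<forall>i. (deriv ^^ n) (Y i) z0 = 0" for n
  proof (induction n rule: less_induct)
    case (less n)
    show ?case
    proof (cases n)
      case 0
      then show ?thesis using z0 by simp
    next
      case (Suc k)
      show ?thesis
      proof
        fix i
        have "(deriv ^^ n) (Y i) z0 = (deriv ^^ k) (deriv (Y i)) z0"
          unfolding Suc by (simp add: funpow_swap1)
        also have "\<dots> = (deriv ^^ k) (\<lambda>w. \<Sum>j\<in>UNIV. m i j w * Y j w) z0"
          using S Y m z0 ode
          by (intro higher_deriv_transform_within_open[where S = S] holomorphic_intros holomorphic_deriv) auto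
        also have "\<dots> = (\<Sum>j\<in>UNIV. (deriv ^^ k) (\<lambda>w. m i j w * Y j w) z0)"
          using S Y m z0 by (intro higher_deriv_sum[where S = S] holomorphic_intros) auto
        also have "\<dots> = 0"
        proof (rule sum.neutral, rule ballI)
          fix j
          have "(deriv ^^ k) (\<lambda>w. m i j w * Y j w) z0 =
            (\<Sum>l = 0..k. of_nat (k choose l) * (deriv ^^ l) (m i j) z0 * (deriv ^^ (k-l)) (Y j) z0)"
            using S Y m z0 by (intro higher_deriv_mult[where S = S]) auto
          also have "\<dots> = 0" using less Suc by (intro sum.neutral) auto
          finally show "(deriv ^^ k) (\<lambda>w. m i j w * Y j w) z0 = 0" .
        qed
        finally show "(deriv ^^ n) (Y i) z0 = 0" .
      qed
    qed
  qed
  then show ?thesis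
    using holomorphic_fun_eq_0_on_connected[OF Y S _ z0(1) z] by blast
qed

lemma linear_ode1_zero:
  assumes "open S" "connected S" "f holomorphic_on S" "m holomorphic_on S"
    and "\<And>z. z \<in> S \<Longrightarrow> deriv f z = m z * f z" "z0 \<in> S" "f z0 = 0" "z \<in> S"
  shows "f z = 0"
  using linear_ode_zero[of S "\<lambda>_::unit. f" "\<lambda>_ _. m" z0 z "()"] assms by simp

section \<open>Expansions at the cusp\<close>

definition qq :: "complex \<Rightarrow> complex" where
  "qq z = exp (2 * of_real pi * \<i> * z)"

lemma norm_qq: "norm (qq z) = exp (- 2 * pi * Im z)"
  by (simp add: qq_def)

lemma qq_nonzero [simp]: "qq z \<noteq> 0"
  by (simp add: qq_def)

lemma qq_in_disc: "z \<in> Hup \<Longrightarrow> qq z \<in> ball 0 1"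
  by (simp add: norm_qq Hup_def)

lemma qq_in_punctured_disc: "z \<in> Hup \<Longrightarrow> qq z \<in> ball 0 1 - {0}"
  by (simp add: norm_qq Hup_def)

lemma qq_has_derivative: "(qq has_field_derivative 2 * of_real pi * \<i> * qq z) (at z)"
  unfolding qq_def[abs_def] by (auto intro!: derivative_eq_intros)

lemma qq_holomorphic [holomorphic_intros]: "qq holomorphic_on S"
  unfolding qq_def[abs_def] by (intro holomorphic_intros)

lemma qq_add: "qq (z + w) = qq z * qq w"
  by (simp add: qq_def exp_add algebra_simps)

lemma qq_1 [simp]: "qq 1 = 1"
  using exp_two_pi_i by (simp add: qq_def mult_ac)

lemma qq_eq_iff: "qq z = qq w \<longleftrightarrow> (\<exists>n::int. z = w + of_int n)"
proof -
  have "(2 * of_real pi * \<i> * z = 2 * of_real pi * \<i> * w + (of_int (2 * n) * pi) * \<i>) \<longleftrightarrow> z = w + of_int n" for n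
  proof -
    have "2 * of_real pi * \<i> * w + (of_int (2 * n) * pi) * \<i> = 2 * of_real pi * \<i> * (w + of_int n)"
      by (simp add: algebra_simps)
    then show ?thesis by simp
  qed
  then show ?thesis by (simp add: qq_def exp_eq)
qed

text \<open>Stated for an arbitrary logarithm \<open>L\<close>, since both \<open>Ln\<close> and
  branches cut elsewhere are used.\<close>

lemma qq_log:
  assumes "exp L = q" "q \<in> ball 0 1"
  shows "qq (L / (2 * of_real pi * \<i>)) = q" "L / (2 * of_real pi * \<i>) \<in> Hup"
proof -
  show 1: "qq (L / (2 * of_real pi * \<i>)) = q" using assms by (simp add: qq_def)
  have "exp (- 2 * pi * Im (L / (2 * of_real pi * \<i>))) < 1"
    using assms(2) unfolding norm_qq[symmetric] 1 by simp
  then show "L / (2 * of_real pi * \<i>) \<in> Hup"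
    by (simp add: Hup_def zero_less_mult_iff)
qed

lemma shift_int_in_Hup [simp]: "z + of_int n \<in> Hup \<longleftrightarrow> z \<in> Hup"
  by (simp add: Hup_def)

lemma periodic_of_int:
  assumes "\<And>z. z \<in> Hup \<Longrightarrow> h (z + 1) = h z" "z \<in> Hup"
  shows "h (z + of_int n) = (h z :: complex)"
proof -
  have *: "h (w + of_nat k) = h w" if "w \<in> Hup" for w k
  proof (induction k)
    case (Suc k)
    have "w + of_nat k \<in> Hup" using that by (simp add: Hup_def)
    from assms(1)[OF this] show ?case using Suc by (simp add: add_ac)
  qed simp
  show ?thesis
  proof (cases "n \<ge> 0")
    case True
    then show ?thesis using *[OF assms(2), of "nat n"] by simp
  next
    case False
    then have "of_nat (nat (- n)) = - (of_int n :: complex)"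
      by (simp add: of_nat_nat)
    then show ?thesis using *[of "z + of_int n" "nat (- n)"] assms(2) by simp
  qed
qed

text \<open>Across the negative axis \<open>Ln q / (2 pi i)\<close> jumps by a period of
  \<open>h\<close>, so \<open>G\<close> does not see the cut. Holomorphy is checked near each point
  with a local branch of the logarithm.\<close>

lemma periodic_descends:
  assumes hol: "h holomorphic_on Hup" and per: "\<And>z. z \<in> Hup \<Longrightarrow> h (z + 1) = h z"
  obtains G where "G holomorphic_on ball 0 1 - {0}" "\<And>z. z \<in> Hup \<Longrightarrow> h z = G (qq z)"
proof
  define G where "G = (\<lambda>q. h (Ln q / (2 * of_real pi * \<i>)))"
  have G_eq: "h w = G (qq w)" if w: "w \<in> Hup" for w
  proof -
    define w' where "w' = Ln (qq w) / (2 * of_real pi * \<i>)"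
    have "qq w' = qq w" unfolding w'_def using qq_log(1)[of "Ln (qq w)"] qq_in_disc[OF w] by simp
    then obtain n :: int where "w' = w + of_int n" using qq_eq_iff by blast
    then have "h w' = h w" using periodic_of_int[where h = h] per w by simp
    then show ?thesis by (simp add: G_def w'_def)
  qed
  then show "\<And>z. z \<in> Hup \<Longrightarrow> h z = G (qq z)" .
  show "G holomorphic_on ball 0 1 - {0}"
  proof -
    have loc: "G holomorphic_on (ball 0 1 \<inter> ball q0 (norm q0))" if q0: "q0 \<noteq> 0" for q0
    proof -
      \<comment> \<open>A branch centred at \<open>q0\<close>: on the disc of radius
        \<open>norm q0\<close> the quotient \<open>q / q0\<close> stays off the cut.\<close>
      define L where "L = (\<lambda>q. Ln (q / q0) + Ln q0)"
      have 1: "q / q0 \<notin> \<real>\<^sub>\<le>\<^sub>0" if "q \<in> ball q0 (norm q0)" for q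
      proof
        assume "q / q0 \<in> \<real>\<^sub>\<le>\<^sub>0"
        then obtain r where r: "r \<le> 0" "q / q0 = of_real r" by (auto elim: nonpos_Reals_cases)
        then have "q = of_real r * q0" using q0 by (simp add: field_simps)
        then have "dist q0 q = norm ((1 - of_real r) * q0)" by (simp add: dist_norm algebra_simps)
        also have "\<dots> = (1 - r) * norm q0"
          using r norm_of_real[of "1 - r", where 'a = complex] by (simp add: norm_mult)
        also have "\<dots> \<ge> 1 * norm q0" using r by (intro mult_right_mono) auto
        finally show False using that by simp
      qed
      have Lhol: "L holomorphic_on ball 0 1 \<inter> ball q0 (norm q0)"
        unfolding L_def using 1 q0 by (intro holomorphic_intros) auto
      have expL: "exp (L q) = q" if "q \<in> ball q0 (norm q0)" for q
      proof -
        have "q / q0 \<noteq> 0" using 1[OF that] by auto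
        then show ?thesis using q0 by (simp add: L_def exp_add)
      qed
      have "(h \<circ> (\<lambda>q. L q / (2 * of_real pi * \<i>))) holomorphic_on ball 0 1 \<inter> ball q0 (norm q0)"
      proof (rule holomorphic_on_compose_gen[OF _ hol])
        show "(\<lambda>q. L q / (2 * of_real pi * \<i>)) holomorphic_on ball 0 1 \<inter> ball q0 (norm q0)"
          by (intro holomorphic_intros Lhol) simp
        show "(\<lambda>q. L q / (2 * of_real pi * \<i>)) ` (ball 0 1 \<inter> ball q0 (norm q0)) \<subseteq> Hup"
          using qq_log(2)[OF expL] by blast
      qed
      then show ?thesis
      proof (rule holomorphic_transform)
        fix q assume "q \<in> ball 0 1 \<inter> ball q0 (norm q0)"
        then have "qq (L q / (2 * of_real pi * \<i>)) = q" "L q / (2 * of_real pi * \<i>) \<in> Hup"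
          using qq_log[OF expL] by auto
        then show "(h \<circ> (\<lambda>q. L q / (2 * of_real pi * \<i>))) q = G q" using G_eq by fastforce
      qed
    qed
    have "ball 0 1 - {0} = (\<Union>q0\<in>ball 0 1 - {0::complex}. ball 0 1 \<inter> ball q0 (norm q0))"
      by (auto simp: dist_norm)
    then show ?thesis
      using holomorphic_on_UN_open[of "ball 0 1 - {0}" G "\<lambda>q0. ball 0 1 \<inter> ball q0 (norm q0)"] loc by (simp add: open_Int)
  qed
qed

text \<open>Order at least \<open>l\<close> at the cusp, since \<open>G 0 = 0\<close> is allowed.
  The exponent is real, so \<open>q^l\<close> has to be written in the variable
  \<open>z\<close>.\<close>

definition qexp :: "real \<Rightarrow> (complex \<Rightarrow> complex) \<Rightarrow> bool" where
  "qexp l f \<longleftrightarrow> (\<exists>G. G holomorphic_on ball 0 1 \<and>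
     (\<forall>z\<in>Hup. f z = exp (2 * of_real pi * \<i> * of_real l * z) * G (qq z)))"

lemma qexp0_iff: "qexp 0 f \<longleftrightarrow> (\<exists>G. G holomorphic_on ball 0 1 \<and> (\<forall>z\<in>Hup. f z = G (qq z)))"
  by (simp add: qexp_def)

lemma ee_shift: "exp (2 * of_real pi * \<i> * of_real l * (z + 1)) = ee l * exp (2 * of_real pi * \<i> * of_real l * z)"
  by (simp add: ee_def exp_add algebra_simps)

lemma ee_nonzero [simp]: "ee r \<noteq> 0"
  by (simp add: ee_def)

lemma ee_inj:
  assumes "ee a = ee b" "0 \<le> a" "a < 1" "0 \<le> b" "b < 1"
  shows "a = b"
proof -
  have "qq (of_real a) = qq (of_real b)" using assms(1) by (simp add: ee_def qq_def)
  then obtain n :: int where "complex_of_real a = of_real b + of_int n" using qq_eq_iff by blast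
  then have "a = b + of_int n" by (metis Re_complex_of_real of_real_add of_real_of_int_eq)
  moreover from this have "n = 0" using assms by linarith
  ultimately show ?thesis by simp
qed

lemma ee_add: "ee (a + b) = ee a * ee b"
  by (simp add: ee_def exp_add algebra_simps)

lemma ee_frac: "ee (frac a) = ee a"
proof -
  have "ee (of_int \<lfloor>a\<rfloor>) = 1"
    using qq_eq_iff[of "of_int \<lfloor>a\<rfloor>" 0] by (auto simp: ee_def qq_def)
  then show ?thesis using ee_add[of "frac a" "of_int \<lfloor>a\<rfloor>"] by (simp add: frac_def)
qed

text \<open>Moderate growth leaves at most \<open>y powr N * exp (2 * pi * l * y)\<close> with \<open>l < 1\<close>, which is
  less than a simple pole at \<open>q = 0\<close>.\<close>

lemma qexpI:
  assumes hol: "f holomorphic_on Hup" and mod: "moderate_growth f" and l: "0 \<le> l" "l < 1"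
    and per: "\<And>z. z \<in> Hup \<Longrightarrow> f (z + 1) = ee l * f z"
  shows "qexp l f"
proof -
  define h where "h = (\<lambda>z. f z * exp (- (2 * of_real pi * \<i> * of_real l * z)))"
  have h: "h holomorphic_on Hup" unfolding h_def by (intro holomorphic_intros hol)
  have "h (z + 1) = h z" if "z \<in> Hup" for z
    using per[OF that] unfolding h_def exp_minus ee_shift by simp
  then obtain G where G: "G holomorphic_on ball 0 1 - {0}" "\<And>z. z \<in> Hup \<Longrightarrow> h z = G (qq z)"
    using periodic_descends[OF h] by metis
  obtain N c where N: "N > 0" "c > 0" "\<And>x y. y > c \<Longrightarrow> norm (f (Complex x y)) \<le> y powr N"
    using mod unfolding moderate_growth_def by blast
  \<comment> \<open>\<open>Y q\<close> is the imaginary part of every preimage of \<open>q\<close>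
    under \<open>qq\<close>.\<close>
  define Y where "Y = (\<lambda>q::complex. - ln (norm q) / (2 * pi))"
  have Ylim: "filterlim Y at_top (at 0)"
  proof -
    have "filterlim (\<lambda>x. - ln x / (2 * pi)) at_top (at_right 0)" by real_asymp
    moreover have "filterlim (norm :: complex \<Rightarrow> real) (at_right 0) (at 0)"
      unfolding filterlim_at by (auto simp: eventually_at_filter intro!: tendsto_norm_zero)
    ultimately show ?thesis unfolding Y_def by (rule filterlim_compose)
  qed
  have bound: "norm ((q - 0) * G q) \<le> exp (- 2 * pi * Y q) * (Y q powr N * exp (2 * pi * l * Y q))"
    if q: "q \<in> ball 0 1 - {0}" and c: "Y q > c" for q
  proof -
    define z where "z = Ln q / (2 * of_real pi * \<i>)"
    have z: "qq z = q" "z \<in> Hup" unfolding z_def using qq_log[of "Ln q"] q by auto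
    have Imz: "Im z = Y q" using norm_qq[of z] z(1) by (simp add: Y_def)
    have nq: "norm q = exp (- 2 * pi * Y q)" using norm_qq[of z] z(1) Imz by simp
    have "norm (f (Complex (Re z) (Im z))) \<le> Im z powr N" using N(3) Imz c by metis
    then have "norm (f z) \<le> Y q powr N" unfolding Imz[symmetric] by simp
    moreover have "norm (exp (- (2 * of_real pi * \<i> * of_real l * z))) = exp (2 * pi * l * Y q)"
      unfolding norm_exp_eq_Re Imz[symmetric] by simp
    ultimately have "norm (h z) \<le> Y q powr N * exp (2 * pi * l * Y q)"
      unfolding h_def norm_mult by (intro mult_mono) auto
    then have "norm (G q) \<le> Y q powr N * exp (2 * pi * l * Y q)" unfolding G(2)[OF z(2)] z(1) .
    then show ?thesis unfolding norm_mult diff_zero nq by (rule mult_left_mono) simp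
  qed
  have "((\<lambda>q. (q - 0) * G q) \<longlongrightarrow> 0) (at 0)"
  proof (rule Lim_null_comparison)
    have "((\<lambda>y. exp (- 2 * pi * y) * (y powr N * exp (2 * pi * l * y))) \<longlongrightarrow> 0) at_top"
    proof -
      define a where "a = 2 * pi * (1 - l)"
      have "a > 0" using l by (simp add: a_def)
      then have "((\<lambda>y. y powr N * exp (- a * y)) \<longlongrightarrow> 0) at_top" by real_asymp
      then have "((\<lambda>y. y powr N * exp (- (2 * pi * (1 - l)) * y)) \<longlongrightarrow> 0) at_top"
        unfolding a_def .
      moreover have "y powr N * exp (- (2 * pi * (1 - l)) * y) = exp (- 2 * pi * y) * (y powr N * exp (2 * pi * l * y))" for y
        by (simp add: exp_add[symmetric] algebra_simps)
      ultimately show ?thesis by (simp only:)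
    qed
    then show "((\<lambda>q. exp (- 2 * pi * Y q) * (Y q powr N * exp (2 * pi * l * Y q))) \<longlongrightarrow> 0) (at 0)"
      using Ylim by (rule filterlim_compose)
    have "eventually (\<lambda>q. q \<in> ball 0 1 - {0::complex}) (at 0)"
      by (rule eventually_at_in_open) auto
    moreover have "eventually (\<lambda>q. Y q > c) (at 0)" using Ylim unfolding filterlim_at_top_dense by blast
    ultimately show "eventually (\<lambda>q. norm ((q - 0) * G q) \<le> exp (- 2 * pi * Y q) * (Y q powr N * exp (2 * pi * l * Y q))) (at 0)"
      by eventually_elim (rule bound)
  qed
  \<comment> \<open>Riemann's removable singularity theorem.\<close>
  then obtain G' where G': "G' holomorphic_on ball 0 1" "\<And>q. q \<in> ball 0 1 - {0} \<Longrightarrow> G' q = G q"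
    using holomorphic_on_extend_lim[of G "ball 0 1" 0] G(1) by auto
  have "f z = exp (2 * of_real pi * \<i> * of_real l * z) * G' (qq z)" if "z \<in> Hup" for z
  proof -
    have "G' (qq z) = h z" using G'(2)[OF qq_in_punctured_disc[OF that]] G(2)[OF that] by simp
    then show ?thesis by (simp add: h_def exp_minus)
  qed
  with G'(1) show ?thesis unfolding qexp_def by (intro exI[of _ G']) auto
qed

lemma holomorphic_compose_qq:
  assumes "G holomorphic_on ball 0 1"
  shows "(\<lambda>z. G (qq z)) holomorphic_on Hup"
proof -
  have "qq ` Hup \<subseteq> ball 0 1" using qq_in_disc by blast
  then show ?thesis using holomorphic_on_compose_gen[OF qq_holomorphic assms, of Hup] by (simp add: o_def)
qed

lemma qexp_holomorphic:
  assumes "qexp l f"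
  shows "f holomorphic_on Hup"
proof -
  obtain G where G: "G holomorphic_on ball 0 1"
     "\<And>z. z \<in> Hup \<Longrightarrow> f z = exp (2 * of_real pi * \<i> * of_real l * z) * G (qq z)"
    using assms unfolding qexp_def by blast
  show ?thesis
    by (rule holomorphic_transform[where f = "\<lambda>z. exp (2 * of_real pi * \<i> * of_real l * z) * G (qq z)"])
       (auto intro!: holomorphic_intros holomorphic_compose_qq G simp: G(2))
qed

lemma qexp_bounded:
  assumes "qexp l f" "l \<ge> 0"
  obtains K where "\<And>z. Im z \<ge> 1 \<Longrightarrow> norm (f z) \<le> K"
proof -
  obtain G where G: "G holomorphic_on ball 0 1"
     "\<And>z. z \<in> Hup \<Longrightarrow> f z = exp (2 * of_real pi * \<i> * of_real l * z) * G (qq z)"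
    using assms unfolding qexp_def by blast
  have "exp (- 2 * pi) < 1" by simp
  then have "compact (G ` cball 0 (exp (- 2 * pi)))"
    by (intro compact_continuous_image holomorphic_on_imp_continuous_on holomorphic_on_subset[OF G(1)])
       (auto simp del: exp_less_one_iff)
  then obtain K where "\<forall>q\<in>cball 0 (exp (- 2 * pi)). norm (G q) \<le> K"
    using compact_imp_bounded[of "G ` cball 0 (exp (- 2 * pi))"] unfolding bounded_iff by (auto simp: image_iff)
  then have K: "norm (G q) \<le> K" if "norm q \<le> exp (- 2 * pi)" for q using that by simp
  show ?thesis
  proof (rule that)
    fix z assume z: "Im z \<ge> 1"
    have "norm (G (qq z)) \<le> K" using z by (intro K) (simp add: norm_qq)
    moreover have "norm (exp (2 * of_real pi * \<i> * of_real l * z)) \<le> 1" using z assms(2) by simp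
    ultimately show "norm (f z) \<le> K"
      using G(2)[of z] z mult_mono[of "norm (exp (2 * of_real pi * \<i> * of_real l * z))" 1 "norm (G (qq z))" K]
      by (simp add: Hup_def norm_mult)
  qed
qed

lemma bounded_moderate_growth:
  assumes "\<And>z. Im z \<ge> 1 \<Longrightarrow> norm (f z) \<le> K"
  shows "moderate_growth f"
proof -
  have "norm (f (Complex x y)) \<le> y powr 1" if "y > max 1 K" for x y
    using assms[of "Complex x y"] that by simp
  then show ?thesis unfolding moderate_growth_def
    by (metis less_max_iff_disj zero_less_one)
qed

lemma qexp_moderate_growth: "qexp l f \<Longrightarrow> l \<ge> 0 \<Longrightarrow> moderate_growth f"
  by (metis qexp_bounded bounded_moderate_growth)

section \<open>The eta product in the variable q\<close>

definition phi :: "complex \<Rightarrow> complex" where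
  "phi q = (\<Prod>n. 1 - q ^ Suc n)"

text \<open>\<open>P\<close> in the variable \<open>q\<close>: the factor
  \<open>(i / pi) * 2 pi i = -2\<close> times the logarithmic derivative \<open>q d/dq\<close> of
  \<open>q^(1/24) * phi q\<close>.\<close>

definition Pq :: "complex \<Rightarrow> complex" where
  "Pq q = - (1 / 12) - 2 * q * deriv phi q / phi q"

lemma phi_convergent:
  fixes q :: complex
  assumes "norm q < 1"
  shows "convergent_prod (\<lambda>n. 1 - q ^ Suc n)"
proof -
  have "summable (\<lambda>n. norm (q ^ Suc n))"
    using assms by (simp add: norm_power norm_mult summable_geometric summable_mult)
  then have "summable (\<lambda>n. norm ((1 - q ^ Suc n) - 1))"
    by (simp add: norm_minus_cancel)
  then show ?thesis
    using abs_convergent_prod_conv_summable abs_convergent_prod_imp_convergent_prod by blast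
qed

lemma phi_nonzero:
  assumes "norm q < 1"
  shows "phi q \<noteq> 0"
  unfolding phi_def
proof (rule prodinf_nonzero[OF phi_convergent[OF assms]])
  fix n
  have "norm (q ^ Suc n) < 1" using assms by (simp add: norm_power power_less_one_iff del: power_Suc)
  then show "1 - q ^ Suc n \<noteq> 0" by auto
qed

lemma phi_0 [simp]: "phi 0 = 1"
  by (simp add: phi_def)

lemma phi_holomorphic: "phi holomorphic_on ball 0 1"
proof (rule holomorphic_uniform_sequence[where f = "\<lambda>N q. \<Prod>n<N. 1 - q ^ Suc n"])
  fix x :: complex assume x: "x \<in> ball 0 1"
  then obtain d where d: "d > 0" "cball x d \<subseteq> ball 0 1" by (meson open_ball open_contains_cball)
  define r where "r = norm x + d"
  have r: "r < 1" "r \<ge> 0"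
  proof -
    show "r \<ge> 0" using d by (simp add: r_def)
    \<comment> \<open>The point of the closed disc farthest from the origin: its norm is
      \<open>r\<close>, so \<open>r < 1\<close> because the disc lies in the unit disc.\<close>
    define y where "y = x + of_real d * (if x = 0 then 1 else sgn x)"
    have "norm (of_real d * (if x = 0 then 1 else sgn x)) = d" using d by (simp add: norm_mult norm_sgn)
    then have "y \<in> cball x d" by (simp add: y_def dist_norm)
    then have "norm y < 1" using d by auto
    moreover have "norm y = r"
    proof (cases "x = 0")
      case True
      then show ?thesis using d by (simp add: y_def r_def)
    next
      case False
      have "y = of_real (norm x + d) * sgn x"
        using False by (simp add: y_def sgn_eq algebra_simps)
      then show ?thesis using False d unfolding r_def by (simp only: norm_mult norm_of_real norm_sgn) simp
    qed
    ultimately show "r < 1" by simp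
  qed
  have nle: "norm q \<le> r" if "q \<in> cball x d" for q
  proof -
    have "norm q \<le> norm x + norm (q - x)" by (metis add.commute diff_add_cancel norm_triangle_ineq)
    also have "norm (q - x) \<le> d" using that by (simp add: dist_norm norm_minus_commute)
    finally show ?thesis by (simp add: r_def)
  qed
  have "uniformly_convergent_on (cball x d) (\<lambda>N q. \<Prod>n<N. 1 - q ^ Suc n)"
  proof (rule uniformly_convergent_on_prod')
    show "uniformly_convergent_on (cball x d) (\<lambda>N q. \<Sum>n<N. norm ((1 - q ^ Suc n) - 1))"
    proof (rule Weierstrass_m_test')
      show "summable (\<lambda>n. r ^ Suc n)" using r by (simp add: summable_geometric summable_mult)
      show "norm (norm ((1 - q ^ Suc n) - 1)) \<le> r ^ Suc n" if "q \<in> cball x d" for n q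
        using power_mono[OF nle[OF that], of "Suc n"] by (simp add: norm_power norm_mult)
    qed
  qed (auto intro!: continuous_intros)
  moreover have "lim (\<lambda>N. \<Prod>n<N. 1 - q ^ Suc n) = phi q" if "q \<in> cball x d" for q
  proof -
    have q: "norm q < 1" using nle[OF that] r by simp
    have "1 - q ^ Suc n \<noteq> 0" for n
    proof -
      have "norm (q ^ Suc n) < 1" using q by (simp add: norm_power power_less_one_iff del: power_Suc)
      then show ?thesis by auto
    qed
    then show ?thesis unfolding phi_def by (intro prodinf_eq_lim'[symmetric] phi_convergent q)
  qed
  ultimately have "uniform_limit (cball x d) (\<lambda>N q. \<Prod>n<N. 1 - q ^ Suc n) phi sequentially"
    unfolding uniformly_convergent_uniform_limit_iff
    unfolding uniform_limit_iff by simp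
  then show "\<exists>d>0. cball x d \<subseteq> ball 0 1 \<and> uniform_limit (cball x d) (\<lambda>N q. \<Prod>n<N. 1 - q ^ Suc n) phi sequentially"
    using d by blast
qed (auto intro!: holomorphic_intros)

lemma Pq_holomorphic: "Pq holomorphic_on ball 0 1"
  unfolding Pq_def[abs_def]
  by (intro holomorphic_intros phi_holomorphic holomorphic_deriv) (auto simp: phi_nonzero)

lemma Pq_0 [simp]: "Pq 0 = - (1 / 12)"
  by (simp add: Pq_def)

lemma compose_qq_has_derivative:
  assumes "G holomorphic_on ball 0 1" "z \<in> Hup"
  shows "((\<lambda>z. G (qq z)) has_field_derivative deriv G (qq z) * (2 * of_real pi * \<i> * qq z)) (at z)"
  by (rule DERIV_chain2[OF _ qq_has_derivative])
     (meson assms holomorphic_derivI open_ball qq_in_disc)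

lemma eta_eq: "eta z = exp (2 * of_real pi * \<i> * z / 24) * phi (qq z)"
proof -
  have "exp (2 * of_real pi * \<i> * of_nat (Suc n) * z) = qq z ^ Suc n" for n
    unfolding qq_def exp_of_nat_mult[symmetric] by (simp add: mult_ac)
  then show ?thesis by (simp add: eta_def phi_def del: power_Suc of_nat_Suc)
qed

lemma Pfun_eq:
  assumes z: "z \<in> Hup"
  shows "Pfun z = Pq (qq z)"
proof -
  define e where "e = exp (2 * of_real pi * \<i> * z / 24)"
  define q where "q = qq z"
  have e: "((\<lambda>z. exp (2 * of_real pi * \<i> * z / 24)) has_field_derivative e * (2 * of_real pi * \<i> / 24)) (at z)"
    unfolding e_def by (auto intro!: derivative_eq_intros simp: mult_ac)
  have "(eta has_field_derivative e * (2 * of_real pi * \<i> / 24) * phi q + deriv phi q * (2 * of_real pi * \<i> * q) * e) (at z)"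
    using DERIV_mult[OF e compose_qq_has_derivative[OF phi_holomorphic z]]
    unfolding eta_eq[abs_def] e_def q_def .
  then have d: "deriv eta z = e * (2 * of_real pi * \<i> / 24) * phi q + deriv phi q * (2 * of_real pi * \<i> * q) * e"
    by (rule DERIV_imp_deriv)
  have nz: "e \<noteq> 0" "phi q \<noteq> 0" using phi_nonzero qq_in_disc[OF z] by (auto simp: e_def q_def)
  have ld: "deriv eta z / eta z = 2 * of_real pi * \<i> * (1 / 24 + q * deriv phi q / phi q)"
    unfolding d eta_eq e_def[symmetric] q_def[symmetric] using nz by (simp add: field_simps)
  show ?thesis unfolding Pfun_def Pq_def q_def[symmetric] ld
    by (simp add: field_simps)
qed

lemma Pfun_holomorphic: "Pfun holomorphic_on Hup"
  by (rule holomorphic_transform[OF holomorphic_compose_qq[OF Pq_holomorphic]]) (simp add: Pfun_eq)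

text \<open>\<open>(1 / (2 pi i)) d/dz\<close> is \<open>q d/dq\<close>, so the order at the cusp
  does not drop. The explicit factor is kept because the behaviour of the Wronskian at
  \<open>q = 0\<close> is read off from it.\<close>

lemma Dsc_qexp:
  assumes G: "G holomorphic_on ball 0 1"
    and f: "\<And>z. z \<in> Hup \<Longrightarrow> f z = exp (2 * of_real pi * \<i> * of_real l * z) * G (qq z)"
    and z: "z \<in> Hup"
  shows "Dsc k f z = exp (2 * of_real pi * \<i> * of_real l * z) *
     (of_real l * G (qq z) + qq z * deriv G (qq z) + of_real k * Pq (qq z) * G (qq z))"
proof -
  define e where "e = exp (2 * of_real pi * \<i> * of_real l * z)"
  have e: "((\<lambda>z. exp (2 * of_real pi * \<i> * of_real l * z)) has_field_derivative e * (2 * of_real pi * \<i> * of_real l)) (at z)"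
    unfolding e_def by (auto intro!: derivative_eq_intros)
  have "((\<lambda>z. exp (2 * of_real pi * \<i> * of_real l * z) * G (qq z)) has_field_derivative
     e * (2 * of_real pi * \<i> * of_real l) * G (qq z) + deriv G (qq z) * (2 * of_real pi * \<i> * qq z) * e) (at z)"
    using DERIV_mult[OF e compose_qq_has_derivative[OF G z]] unfolding e_def by simp
  then have "(f has_field_derivative
     e * (2 * of_real pi * \<i> * of_real l) * G (qq z) + deriv G (qq z) * (2 * of_real pi * \<i> * qq z) * e) (at z)"
    by (rule has_field_derivative_transform_within_open[OF _ open_Hup z]) (simp add: f)
  then have "deriv f z = e * (2 * of_real pi * \<i> * of_real l) * G (qq z) + deriv G (qq z) * (2 * of_real pi * \<i> * qq z) * e"
    by (rule DERIV_imp_deriv)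
  then show ?thesis unfolding Dsc_def Pfun_eq[OF z] f[OF z] e_def[symmetric] by (simp add: field_simps)
qed

lemma qexp_Dsc:
  assumes "qexp l f"
  shows "qexp l (Dsc k f)"
proof -
  obtain G where G: "G holomorphic_on ball 0 1"
     "\<And>z. z \<in> Hup \<Longrightarrow> f z = exp (2 * of_real pi * \<i> * of_real l * z) * G (qq z)"
    using assms unfolding qexp_def by blast
  show ?thesis unfolding qexp_def
  proof (intro exI conjI ballI)
    show "(\<lambda>q. of_real l * G q + q * deriv G q + of_real k * Pq q * G q) holomorphic_on ball 0 1"
      by (intro holomorphic_intros G Pq_holomorphic holomorphic_deriv) auto
  qed (rule Dsc_qexp[OF G])
qed

lemma qexp_mult:
  assumes "qexp l f" "qexp l' g"
  shows "qexp (l + l') (\<lambda>z. f z * g z)"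
proof -
  obtain G where G: "G holomorphic_on ball 0 1"
     "\<And>z. z \<in> Hup \<Longrightarrow> f z = exp (2 * of_real pi * \<i> * of_real l * z) * G (qq z)"
    using assms(1) unfolding qexp_def by blast
  obtain G' where G': "G' holomorphic_on ball 0 1"
     "\<And>z. z \<in> Hup \<Longrightarrow> g z = exp (2 * of_real pi * \<i> * of_real l' * z) * G' (qq z)"
    using assms(2) unfolding qexp_def by blast
  show ?thesis unfolding qexp_def
    by (rule exI[of _ "\<lambda>q. G q * G' q"])
       (auto intro!: holomorphic_intros G G' simp: G(2) G'(2) algebra_simps exp_add)
qed

lemma qexp_add:
  assumes "qexp l f" "qexp l g"
  shows "qexp l (\<lambda>z. f z + g z)"
proof -
  obtain G where G: "G holomorphic_on ball 0 1"
     "\<And>z. z \<in> Hup \<Longrightarrow> f z = exp (2 * of_real pi * \<i> * of_real l * z) * G (qq z)"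
    using assms(1) unfolding qexp_def by blast
  obtain G' where G': "G' holomorphic_on ball 0 1"
     "\<And>z. z \<in> Hup \<Longrightarrow> g z = exp (2 * of_real pi * \<i> * of_real l * z) * G' (qq z)"
    using assms(2) unfolding qexp_def by blast
  show ?thesis unfolding qexp_def
    by (rule exI[of _ "\<lambda>q. G q + G' q"])
       (auto intro!: holomorphic_intros G G' simp: G(2) G'(2) algebra_simps)
qed

lemma qexp_cmult:
  assumes "qexp l f"
  shows "qexp l (\<lambda>z. c * f z)"
proof -
  have "qexp 0 (\<lambda>_. c)" unfolding qexp0_iff by (intro exI[of _ "\<lambda>_. c"]) auto
  from qexp_mult[OF this assms] show ?thesis by simp
qed

lemma qexp_zero: "qexp l (\<lambda>_. 0)"
  unfolding qexp_def by (intro exI[of _ "\<lambda>_. 0"]) auto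

lemma qexp_cong: "(\<And>z. z \<in> Hup \<Longrightarrow> f z = g z) \<Longrightarrow> qexp l f \<longleftrightarrow> qexp l g"
  by (simp add: qexp_def)

section \<open>Transformation behaviour of the Serre derivative\<close>

text \<open>Differentiating \<open>(cz+d)^k\<close> contributes \<open>k * c / (cz+d)\<close>.
  Collected with \<open>P\<close> at the moved point, this gives an affine weight 2 slash of
  \<open>P\<close> that does not depend on \<open>k\<close>.\<close>

definition slashP :: "mat2 \<Rightarrow> complex \<Rightarrow> complex" where
  "slashP g z = Pfun (mob g z) / (jfac g z)\<^sup>2 + of_int (ec g) / (2 * of_real pi * \<i> * jfac g z)"

text \<open>The law of \<open>- E_2 / 12\<close>.\<close>

definition quasimodular_P :: bool where
  "quasimodular_P \<longleftrightarrow> (\<forall>g\<in>SL2Z. \<forall>z\<in>Hup. slashP g z = Pfun z)"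

lemma jfac_powr_add2:
  assumes "g \<in> SL2Z" "z \<in> Hup"
  shows "jfac g z powr of_real (k + 2) = jfac g z powr of_real k * (jfac g z)\<^sup>2"
proof -
  have "jfac g z powr 2 = (jfac g z)\<^sup>2" using jfac_nonzero[OF assms] powr_numeral by auto
  then show ?thesis by (simp add: powr_add)
qed

text \<open>\<open>h\<close> is kept apart from \<open>f\<close> so that factors depending on
  \<open>g\<close>, such as the multiplier and the matrix of the representation, can be absorbed
  into it.\<close>

lemma Dsc_mob:
  assumes f: "f holomorphic_on Hup" and h: "h holomorphic_on Hup" and g: "g \<in> SL2Z"
    and tr: "\<And>z. z \<in> Hup \<Longrightarrow> f (mob g z) = jfac g z powr of_real k * h z"
    and z: "z \<in> Hup"
  shows "Dsc k f (mob g z) = jfac g z powr of_real (k + 2) *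
            (deriv h z / (2 * of_real pi * \<i>) + of_real k * slashP g z * h z)"
proof -
  define j where "j = jfac g z"
  define p where "p = j powr of_real k"
  define c where "c = complex_of_int (ec g)"
  have j: "j \<noteq> 0" using jfac_nonzero g z by (simp add: j_def)
  have df: "(f has_field_derivative deriv f (mob g z)) (at (mob g z))"
    using f mob_in_Hup[OF g z] holomorphic_derivI open_Hup by blast
  have dh: "(h has_field_derivative deriv h z) (at z)"
    using h z holomorphic_derivI open_Hup by blast
  have 1: "((\<lambda>z. f (mob g z)) has_field_derivative deriv f (mob g z) * (1 / j\<^sup>2)) (at z)"
    using DERIV_chain2[OF df mob_has_derivative[OF g z]] by (simp add: j_def)
  have "((\<lambda>z. jfac g z powr of_real k * h z) has_field_derivative
      (of_real k * c * (p / j)) * h z + deriv h z * p) (at z)"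
    using DERIV_mult[OF jfac_powr_has_derivative[OF g z] dh] by (simp add: j_def p_def c_def)
  then have "((\<lambda>z. f (mob g z)) has_field_derivative
      (of_real k * c * (p / j)) * h z + deriv h z * p) (at z)"
    by (rule has_field_derivative_transform_within_open[OF _ open_Hup z]) (simp add: tr)
  from DERIV_unique[OF 1 this] have d: "deriv f (mob g z) = j\<^sup>2 * ((of_real k * c * (p / j)) * h z + deriv h z * p)"
    using j by (simp add: field_simps)
  show ?thesis
    unfolding Dsc_def d jfac_powr_add2[OF g z] tr[OF z] slashP_def
    unfolding j_def[symmetric] p_def[symmetric] c_def[symmetric]
    using j by (simp add: field_simps power2_eq_square)
qed

lemma Dsc_mob_quasi:
  assumes "quasimodular_P"
    and f: "f holomorphic_on Hup" and h: "h holomorphic_on Hup" and g: "g \<in> SL2Z"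
    and tr: "\<And>z. z \<in> Hup \<Longrightarrow> f (mob g z) = jfac g z powr of_real k * h z"
    and z: "z \<in> Hup"
  shows "Dsc k f (mob g z) = jfac g z powr of_real (k + 2) * Dsc k h z"
  using Dsc_mob[OF f h g tr z] assms(1) g z by (simp add: quasimodular_P_def Dsc_def)

section \<open>Modular forms of level one\<close>

lemma ee_0 [simp]: "ee 0 = 1"
  by (simp add: ee_def)

text \<open>Under invariance by \<open>T\<close>, moderate growth amounts to holomorphy at the cusp;
  from here on forms are handled through their expansions in \<open>q\<close>.\<close>

lemma MF_iff:
  "f \<in> MF j \<longleftrightarrow> (\<forall>z. z \<notin> Hup \<longrightarrow> f z = 0) \<and> qexp 0 f \<and>
     (\<forall>g\<in>SL2Z. \<forall>z\<in>Hup. f (mob g z) = jfac g z powi j * f z)"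
proof
  assume f: "f \<in> MF j"
  have "f (z + 1) = ee 0 * f z" if "z \<in> Hup" for z
  proof -
    have "f (mob Tmat z) = jfac Tmat z powi j * f z" using f that SL2Z_generators(1) unfolding MF_def by blast
    then show ?thesis by simp
  qed
  then have "qexp 0 f" using f by (intro qexpI) (auto simp: MF_def)
  then show "(\<forall>z. z \<notin> Hup \<longrightarrow> f z = 0) \<and> qexp 0 f \<and>
     (\<forall>g\<in>SL2Z. \<forall>z\<in>Hup. f (mob g z) = jfac g z powi j * f z)"
    using f by (simp add: MF_def)
next
  assume "(\<forall>z. z \<notin> Hup \<longrightarrow> f z = 0) \<and> qexp 0 f \<and>
     (\<forall>g\<in>SL2Z. \<forall>z\<in>Hup. f (mob g z) = jfac g z powi j * f z)"
  then show "f \<in> MF j"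
    using qexp_holomorphic[of 0 f] qexp_moderate_growth[of 0 f] by (simp add: MF_def)
qed

lemma MF_off: "f \<in> MF j \<Longrightarrow> z \<notin> Hup \<Longrightarrow> f z = 0"
  by (simp add: MF_def)

lemma MF_holomorphic: "f \<in> MF j \<Longrightarrow> f holomorphic_on Hup"
  by (simp add: MF_def)

lemma MF_mob: "f \<in> MF j \<Longrightarrow> g \<in> SL2Z \<Longrightarrow> z \<in> Hup \<Longrightarrow> f (mob g z) = jfac g z powi j * f z"
  by (simp add: MF_def)

lemma MF_S: "f \<in> MF j \<Longrightarrow> z \<in> Hup \<Longrightarrow> f (- 1 / z) = z powi j * f z"
  using MF_mob[of f j Smat z] by (simp add: mob_S)

lemma MF_zero: "(\<lambda>_. 0) \<in> MF j" "0 \<in> MF j"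
  by (auto simp: MF_iff qexp_zero zero_fun_def)

lemma MF_cmult: "f \<in> MF j \<Longrightarrow> (\<lambda>z. c * f z) \<in> MF j"
  by (auto simp: MF_iff qexp_cmult)

lemma MF_add: "f \<in> MF j \<Longrightarrow> g \<in> MF j \<Longrightarrow> (\<lambda>z. f z + g z) \<in> MF j"
  by (auto simp: MF_iff qexp_add algebra_simps)

lemma MF_diff: "f \<in> MF j \<Longrightarrow> g \<in> MF j \<Longrightarrow> (\<lambda>z. f z - g z) \<in> MF j"
  using MF_add[of f j "\<lambda>z. - 1 * g z"] MF_cmult[of g j "-1"] by simp

lemma MF_mult:
  assumes "f \<in> MF i" "g \<in> MF j"
  shows "(\<lambda>z. f z * g z) \<in> MF (i + j)"
  using assms qexp_mult[of 0 f 0 g] jfac_nonzero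
  by (auto simp: MF_iff power_int_add)

lemma MF_power:
  assumes "f \<in> MF j"
  shows "n > 0 \<Longrightarrow> (\<lambda>z. f z ^ n) \<in> MF (int n * j)"
proof (induction n rule: nat_induct_non_zero)
  case 1
  then show ?case using assms by simp
next
  case (Suc n)
  have "j + int n * j = int (Suc n) * j" by (simp add: algebra_simps)
  then show ?case using MF_mult[OF assms Suc(2)] by simp
qed

subsection \<open>The constant term\<close>

text \<open>The constant term of the \<open>q\<close>-expansion, as a relation, so that no expansion
  has to be chosen.\<close>

definition at_cusp :: "(complex \<Rightarrow> complex) \<Rightarrow> complex \<Rightarrow> bool" where
  "at_cusp f c \<longleftrightarrow> (\<exists>G. G holomorphic_on ball 0 1 \<and> G 0 = c \<and> (\<forall>z\<in>Hup. f z = G (qq z)))"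

lemma at_cuspI:
  assumes "G holomorphic_on ball 0 1" "G 0 = c" "\<And>z. z \<in> Hup \<Longrightarrow> f z = G (qq z)"
  shows "at_cusp f c"
  using assms unfolding at_cusp_def by blast

lemma at_cusp_exists: "f \<in> MF j \<Longrightarrow> \<exists>c. at_cusp f c"
  by (auto simp: MF_iff qexp0_iff at_cusp_def)

lemma at_cusp_mult: "at_cusp f a \<Longrightarrow> at_cusp g b \<Longrightarrow> at_cusp (\<lambda>z. f z * g z) (a * b)"
  unfolding at_cusp_def
  by (elim exE conjE, rule_tac x = "\<lambda>q. G q * Ga q" in exI) (auto intro!: holomorphic_intros)

lemma at_cusp_const: "at_cusp (\<lambda>_. a) a"
  by (rule at_cuspI[of "\<lambda>_. a"]) auto

lemma at_cusp_power: "at_cusp f a \<Longrightarrow> at_cusp (\<lambda>z. f z ^ n) (a ^ n)"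
  by (induction n) (simp_all add: at_cusp_const at_cusp_mult)

lemma at_cusp_diff: "at_cusp f a \<Longrightarrow> at_cusp g b \<Longrightarrow> at_cusp (\<lambda>z. f z - g z) (a - b)"
  unfolding at_cusp_def
  by (elim exE conjE, rule_tac x = "\<lambda>q. G q - Ga q" in exI) (auto intro!: holomorphic_intros)

lemma at_cusp_cmult: "at_cusp f a \<Longrightarrow> at_cusp (\<lambda>z. b * f z) (b * a)"
  using at_cusp_mult[OF at_cusp_const] .

text \<open>The points \<open>\<i> * t\<close> run into the cusp, so the constant term is a limit of
  values of \<open>f\<close> and independent of the choice of \<open>G\<close>.\<close>

lemma at_cusp_limit:
  assumes "at_cusp f a"
  shows "((\<lambda>t. f (\<i> * of_real t)) \<longlongrightarrow> a) at_top"
proof -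
  obtain G where G: "G holomorphic_on ball 0 1" "G 0 = a" "\<And>z. z \<in> Hup \<Longrightarrow> f z = G (qq z)"
    using assms unfolding at_cusp_def by blast
  have "((\<lambda>t. exp (- 2 * pi * t)) \<longlongrightarrow> 0) at_top" by real_asymp
  then have "((\<lambda>t. norm (qq (\<i> * of_real t))) \<longlongrightarrow> 0) at_top" by (simp add: norm_qq)
  then have 1: "((\<lambda>t. qq (\<i> * of_real t)) \<longlongrightarrow> 0) at_top" by (rule tendsto_norm_zero_cancel)
  have "isCont G 0"
    using holomorphic_on_imp_continuous_on[OF G(1)] by (simp add: continuous_on_eq_continuous_at)
  then have "((\<lambda>t. G (qq (\<i> * of_real t))) \<longlongrightarrow> a) at_top"
    using isCont_tendsto_compose[OF _ 1] G(2) by metis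
  moreover have "eventually (\<lambda>t. G (qq (\<i> * of_real t)) = f (\<i> * of_real t)) at_top"
    using eventually_gt_at_top[of "0::real"] by eventually_elim (auto simp: G(3) Hup_def)
  ultimately show ?thesis by (rule Lim_transform_eventually)
qed

lemma at_cusp_unique:
  assumes "at_cusp f a" "at_cusp g b" "\<And>z. z \<in> Hup \<Longrightarrow> f z = g z"
  shows "a = b"
proof -
  have "eventually (\<lambda>t. f (\<i> * of_real t) = g (\<i> * of_real t)) at_top"
    using eventually_gt_at_top[of "0::real"] by eventually_elim (auto simp: assms(3) Hup_def)
  then have "((\<lambda>t. g (\<i> * of_real t)) \<longlongrightarrow> a) at_top"
    by (rule Lim_transform_eventually[OF at_cusp_limit[OF assms(1)]])
  then show ?thesis
    using at_cusp_limit[OF assms(2)] tendsto_unique trivial_limit_at_top_linorder by blast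
qed

subsection \<open>Weight zero\<close>

text \<open>If \<open>Im z < 1/2\<close> then, after a translation to \<open>\<bar>Re z\<bar> \<le> 1/2\<close>, the inversion at least doubles
  the imaginary part.\<close>

lemma Hup_orbit_induct [consumes 1, case_names high T S]:
  assumes "z \<in> Hup"
    and high: "\<And>z. Im z \<ge> 1/2 \<Longrightarrow> Q z"
    and T: "\<And>z n. z \<in> Hup \<Longrightarrow> Q (z + of_int n) \<Longrightarrow> Q z"
    and S: "\<And>z. z \<in> Hup \<Longrightarrow> Q (- 1 / z) \<Longrightarrow> Q z"
  shows "Q z"
proof -
  \<comment> \<open>The induction parameter is the number of doublings that bring the height up to
    1/2.\<close>
  have "Q z" if "z \<in> Hup" "2 ^ n * Im z \<ge> 1/2" for n z
    using that
  proof (induction n arbitrary: z)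
    case 0
    then show ?case using high by simp
  next
    case (Suc n)
    show ?case
    proof (cases "Im z \<ge> 1/2")
      case True
      then show ?thesis by (rule high)
    next
      case False
      define w where "w = z + of_int (- round (Re z))"
      have w: "w \<in> Hup" "Im w = Im z" using Suc.prems by (auto simp: w_def Hup_def)
      have "\<bar>Re w\<bar> \<le> 1/2" using of_int_round_abs_le[of "Re z"] by (simp add: w_def abs_minus_commute)
      then have "(Re w)\<^sup>2 \<le> (1/2)\<^sup>2" by (metis abs_le_square_iff abs_of_nonneg zero_le_divide_1_iff zero_le_numeral)
      moreover have "(Im w)\<^sup>2 \<le> (1/2)\<^sup>2" using w False by (intro power_mono) (auto simp: Hup_def)
      ultimately have n: "(norm w)\<^sup>2 \<le> 1/2" unfolding cmod_power2 by (simp add: power2_eq_square)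
      have im: "Im (- 1 / w) = Im w / (norm w)\<^sup>2"
        using Im_mob[OF SL2Z_generators(2) w(1)] by (simp add: mob_S)
      have nz: "norm w > 0" using w Hup_nonzero by auto
      have "2 * Im w \<le> Im w / (norm w)\<^sup>2"
        using n nz w(1) mult_right_mono[OF n, of "2 * Im w"] by (simp add: field_simps Hup_def)
      then have im2: "Im (- 1 / w) \<ge> 2 * Im z" using im w(2) by simp
      have "- 1 / w \<in> Hup" using mob_in_Hup[OF SL2Z_generators(2) w(1)] by (simp add: mob_S)
      moreover have "2 ^ n * Im (- 1 / w) \<ge> 1/2"
        using Suc.prems(2) mult_left_mono[OF im2, of "2 ^ n"] by simp
      ultimately have "Q (- 1 / w)" by (rule Suc.IH)
      then have "Q w" using S w by blast
      then show ?thesis using T Suc.prems unfolding w_def by blast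
    qed
  qed
  moreover have "\<exists>n. 2 ^ n * Im z \<ge> 1/2"
  proof -
    obtain n where "1 / (2 * Im z) < 2 ^ n" using real_arch_pow[of 2] by auto
    then show ?thesis using assms(1) by (intro exI[of _ n]) (simp add: Hup_def field_simps)
  qed
  ultimately show ?thesis using assms(1) by blast
qed

text \<open>The points of height at least 1/2 correspond to \<open>norm q \<le> exp (- pi)\<close>,
  a compact disc. By invariance the maximum of \<open>norm (G q)\<close> there bounds
  \<open>G\<close> on the whole unit disc, where it is attained at an interior point; the maximum
  principle applies.\<close>

lemma MF_0_constant:
  assumes "f \<in> MF 0"
  obtains c where "\<And>z. z \<in> Hup \<Longrightarrow> f z = c"
proof -
  obtain G where G: "G holomorphic_on ball 0 1" "\<And>z. z \<in> Hup \<Longrightarrow> f z = G (qq z)"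
    using assms unfolding MF_iff qexp0_iff by blast
  define r where "r = exp (- pi)"
  have r: "0 < r" "r < 1" by (auto simp: r_def)
  have "continuous_on (cball 0 r) G"
    using r by (intro holomorphic_on_imp_continuous_on holomorphic_on_subset[OF G(1)]) auto
  then obtain x where x: "x \<in> cball 0 r" "\<And>q. q \<in> cball 0 r \<Longrightarrow> norm (G q) \<le> norm (G x)"
    using continuous_attains_sup[of "cball 0 r" "\<lambda>q. norm (G q)", OF _ _ continuous_on_norm] r by auto
  have bound: "norm (f z) \<le> norm (G x)" if "z \<in> Hup" for z
    using that
  proof (induction rule: Hup_orbit_induct)
    case (high z)
    then have "qq z \<in> cball 0 r" by (simp add: norm_qq r_def)
    then show ?case using x(2) G(2)[of z] high by (simp add: Hup_def)
  next
    case (T z n)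
    have "qq (z + of_int n) = qq z" unfolding qq_eq_iff by blast
    then show ?case using T G(2) by (metis shift_int_in_Hup)
  next
    case (S z)
    then show ?case using MF_S[OF assms, of z] by simp
  qed
  have "norm (G q) \<le> norm (G x)" if q: "q \<in> ball 0 1" for q
  proof (cases "q = 0")
    case True
    then show ?thesis using x(2)[of 0] r by simp
  next
    case False
    then have "qq (Ln q / (2 * of_real pi * \<i>)) = q" "Ln q / (2 * of_real pi * \<i>) \<in> Hup"
      using qq_log[of "Ln q" q] q by auto
    then show ?thesis using bound G(2) by metis
  qed
  moreover have "x \<in> ball 0 1" using x(1) r by simp
  ultimately have "G constant_on ball 0 1"
    using maximum_modulus_principle[OF G(1) open_ball connected_ball open_ball subset_refl, of x] by blast
  then obtain c where "\<And>q. q \<in> ball 0 1 \<Longrightarrow> G q = c" unfolding constant_on_def by blast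
  then show ?thesis using that[of c] G(2) qq_in_disc by simp
qed

subsection \<open>The discriminant\<close>

definition Delta :: "complex \<Rightarrow> complex" where
  "Delta z = (if z \<in> Hup then qq z * phi (qq z) ^ 24 else 0)"

lemma Delta_nonzero: "z \<in> Hup \<Longrightarrow> Delta z \<noteq> 0"
  using phi_nonzero qq_in_disc[of z] by (simp add: Delta_def)

lemma Delta_at_cusp: "at_cusp Delta 0"
  by (rule at_cuspI[of "\<lambda>q. q * phi q ^ 24"]) (auto intro!: holomorphic_intros phi_holomorphic simp: Delta_def)

lemma qexp_Delta: "qexp 0 Delta"
  using Delta_at_cusp by (auto simp: at_cusp_def qexp0_iff)

text \<open>\<open>Delta\<close> is the 24th power of eta and \<open>P\<close> is a multiple of the
  logarithmic derivative of eta. Weight 12 is where they cancel, since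
  \<open>24 / (2 pi i) = - 12 i / pi\<close>.\<close>

lemma Dsc_Delta:
  assumes z: "z \<in> Hup"
  shows "Dsc 12 Delta z = 0"
proof -
  define G where "G = (\<lambda>q. q * phi q ^ 24)"
  have G: "G holomorphic_on ball 0 1" unfolding G_def by (intro holomorphic_intros phi_holomorphic)
  define q where "q = qq z"
  have q: "q \<in> ball 0 1" using qq_in_disc z by (simp add: q_def)
  have dphi: "(phi has_field_derivative deriv phi q) (at q)"
    using phi_holomorphic q holomorphic_derivI by blast
  have "(G has_field_derivative phi q ^ 24 + q * (24 * phi q ^ 23 * deriv phi q)) (at q)"
    unfolding G_def by (auto intro!: derivative_eq_intros dphi)
  then have "deriv G q = phi q ^ 24 + q * (24 * phi q ^ 23 * deriv phi q)" by (rule DERIV_imp_deriv)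
  moreover have "phi q \<noteq> 0" using phi_nonzero q by simp
  moreover have "phi q ^ 24 = phi q ^ 23 * phi q" by (simp add: power_Suc2[symmetric] del: power_Suc)
  ultimately show ?thesis
    using Dsc_qexp[OF G, of Delta 0 z 12] z
    by (simp add: Delta_def G_def q_def[symmetric] Pq_def field_simps)
qed

lemma deriv_eq_of_Dsc_zero: "Dsc k f z = 0 \<Longrightarrow> deriv f z = - (2 * of_real pi * \<i> * of_real k * Pfun z) * f z"
  by (simp add: Dsc_def field_simps add_eq_0_iff)

lemma SL2Z_powi_induct:
  assumes S: "\<And>z. z \<in> Hup \<Longrightarrow> f (- 1 / z) = z powi j * f z" and T: "\<And>z. z \<in> Hup \<Longrightarrow> f (z + 1) = f z"
    and g: "g \<in> SL2Z"
  shows "\<forall>z\<in>Hup. f (mob g z) = jfac g z powi j * f z"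
  using g
proof (induction rule: SL2Z_induct)
  case T
  then show ?case using assms by simp
next
  case Tinv
  show ?case
  proof
    fix z assume "z \<in> Hup"
    then have "z - 1 \<in> Hup" by (simp add: Hup_def)
    from T[OF this] show "f (mob Tinv z) = jfac Tinv z powi j * f z" by simp
  qed
next
  case S
  then show ?case using assms by (simp add: mob_S)
next
  case (mult g h)
  then show ?case
    by (auto simp: mob_mult jfac_mult mob_in_Hup power_int_mult_distrib)
qed

text \<open>By the law of \<open>P\<close>, the slash \<open>h\<close> of \<open>Delta\<close> by
  \<open>S\<close> also satisfies \<open>D h = 0\<close>. Both solve the same first order equation,
  so agreement at one point suffices.\<close>

lemma Delta_modular:
  assumes quasi: "quasimodular_P"
  shows "Delta \<in> MF 12"
  unfolding MF_iff
proof (intro conjI allI impI ballI)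
  show "Delta z = 0" if "z \<notin> Hup" for z using that by (simp add: Delta_def)
  show "qexp 0 Delta" by (rule qexp_Delta)
  have D: "Delta holomorphic_on Hup" by (rule qexp_holomorphic[OF qexp_Delta])
  define h where "h = (\<lambda>z. Delta (mob Smat z) / z ^ 12)"
  have mob_hol: "mob g holomorphic_on Hup" if "g \<in> SL2Z" for g
    unfolding holomorphic_on_open[OF open_Hup] using mob_has_derivative[OF that] by blast
  have "(Delta \<circ> mob Smat) holomorphic_on Hup"
    by (rule holomorphic_on_compose_gen[OF mob_hol D]) (use mob_in_Hup SL2Z_generators in blast)+
  then have h: "h holomorphic_on Hup" unfolding h_def o_def
    by (intro holomorphic_intros) (auto simp: Hup_nonzero)
  have tr: "Delta (mob Smat z) = jfac Smat z powr of_real 12 * h z" if "z \<in> Hup" for z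
  proof -
    have nz: "z \<noteq> 0" by (rule Hup_nonzero[OF that])
    then have "z powr 12 = z ^ 12" using powr_numeral by auto
    then show ?thesis using nz by (simp add: h_def)
  qed
  have Dh: "Dsc 12 h z = 0" if z: "z \<in> Hup" for z
  proof -
    have "Dsc 12 Delta (mob Smat z) = jfac Smat z powr of_real (12 + 2) * Dsc 12 h z"
      by (rule Dsc_mob_quasi[OF quasi D h SL2Z_generators(2) tr z])
    moreover have "Dsc 12 Delta (mob Smat z) = 0" by (intro Dsc_Delta mob_in_Hup z) simp
    moreover have "jfac Smat z powr of_real (12 + 2) \<noteq> 0" using Hup_nonzero[OF z] by simp
    ultimately show ?thesis by (metis mult_eq_0_iff)
  qed
  have heq: "h z - Delta z = 0" if z: "z \<in> Hup" for z
  proof -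
    let ?m = "\<lambda>z. - (2 * of_real pi * \<i> * of_real 12 * Pfun z)"
    have 1: "(\<lambda>z. h z - Delta z) holomorphic_on Hup" by (intro holomorphic_intros h D)
    have 2: "?m holomorphic_on Hup"
      by (intro holomorphic_intros Pfun_holomorphic)
    \<comment> \<open>\<open>\<i>\<close> is fixed by \<open>S\<close>, and its 12th power is
      1.\<close>
    have 3: "h \<i> - Delta \<i> = 0"
      by (simp add: h_def mob_S)
    have 4: "deriv (\<lambda>z. h z - Delta z) z = ?m z * (h z - Delta z)" if z: "z \<in> Hup" for z
    proof -
      have "deriv (\<lambda>z. h z - Delta z) z = deriv h z - deriv Delta z"
        using h D z holomorphic_on_imp_differentiable_at open_Hup by (intro deriv_diff) blast+
      then show ?thesis
        using deriv_eq_of_Dsc_zero[OF Dh[OF z]] deriv_eq_of_Dsc_zero[OF Dsc_Delta[OF z]]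
        by (simp add: algebra_simps)
    qed
    show ?thesis by (rule linear_ode1_zero[OF open_Hup connected_Hup 1 2 4 i_in_Hup 3 z])
  qed
  have S: "Delta (- 1 / z) = z powi 12 * Delta z" if "z \<in> Hup" for z
    using heq[OF that] Hup_nonzero[OF that] by (simp add: h_def mob_S field_simps)
  have T: "Delta (z + 1) = Delta z" if "z \<in> Hup" for z
    using that shift_int_in_Hup[of z 1] by (simp add: Delta_def qq_add)
  show "Delta (mob g z) = jfac g z powi 12 * Delta z" if "g \<in> SL2Z" "z \<in> Hup" for g z
    using SL2Z_powi_induct[of Delta 12, OF S T that(1)] that(2) by blast
qed

text \<open>\<open>Delta\<close> has no zero in the half-plane and a simple one at
  \<open>q = 0\<close>, which the vanishing constant term of \<open>f\<close> cancels.\<close>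

lemma MF_div_Delta:
  assumes quasi: "quasimodular_P" and f: "f \<in> MF j" and cusp: "at_cusp f 0"
  shows "(\<lambda>z. f z / Delta z) \<in> MF (j - 12)"
  unfolding MF_iff
proof (intro conjI allI impI ballI)
  show "f z / Delta z = 0" if "z \<notin> Hup" for z using that by (simp add: Delta_def)
  obtain G where G: "G holomorphic_on ball 0 1" "G 0 = 0" "\<And>z. z \<in> Hup \<Longrightarrow> f z = G (qq z)"
    using cusp unfolding at_cusp_def by blast
  have "isCont G 0"
    using holomorphic_on_imp_continuous_on[OF G(1)] by (simp add: continuous_on_eq_continuous_at)
  then have "(G \<longlongrightarrow> 0) (at 0)" using G(2) by (simp add: isCont_def)
  then have "((\<lambda>q. (q - 0) * (G q / q)) \<longlongrightarrow> 0) (at 0)"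
    by (rule Lim_transform_eventually) (auto simp: eventually_at_filter)
  moreover have "(\<lambda>q. G q / q) holomorphic_on ball 0 1 - {0}"
    by (intro holomorphic_intros holomorphic_on_subset[OF G(1)]) auto
  ultimately obtain K where K: "K holomorphic_on ball 0 1" "\<And>q. q \<in> ball 0 1 - {0} \<Longrightarrow> K q = G q / q"
    using holomorphic_on_extend_lim[of "\<lambda>q. G q / q" "ball 0 1" 0] by auto
  show "qexp 0 (\<lambda>z. f z / Delta z)"
    unfolding qexp0_iff
  proof (intro exI[of _ "\<lambda>q. K q / phi q ^ 24"] conjI ballI)
    show "(\<lambda>q. K q / phi q ^ 24) holomorphic_on ball 0 1"
      by (intro holomorphic_intros K phi_holomorphic) (auto simp: phi_nonzero)
    show "f z / Delta z = K (qq z) / phi (qq z) ^ 24" if "z \<in> Hup" for z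
      using that G(3) K(2)[OF qq_in_punctured_disc[OF that]] by (simp add: Delta_def)
  qed
  show "f (mob g z) / Delta (mob g z) = jfac g z powi (j - 12) * (f z / Delta z)"
    if "g \<in> SL2Z" "z \<in> Hup" for g z
    using MF_mob[OF f that] MF_mob[OF Delta_modular[OF quasi] that] jfac_nonzero[OF that]
    by (simp add: power_int_diff)
qed

lemma MF_Dsc:
  assumes quasi: "quasimodular_P" and f: "f \<in> MF j" and k: "k = of_int j"
  shows "(\<lambda>z. if z \<in> Hup then Dsc k f z else 0) \<in> MF (j + 2)"
  unfolding MF_iff k
proof (intro conjI allI impI ballI)
  have "qexp 0 (Dsc (of_int j) f)" using f by (intro qexp_Dsc) (simp add: MF_iff)
  then show "qexp 0 (\<lambda>z. if z \<in> Hup then Dsc (of_int j) f z else 0)"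
    by (rule qexp_cong[THEN iffD1, rotated]) simp
  fix g z assume g: "g \<in> SL2Z" and z: "z \<in> Hup"
  have powr: "jfac g z powr of_real (of_int i) = jfac g z powi i" if "z \<in> Hup" for z and i :: int
    using jfac_nonzero[OF g that] by (simp add: complex_powr_of_int)
  have "Dsc (of_int j) f (mob g z) = jfac g z powr of_real (of_int j + 2) * Dsc (of_int j) f z"
    by (rule Dsc_mob_quasi[OF quasi _ _ g _ z]) (use f g in \<open>auto simp: MF_holomorphic MF_mob powr simp del: of_real_of_int_eq\<close>)
  moreover have "jfac g z powr of_real (of_int j + 2) = jfac g z powi (j + 2)"
    using powr[OF z, of "j + 2"] by simp
  ultimately show "(if mob g z \<in> Hup then Dsc (of_int j) f (mob g z) else 0) =
     jfac g z powi (j + 2) * (if z \<in> Hup then Dsc (of_int j) f z else 0)"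
    using mob_in_Hup[OF g z] z by simp
qed simp

subsection \<open>Eisenstein series\<close>

text \<open>Since \<open>P = - E\<^sub>2 / 12\<close>, this is Ramanujan's identity for the derivative of \<open>E\<^sub>2\<close>.\<close>

definition E4 :: "complex \<Rightarrow> complex" where
  "E4 z = (if z \<in> Hup then 144 * ((Pfun z)\<^sup>2 + deriv Pfun z / (2 * of_real pi * \<i>)) else 0)"

lemma E4_at_cusp: "at_cusp E4 1"
proof (rule at_cuspI[of "\<lambda>q. 144 * ((Pq q)\<^sup>2 + q * deriv Pq q)"])
  show "(\<lambda>q. 144 * ((Pq q)\<^sup>2 + q * deriv Pq q)) holomorphic_on ball 0 1"
    by (intro holomorphic_intros Pq_holomorphic holomorphic_deriv) auto
  show "144 * ((Pq 0)\<^sup>2 + 0 * deriv Pq 0) = 1" by (simp add: power2_eq_square)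
  fix z assume z: "z \<in> Hup"
  have "(Pfun has_field_derivative deriv Pq (qq z) * (2 * of_real pi * \<i> * qq z)) (at z)"
    by (rule has_field_derivative_transform_within_open[OF compose_qq_has_derivative[OF Pq_holomorphic z] open_Hup z])
       (simp add: Pfun_eq)
  then have "deriv Pfun z = deriv Pq (qq z) * (2 * of_real pi * \<i> * qq z)" by (rule DERIV_imp_deriv)
  then show "E4 z = 144 * ((Pq (qq z))\<^sup>2 + qq z * deriv Pq (qq z))"
    using z by (simp add: E4_def Pfun_eq)
qed

text \<open>Differentiating the law of \<open>P\<close> gives that of its derivative. The anomalies
  of \<open>P^2\<close> and \<open>P' / (2 pi i)\<close>, multiples of \<open>c * j^3 * P\<close>
  and \<open>c^2 * j^2\<close>, are opposite and cancel.\<close>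

lemma E4_MF:
  assumes quasi: "quasimodular_P"
  shows "E4 \<in> MF 4"
  unfolding MF_iff
proof (intro conjI allI impI ballI)
  show "qexp 0 E4" using E4_at_cusp by (auto simp: at_cusp_def qexp0_iff)
  fix g z assume g: "g \<in> SL2Z" and z: "z \<in> Hup"
  define I where "I = 2 * of_real pi * \<i>"
  define c where "c = complex_of_int (ec g)"
  define j where "j = jfac g z"
  have I: "I \<noteq> 0" by (simp add: I_def)
  have j: "j \<noteq> 0" using jfac_nonzero[OF g z] by (simp add: j_def)
  have P: "Pfun (mob g w) = (jfac g w)\<^sup>2 * Pfun w - c * jfac g w / I" if "w \<in> Hup" for w
  proof -
    have "Pfun (mob g w) / (jfac g w)\<^sup>2 + c / (I * jfac g w) = Pfun w"
      using quasi g that unfolding quasimodular_P_def slashP_def I_def c_def by blast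
    then show ?thesis using jfac_nonzero[OF g that] I by (simp add: field_simps power2_eq_square)
  qed
  have dP: "(Pfun has_field_derivative deriv Pfun w) (at w)" if "w \<in> Hup" for w
    using Pfun_holomorphic that holomorphic_derivI open_Hup by blast
  have dj: "(jfac g has_field_derivative c) (at z)"
    unfolding jfac_def[abs_def] c_def by (auto intro!: derivative_eq_intros)
  have 1: "((\<lambda>w. Pfun (mob g w)) has_field_derivative deriv Pfun (mob g z) * (1 / j\<^sup>2)) (at z)"
    using DERIV_chain2[OF dP[OF mob_in_Hup[OF g z]] mob_has_derivative[OF g z]] by (simp add: j_def)
  have "((\<lambda>w. (jfac g w)\<^sup>2 * Pfun w - c * jfac g w / I) has_field_derivative
      2 * j * c * Pfun z + j\<^sup>2 * deriv Pfun z - c * c / I) (at z)"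
    unfolding j_def using I by (auto intro!: derivative_eq_intros dj dP[OF z])
  then have "((\<lambda>w. Pfun (mob g w)) has_field_derivative
      2 * j * c * Pfun z + j\<^sup>2 * deriv Pfun z - c * c / I) (at z)"
    by (rule has_field_derivative_transform_within_open[OF _ open_Hup z]) (simp add: P)
  from DERIV_unique[OF 1 this]
  have d: "deriv Pfun (mob g z) = j\<^sup>2 * (2 * j * c * Pfun z + j\<^sup>2 * deriv Pfun z - c * c / I)"
    using j by (simp add: field_simps)
  have "(Pfun (mob g z))\<^sup>2 + deriv Pfun (mob g z) / I = j ^ 4 * ((Pfun z)\<^sup>2 + deriv Pfun z / I)"
    unfolding d P[OF z] j_def[symmetric] using I
    by (simp add: field_simps power2_eq_square power4_eq_xxxx)
  then show "E4 (mob g z) = jfac g z powi 4 * E4 z"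
    using mob_in_Hup[OF g z] z by (simp add: E4_def I_def j_def)
qed (simp add: E4_def)

text \<open>Ramanujan's identity \<open>D E_4 = - E_6 / 3\<close>; the factor -3 makes the constant
  term 1.\<close>

definition E6 :: "complex \<Rightarrow> complex" where
  "E6 z = - 3 * (if z \<in> Hup then Dsc 4 E4 z else 0)"

lemma E6_MF: "quasimodular_P \<Longrightarrow> E6 \<in> MF 6"
  using MF_cmult[OF MF_Dsc[OF _ E4_MF, of 4], of "-3"] by (simp add: E6_def[abs_def])

lemma at_cusp_Dsc:
  assumes "at_cusp f a"
  shows "at_cusp (\<lambda>z. if z \<in> Hup then Dsc k f z else 0) (- (of_real k / 12) * a)"
proof -
  obtain G where G: "G holomorphic_on ball 0 1" "G 0 = a" "\<And>z. z \<in> Hup \<Longrightarrow> f z = G (qq z)"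
    using assms unfolding at_cusp_def by blast
  show ?thesis
  proof (rule at_cuspI[of "\<lambda>q. q * deriv G q + of_real k * Pq q * G q"])
    show "(\<lambda>q. q * deriv G q + of_real k * Pq q * G q) holomorphic_on ball 0 1"
      by (intro holomorphic_intros G Pq_holomorphic holomorphic_deriv) auto
  qed (use G(2) Dsc_qexp[OF G(1), of f 0 _ k] G(3) in auto)
qed

lemma E6_at_cusp: "at_cusp E6 1"
  using at_cusp_cmult[OF at_cusp_Dsc[OF E4_at_cusp], of "-3" 4] by (simp add: E6_def[abs_def])

text \<open>\<open>2 * k\<close> is \<open>4 * i\<close> or \<open>4 * i + 6\<close>, so powers of
  \<open>E4\<close>, multiplied once by \<open>E6\<close> for odd \<open>k\<close>, suffice.\<close>

lemma MF_normalized_exists: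
  assumes "quasimodular_P" "k \<ge> 2"
  shows "\<exists>E\<in>MF (2 * int k). at_cusp E 1"
  using assms(2)
proof (induction k rule: less_induct)
  case (less k)
  consider "k = 2" | "k = 3" | "k \<ge> 4" using less.prems by linarith
  then show ?case
  proof cases
    case 1
    then show ?thesis using E4_MF[OF assms(1)] E4_at_cusp by auto
  next
    case 2
    then show ?thesis using E6_MF[OF assms(1)] E6_at_cusp by auto
  next
    case 3
    then have "k - 2 < k" "k - 2 \<ge> 2" by auto
    then obtain E where E: "E \<in> MF (2 * int (k - 2))" "at_cusp E 1" using less.IH by blast
    have "2 * int (k - 2) + 4 = 2 * int k" using 3 by auto
    then show ?thesis
      using MF_mult[OF E(1) E4_MF[OF assms(1)]] at_cusp_mult[OF E(2) E4_at_cusp] by auto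
  qed
qed

subsection \<open>Dimensions\<close>

lemma MF_zero_of_Hup: "f \<in> MF j \<Longrightarrow> (\<And>z. z \<in> Hup \<Longrightarrow> f z = 0) \<Longrightarrow> f = (\<lambda>_. 0)"
  using MF_off by fastforce

text \<open>Multiplying \<open>f^12\<close> by a power of \<open>Delta\<close> brings the weight to
  0. The product is constant, and it vanishes at the cusp because \<open>Delta\<close> does.\<close>

lemma MF_negative:
  assumes quasi: "quasimodular_P" and f: "f \<in> MF j" and j: "j < 0"
  shows "f = (\<lambda>_. 0)"
proof -
  define h where "h = (\<lambda>z. f z ^ 12 * Delta z ^ nat (- j))"
  have "h \<in> MF (int 12 * j + int (nat (- j)) * 12)"
    unfolding h_def using j by (intro MF_mult MF_power f Delta_modular quasi) auto
  then have "h \<in> MF 0" using j by simp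
  then obtain c where c: "\<And>z. z \<in> Hup \<Longrightarrow> h z = c" using MF_0_constant by blast
  obtain a where "at_cusp f a" using at_cusp_exists f by blast
  then have "at_cusp h (a ^ 12 * 0 ^ nat (- j))"
    unfolding h_def by (intro at_cusp_mult at_cusp_power Delta_at_cusp)
  moreover have "a ^ 12 * 0 ^ nat (- j) = 0" using j by (simp add: zero_power)
  ultimately have "at_cusp h 0" by simp
  then have "c = 0" using at_cusp_unique[OF _ at_cusp_const[of c]] c by force
  then show ?thesis using c Delta_nonzero by (intro MF_zero_of_Hup[OF f]) (simp add: h_def)
qed

text \<open>Division by \<open>Delta\<close> lands in negative weight. Hence below weight 12 a form
  is determined by its constant term.\<close>

lemma MF_cusp_small_weight:
  assumes "quasimodular_P" "f \<in> MF j" "j < 12" "at_cusp f 0"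
  shows "f = (\<lambda>_. 0)"
proof (rule MF_zero_of_Hup[OF assms(2)])
  fix z assume "z \<in> Hup"
  have "(\<lambda>z. f z / Delta z) = (\<lambda>_. 0)"
    using MF_negative[OF assms(1) MF_div_Delta[OF assms(1,2,4)]] assms(3) by simp
  from fun_cong[OF this, of z] show "f z = 0" using Delta_nonzero[OF \<open>z \<in> Hup\<close>] by simp
qed

lemma MF_small_weight_multiple:
  assumes "quasimodular_P" "f \<in> MF j" "E \<in> MF j" "j < 12" "at_cusp E 1" "at_cusp f a"
  shows "f = (\<lambda>z. a * E z)"
proof -
  have "(\<lambda>z. f z - a * E z) = (\<lambda>_. 0)"
  proof (rule MF_cusp_small_weight[OF assms(1) _ assms(4)])
    show "(\<lambda>z. f z - a * E z) \<in> MF j" by (intro MF_diff MF_cmult assms)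
    show "at_cusp (\<lambda>z. f z - a * E z) 0"
      using at_cusp_diff[OF assms(6) at_cusp_cmult[OF assms(5), of a]] by simp
  qed
  then show ?thesis by (metis eq_iff_diff_eq_0)
qed

text \<open>If \<open>f\<close> has weight 2 and constant term \<open>a \<noteq> 0\<close>, then \<open>f\<^sup>2\<close> and \<open>D f\<close> are both multiples of
  \<open>E4\<close>, so \<open>f\<close> solves a first order linear equation; but \<open>f \<i> = 0\<close>.\<close>

lemma MF_2:
  assumes quasi: "quasimodular_P" and f: "f \<in> MF 2"
  shows "f = (\<lambda>_. 0)"
proof -
  obtain a where a: "at_cusp f a" using at_cusp_exists f by blast
  have "a = 0"
  proof (rule ccontr)
    assume a0: "a \<noteq> 0"
    have f2: "(\<lambda>z. f z ^ 2) = (\<lambda>z. a ^ 2 * E4 z)"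
      using MF_power[OF f, of 2]
      by (intro MF_small_weight_multiple[OF quasi _ E4_MF[OF quasi] _ E4_at_cusp at_cusp_power[OF a]]) auto
    define b where "b = - (of_real 2 / 12) * a"
    have Df: "(\<lambda>z. if z \<in> Hup then Dsc 2 f z else 0) = (\<lambda>z. b * E4 z)"
      unfolding b_def using MF_Dsc[OF quasi f, of 2]
      by (intro MF_small_weight_multiple[OF quasi _ E4_MF[OF quasi] _ E4_at_cusp at_cusp_Dsc[OF a]]) auto
    define m where "m = (\<lambda>z. 2 * of_real pi * \<i> * (b / a ^ 2 * f z - 2 * Pfun z))"
    have ode: "deriv f z = m z * f z" if "z \<in> Hup" for z
    proof -
      have "Dsc 2 f z = b * E4 z" using fun_cong[OF Df, of z] that by simp
      also have "E4 z = f z ^ 2 / a ^ 2" using fun_cong[OF f2, of z] a0 by simp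
      finally have "deriv f z / (2 * of_real pi * \<i>) = b / a ^ 2 * f z * f z - 2 * Pfun z * f z"
        by (simp add: Dsc_def power2_eq_square algebra_simps)
      then show ?thesis by (simp add: m_def field_simps)
    qed
    have m: "m holomorphic_on Hup" unfolding m_def
      by (intro holomorphic_intros Pfun_holomorphic MF_holomorphic[OF f]) (use a0 in auto)
    \<comment> \<open>\<open>\<i>\<close> is fixed by \<open>S\<close>, so weight 2 gives
      \<open>f \<i> = - f \<i>\<close>.\<close>
    have fi: "f \<i> = 0" using MF_S[OF f i_in_Hup] by simp
    have "f z = 0" if "z \<in> Hup" for z
      by (rule linear_ode1_zero[OF open_Hup connected_Hup MF_holomorphic[OF f] m ode i_in_Hup fi that])
    then show False using at_cusp_unique[OF a at_cusp_const[of 0]] a0 by blast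
  qed
  then show ?thesis using MF_cusp_small_weight[OF quasi f] a by simp
qed

definition MF_basis :: "nat \<Rightarrow> (nat \<Rightarrow> complex \<Rightarrow> complex) \<Rightarrow> int \<Rightarrow> bool" where
  "MF_basis n b j \<longleftrightarrow> (\<forall>i<n. b i \<in> MF j) \<and>
     (\<forall>f\<in>MF j. \<exists>c. \<forall>z. f z = (\<Sum>i<n. c i * b i z)) \<and>
     (\<forall>c. (\<forall>z\<in>Hup. (\<Sum>i<n. c i * b i z) = 0) \<longrightarrow> (\<forall>i<n. c i = 0))"

lemma MF_basis_0: "(\<And>f. f \<in> MF j \<Longrightarrow> f = (\<lambda>_. 0)) \<Longrightarrow> MF_basis 0 b j"
  by (auto simp: MF_basis_def)

text \<open>The constant term maps the forms of weight \<open>j\<close> onto the complex numbers,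
  with \<open>E\<close> over 1, and its kernel is \<open>Delta\<close> times the forms of weight
  \<open>j - 12\<close>.\<close>

lemma MF_basis_step:
  assumes quasi: "quasimodular_P" and E: "E \<in> MF j" "at_cusp E 1" and b: "MF_basis n b (j - 12)"
  shows "\<exists>b'. MF_basis (Suc n) b' j"
proof
  define b' where "b' = (\<lambda>i z. case i of 0 \<Rightarrow> E z | Suc i \<Rightarrow> Delta z * b i z)"
  have sum: "(\<Sum>i<Suc n. c i * b' i z) = c 0 * E z + Delta z * (\<Sum>i<n. c (Suc i) * b i z)" for c z
    unfolding sum.lessThan_Suc_shift by (simp add: b'_def sum_distrib_left mult_ac)
  have D: "Delta \<in> MF 12" by (rule Delta_modular[OF quasi])
  show "MF_basis (Suc n) b' j"
    unfolding MF_basis_def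
  proof (intro conjI allI impI ballI)
    fix i assume "i < Suc n"
    then show "b' i \<in> MF j"
      using E b MF_mult[OF D, of "b (i - 1)" "j - 12"] by (cases i) (auto simp: b'_def MF_basis_def)
  next
    fix f assume f: "f \<in> MF j"
    obtain a where a: "at_cusp f a" using at_cusp_exists f by blast
    have "(\<lambda>z. f z - a * E z) \<in> MF j" by (intro MF_diff MF_cmult f E)
    moreover have "at_cusp (\<lambda>z. f z - a * E z) 0"
      using at_cusp_diff[OF a at_cusp_cmult[OF E(2), of a]] by simp
    ultimately have "(\<lambda>z. (f z - a * E z) / Delta z) \<in> MF (j - 12)" by (rule MF_div_Delta[OF quasi])
    then have "\<exists>c. \<forall>z. (f z - a * E z) / Delta z = (\<Sum>i<n. c i * b i z)"
      using b unfolding MF_basis_def by (elim conjE) (erule (1) bspec)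
    then obtain c where c: "\<And>z. (f z - a * E z) / Delta z = (\<Sum>i<n. c i * b i z)" by blast
    have "f z = (\<Sum>i<Suc n. case_nat a c i * b' i z)" for z
    proof (cases "z \<in> Hup")
      case True
      then show ?thesis using Delta_nonzero[OF True] c[of z] unfolding sum by (simp add: field_simps)
    next
      case False
      then show ?thesis unfolding sum using MF_off[OF f False] MF_off[OF E(1) False] by (simp add: Delta_def)
    qed
    then show "\<exists>c. \<forall>z. f z = (\<Sum>i<Suc n. c i * b' i z)" by blast
  next
    fix c i assume c: "\<forall>z\<in>Hup. (\<Sum>i<Suc n. c i * b' i z) = 0" and i: "i < Suc n"
    have S: "(\<lambda>z. \<Sum>i<n. c (Suc i) * b i z) \<in> MF (j - 12)"
    proof -
      have "(\<lambda>z. \<Sum>i\<in>A. c (Suc i) * b i z) \<in> MF (j - 12)" if "finite A" "A \<subseteq> {..<n}" for A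
        using that
        by (induction A) (use b in \<open>auto simp: MF_basis_def intro!: MF_zero MF_add MF_cmult\<close>)
      then show ?thesis by simp
    qed
    then obtain a where "at_cusp (\<lambda>z. \<Sum>i<n. c (Suc i) * b i z) a" using at_cusp_exists by blast
    then have "at_cusp (\<lambda>z. Delta z * (\<Sum>i<n. c (Suc i) * b i z)) 0"
      using at_cusp_mult[OF Delta_at_cusp, of _ a] by simp
    moreover have "- c 0 * E z = Delta z * (\<Sum>i<n. c (Suc i) * b i z)" if "z \<in> Hup" for z
      using c that unfolding sum by (simp add: add_eq_0_iff2)
    ultimately have "- c 0 * 1 = 0"
      by (rule at_cusp_unique[OF at_cusp_cmult[OF E(2)]])
    then have c0: "c 0 = 0" by simp
    have "\<forall>z\<in>Hup. (\<Sum>i<n. c (Suc i) * b i z) = 0"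
      using c Delta_nonzero unfolding sum c0 by auto
    then have "\<forall>i<n. c (Suc i) = 0"
      using b unfolding MF_basis_def by (elim conjE, drule_tac x = "\<lambda>i. c (Suc i)" in spec) simp
    then show "c i = 0" using c0 i by (cases i) auto
  qed
qed

text \<open>The classical dimension in weight \<open>2 * k\<close>. The residue 1 modulo 6 loses one
  dimension because there is no nonzero form of weight 2.\<close>

definition MF_dim :: "nat \<Rightarrow> nat" where
  "MF_dim k = (if k mod 6 = 1 then k div 6 else k div 6 + 1)"

lemma MF_basis_exists:
  assumes quasi: "quasimodular_P"
  shows "\<exists>b. MF_basis (MF_dim k) b (2 * int k)"
proof (induction k rule: less_induct)
  case (less k)
  consider "k = 0" | "k = 1" | "2 \<le> k" "k < 6" | "k \<ge> 6" by linarith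
  then show ?case
  proof cases
    case 1
    define u where "u = (\<lambda>z. if z \<in> Hup then 1 else 0 :: complex)"
    have u: "u \<in> MF 0"
    proof -
      have "qexp 0 u" unfolding qexp0_iff by (intro exI[of _ "\<lambda>_. 1"]) (auto simp: u_def)
      then show ?thesis by (auto simp: MF_iff u_def mob_in_Hup)
    qed
    have "MF_basis 1 (\<lambda>_. u) 0"
      unfolding MF_basis_def
    proof (intro conjI allI impI ballI)
      fix f assume f: "f \<in> MF 0"
      obtain c where "\<And>z. z \<in> Hup \<Longrightarrow> f z = c" using MF_0_constant f by blast
      then have "\<forall>z. f z = (\<Sum>i<1::nat. c * u z)" using MF_off[OF f] by (simp add: u_def)
      then show "\<exists>c. \<forall>z. f z = (\<Sum>i<1::nat. c i * u z)" by (intro exI[of _ "\<lambda>_. c"])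
    next
      fix c :: "nat \<Rightarrow> complex" and i :: nat
      assume c: "\<forall>z\<in>Hup. (\<Sum>i<1. c i * u z) = 0" and i: "i < 1"
      from bspec[OF c i_in_Hup] show "c i = 0" using i by (simp add: u_def)
    qed (rule u)
    then show ?thesis using 1 by (auto simp: MF_dim_def)
  next
    case 2
    then show ?thesis using MF_basis_0[of 2] MF_2[OF quasi] by (auto simp: MF_dim_def)
  next
    case 3
    then obtain E where "E \<in> MF (2 * int k)" "at_cusp E 1" using MF_normalized_exists[OF quasi] by blast
    moreover have "MF_basis 0 (\<lambda>_. 0) (2 * int k - 12)"
      using 3 MF_negative[OF quasi] by (intro MF_basis_0) auto
    ultimately have "\<exists>b'. MF_basis (Suc 0) b' (2 * int k)" by (rule MF_basis_step[OF quasi])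
    then show ?thesis using 3 by (simp add: MF_dim_def)
  next
    case 4
    define l where "l = k - 6"
    have l: "k = l + 6" "l < k" using 4 by (auto simp: l_def)
    obtain E where E: "E \<in> MF (2 * int k)" "at_cusp E 1" using MF_normalized_exists[OF quasi, of k] 4 by auto
    obtain b where "MF_basis (MF_dim l) b (2 * int l)" using less.IH l(2) by blast
    then have "MF_basis (MF_dim l) b (2 * int k - 12)" using l(1) by simp
    then have "\<exists>b'. MF_basis (Suc (MF_dim l)) b' (2 * int k)" by (rule MF_basis_step[OF quasi E])
    moreover have "Suc (MF_dim l) = MF_dim k" unfolding MF_dim_def l(1) by simp
    ultimately show ?thesis by simp
  qed
qed

section \<open>Linear algebra in dimension three\<close>

definition det3 :: "complex^3 \<Rightarrow> complex^3 \<Rightarrow> complex^3 \<Rightarrow> complex" where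
  "det3 x y z = x$1 * (y$2 * z$3 - y$3 * z$2) - x$2 * (y$1 * z$3 - y$3 * z$1) + x$3 * (y$1 * z$2 - y$2 * z$1)"

lemma mat3_vec_nth: "((A::cmat3) *v x) $ i = A$i$1 * x$1 + A$i$2 * x$2 + A$i$3 * x$3"
  by (simp add: matrix_vector_mult_def sum_3)

lemma double_cancel: "2 * x = 2 * y \<Longrightarrow> x = (y :: complex)"
  by simp

lemma matrix_inv_left: "invertible A \<Longrightarrow> matrix_inv A ** A = mat 1"
  and matrix_inv_right: "invertible A \<Longrightarrow> A ** matrix_inv A = mat 1"
  unfolding invertible_def matrix_inv_def by (metis (mono_tags, lifting) someI_ex)+

lemma det3_mult: "det3 (A *v x) (A *v y) (A *v z) = det A * det3 x y z"
  unfolding det3_def det_3 mat3_vec_nth by algebra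

lemma det3_add1: "det3 (x + x') y z = det3 x y z + det3 x' y z"
  and det3_add2: "det3 x (y + y') z = det3 x y z + det3 x y' z"
  and det3_add3: "det3 x y (z + z') = det3 x y z + det3 x y z'"
  by (simp_all add: det3_def algebra_simps)

lemma det3_scale: "det3 (a *s x) (b *s y) (c *s z) = a * b * c * det3 x y z"
  by (simp add: det3_def algebra_simps)

lemma cramer3: "det3 x y z *s w = det3 w y z *s x + det3 x w z *s y + det3 x y w *s z"
  unfolding vec_eq_iff forall_3 det3_def by (simp add: algebra_simps)

text \<open>The relation is between the coordinates and common to the three vectors: when these are
  a vector function and its derivatives, it is a relation between its components.\<close>

lemma det3_eq_0_kernel:
  assumes "det3 x y z = 0"
  obtains c :: "complex^3" where "c \<noteq> 0"
    "(\<Sum>i\<in>UNIV. c$i * x$i) = 0" "(\<Sum>i\<in>UNIV. c$i * y$i) = 0" "(\<Sum>i\<in>UNIV. c$i * z$i) = 0"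
proof -
  define A :: cmat3 where "A = (\<chi> i j. if i = 1 then x$j else if i = 2 then y$j else z$j)"
  have e: "A$1$j = x$j" "A$2$j = y$j" "A$3$j = z$j" for j by (auto simp: A_def)
  have "det A = 0" using assms unfolding det_3 det3_def e by algebra
  then have "\<not> invertible A" by (simp add: invertible_det_nz)
  then obtain c where "c \<noteq> 0" "A *v c = 0"
    using matrix_left_invertible_ker[of A] invertible_left_inverse[of A] by blast
  then show ?thesis
    by (intro that[of c]) (auto simp: vec_eq_iff forall_3 mat3_vec_nth e sum_3 mult_ac)
qed

subsection \<open>Diagonalising a unitarizable matrix\<close>

definition hdot :: "complex^3 \<Rightarrow> complex^3 \<Rightarrow> complex" where
  "hdot x y = (\<Sum>i\<in>UNIV. x$i * cnj (y$i))"

lemma hdot_self_0: "hdot x x = 0 \<Longrightarrow> x = 0"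
proof -
  assume "hdot x x = 0"
  moreover have "hdot x x = of_real (\<Sum>i\<in>UNIV. (norm (x$i))\<^sup>2)"
    by (simp only: hdot_def of_real_sum complex_norm_square)
  ultimately have "(\<Sum>i\<in>UNIV. (norm (x$i))\<^sup>2) = 0" by (metis of_real_eq_0_iff)
  then show "x = 0" by (simp add: sum_nonneg_eq_0_iff vec_eq_iff)
qed

lemma unitary3_hdot:
  assumes "unitary3 U"
  shows "hdot (U *v x) (U *v y) = hdot x y"
proof -
  have "cadj3 U ** U = mat 1" using assms matrix_left_right_inverse unfolding unitary3_def by blast
  then have y: "cadj3 U *v (U *v y) = y" by (simp add: matrix_vector_mul_assoc)
  have "hdot (U *v x) w = hdot x (cadj3 U *v w)" for w
    by (simp add: hdot_def mat3_vec_nth sum_3 cadj3_def algebra_simps)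
  then show ?thesis by (simp add: y)
qed

text \<open>A unitary matrix has no Jordan block of size two: \<open>u\<close> lies in the kernel
  and in the image of \<open>U - \<mu>\<close>, and expanding
  \<open>hdot (U y) (U u) = hdot y u\<close> leaves \<open>cnj \<mu> * hdot u u = 0\<close>.\<close>

lemma unitary3_kernel_square:
  assumes U: "unitary3 U" and 2: "U *v u = \<mu> *s u" and u: "u = U *v y - \<mu> *s y"
  shows "u = 0"
proof (rule ccontr)
  assume u0: "u \<noteq> 0"
  have lin: "hdot (a *s x + w) (b *s x') = a * cnj b * hdot x x' + cnj b * hdot w x'" for a b x w x'
    by (simp add: hdot_def sum_3 algebra_simps)
  have lin': "hdot (a *s x) (b *s x') = a * cnj b * hdot x x'" for a b x x'
    by (simp add: hdot_def sum_3 algebra_simps)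
  have uu: "hdot u u \<noteq> 0" using u0 hdot_self_0 by blast
  have "\<mu> * cnj \<mu> * hdot u u = hdot u u"
    using unitary3_hdot[OF U, of u u] unfolding 2 lin' .
  then have 1: "\<mu> * cnj \<mu> = 1" using uu by simp
  have y: "U *v y = \<mu> *s y + u" by (simp add: u)
  have "\<mu> * cnj \<mu> * hdot y u + cnj \<mu> * hdot u u = hdot y u"
    using unitary3_hdot[OF U, of y u] unfolding 2 y lin .
  then have "cnj \<mu> * hdot u u = 0" by (simp add: 1)
  then show False using uu 1 by auto
qed

text \<open>The monic cubics agree everywhere, so comparing values at 0, 1 and -1 yields the three
  elementary symmetric functions.\<close>

lemma charpoly3_coeffs:
  assumes "\<forall>x. charpoly3 A x = (x - a) * (x - b) * (x - c)"
  shows "a + b + c = (A::cmat3)$1$1 + A$2$2 + A$3$3"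
    "a * b + a * c + b * c = A$1$1 * A$2$2 - A$1$2 * A$2$1 + A$1$1 * A$3$3 - A$1$3 * A$3$1 + A$2$2 * A$3$3 - A$2$3 * A$3$2"
    "a * b * c = det A"
proof -
  have m: "mat (x::complex) $ i $ j = (if i = j then x else 0)" for x and i j :: 3 by (simp add: mat_def)
  have *: "det (mat x - A) = (x - a) * (x - b) * (x - c)" for x using assms by (simp add: charpoly3_def)
  have 0: "a * b * c = det A" using *[of 0] unfolding det_3 by (simp add: m) algebra
  have 1: "(1 - a) * (1 - b) * (1 - c) = det (mat 1 - A)" using *[of 1] by simp
  have 2: "(- 1 - a) * (- 1 - b) * (- 1 - c) = det (mat (- 1) - A)" using *[of "- 1"] by simp
  show "a * b * c = det A" by (rule 0)
  have sum: "(1 - a) * (1 - b) * (1 - c) + (- 1 - a) * (- 1 - b) * (- 1 - c) = - 2 * (a + b + c) - 2 * (a * b * c)"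
    by (simp add: algebra_simps)
  have dif: "(1 - a) * (1 - b) * (1 - c) - (- 1 - a) * (- 1 - b) * (- 1 - c) = 2 + 2 * (a * b + a * c + b * c)"
    by (simp add: algebra_simps)
  have sum': "det (mat 1 - A) + det (mat (- 1) - A) = - 2 * (A$1$1 + A$2$2 + A$3$3) - 2 * det A"
    unfolding det_3 by (simp add: m algebra_simps)
  have dif': "det (mat 1 - A) - det (mat (- 1) - A) = 2 + 2 * (A$1$1 * A$2$2 - A$1$2 * A$2$1 + A$1$1 * A$3$3 - A$1$3 * A$3$1 + A$2$2 * A$3$3 - A$2$3 * A$3$2)"
    unfolding det_3 by (simp add: m algebra_simps)
  show "a + b + c = A$1$1 + A$2$2 + A$3$3"
  proof -
    have "2 * (a + b + c) = 2 * (A$1$1 + A$2$2 + A$3$3)" using sum sum' 0 1 2 by algebra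
    then show ?thesis by (rule double_cancel)
  qed
  show "a * b + a * c + b * c = A$1$1 * A$2$2 - A$1$2 * A$2$1 + A$1$1 * A$3$3 - A$1$3 * A$3$1 + A$2$2 * A$3$3 - A$2$3 * A$3$2"
    (is "?l = ?r")
  proof -
    have "2 * ?l = 2 * ?r" using dif dif' 1 2 by algebra
    then show ?thesis by (rule double_cancel)
  qed
qed

lemma cayley_hamilton3:
  fixes A :: cmat3
  assumes "\<forall>x. charpoly3 A x = (x - a) * (x - b) * (x - c)"
  defines "N \<equiv> \<lambda>\<mu> x. A *v x - \<mu> *s x"
  shows "N a (N b (N c x)) = 0"
proof -
  note e = charpoly3_coeffs[OF assms(1)]
  have "N a (N b (N c x)) = A *v (A *v (A *v x)) - (a + b + c) *s (A *v (A *v x))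
      + (a * b + a * c + b * c) *s (A *v x) - (a * b * c) *s x"
    unfolding vec_eq_iff by (simp add: N_def mat3_vec_nth algebra_simps)
  also have "\<dots> = 0"
    unfolding e det_3 vec_eq_iff forall_3
    by (simp add: mat3_vec_nth algebra_simps)
  finally show ?thesis .
qed

text \<open>The hypothesis \<open>ker\<close> excludes generalised eigenvectors. The factored
  Cayley-Hamilton identity splits \<open>y = N c x\<close> into two eigenvectors, and the splitting
  is then lifted to \<open>x\<close>; repeated eigenvalues are covered by
  \<open>ker\<close>.\<close>

lemma eigen_decomposition3:
  fixes A :: cmat3
  assumes char: "\<forall>x. charpoly3 A x = (x - a) * (x - b) * (x - c)"
    and ker: "\<And>\<mu> x. A *v (A *v x - \<mu> *s x) = \<mu> *s (A *v x - \<mu> *s x) \<Longrightarrow> A *v x = \<mu> *s x"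
  shows "\<exists>x1 x2 x3. x = x1 + x2 + x3 \<and> A *v x1 = a *s x1 \<and> A *v x2 = b *s x2 \<and> A *v x3 = c *s x3"
proof -
  define N where "N = (\<lambda>\<mu> x. A *v x - \<mu> *s x)"
  have N0: "N \<mu> x = 0 \<longleftrightarrow> A *v x = \<mu> *s x" for \<mu> x by (auto simp: N_def)
  have Nadd: "N \<mu> (x + y) = N \<mu> x + N \<mu> y" for \<mu> x y
    by (simp add: N_def matrix_vector_right_distrib vector_add_ldistrib algebra_simps)
  have Nsub: "N \<mu> (x - y) = N \<mu> x - N \<mu> y" for \<mu> x y
    by (simp add: N_def matrix_vector_mult_diff_distrib vector_ssub_ldistrib algebra_simps)
  have Nscale: "N \<mu> (k *s x) = k *s N \<mu> x" for \<mu> k x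
    by (simp add: N_def vec_eq_iff mat3_vec_nth algebra_simps)
  have Neig: "A *v x = \<nu> *s x \<Longrightarrow> N \<mu> x = (\<nu> - \<mu>) *s x" for \<mu> \<nu> x
    by (simp add: N_def vec_eq_iff algebra_simps)
  have Ncomm: "N \<mu> (N \<nu> x) = N \<nu> (N \<mu> x)" for \<mu> \<nu> x
    by (simp add: N_def vec_eq_iff mat3_vec_nth algebra_simps)
  have Nker: "N \<mu> (N \<mu> x) = 0 \<Longrightarrow> N \<mu> x = 0" for \<mu> x
    unfolding N0 using ker[of x \<mu>] by (simp add: N_def)
  define y where "y = N c x"
  have "N a (N b y) = 0" unfolding y_def N_def by (rule cayley_hamilton3[OF char])
  then have "\<exists>y1 y2. y = y1 + y2 \<and> N a y1 = 0 \<and> N b y2 = 0"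
  proof (cases "a = b")
    case True
    then have "N a y = 0" using \<open>N a (N b y) = 0\<close> Nker by blast
    then show ?thesis by (rule_tac x = y in exI, rule_tac x = 0 in exI) (simp add: N_def)
  next
    case False
    \<comment> \<open>Lagrange interpolation: \<open>N b - N a\<close> is multiplication by
      \<open>a - b\<close>.\<close>
    have "y = (1 / (a - b)) *s N b y + (- 1 / (a - b)) *s N a y"
      unfolding vec_eq_iff
    proof
      fix i
      have "N b y $ i - N a y $ i = (a - b) * y $ i" by (simp add: N_def algebra_simps)
      then have "y $ i = (N b y $ i - N a y $ i) / (a - b)" using False by simp
      then show "y $ i = ((1 / (a - b)) *s N b y + (- 1 / (a - b)) *s N a y) $ i"
        by (simp add: diff_divide_distrib)
    qed
    moreover have "N b (N a y) = 0" using \<open>N a (N b y) = 0\<close> Ncomm by metis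
    ultimately show ?thesis using \<open>N a (N b y) = 0\<close>
      by (rule_tac x = "(1 / (a - b)) *s N b y" in exI, rule_tac x = "(- 1 / (a - b)) *s N a y" in exI)
         (simp only: Nscale vector_smult_rzero simp_thms)
  qed
  then obtain y1 y2 where y: "y = y1 + y2" "N a y1 = 0" "N b y2 = 0" by blast
  \<comment> \<open>Preimages of \<open>y1\<close> and \<open>y2\<close> under \<open>N c\<close>.
    If \<open>a = c\<close> there is nothing to divide by, but then \<open>N c\<close> kills
    \<open>y1\<close>; leaving it in the remainder is harmless, since only
    \<open>N c (N c x3) = 0\<close> is required.\<close>
  define x1 where "x1 = (if a = c then 0 else (1 / (a - c)) *s y1)"
  define x2 where "x2 = (if b = c then 0 else (1 / (b - c)) *s y2)"
  define x3 where "x3 = x - x1 - x2"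
  have Nzero: "N \<mu> 0 = 0" for \<mu> by (simp add: N_def)
  have x1: "N a x1 = 0" by (simp add: x1_def Nscale Nzero y(2))
  have x2: "N b x2 = 0" by (simp add: x2_def Nscale Nzero y(3))
  have c1: "N c (y1 - N c x1) = 0"
  proof (cases "a = c")
    case True
    then show ?thesis using y(2) by (simp add: x1_def N_def)
  next
    case False
    have "N c x1 = y1" using Neig[OF x1[unfolded N0], of c] False by (simp add: x1_def)
    then show ?thesis by (simp add: N_def)
  qed
  have c2: "N c (y2 - N c x2) = 0"
  proof (cases "b = c")
    case True
    then show ?thesis using y(3) by (simp add: x2_def N_def)
  next
    case False
    have "N c x2 = y2" using Neig[OF x2[unfolded N0], of c] False by (simp add: x2_def)
    then show ?thesis by (simp add: N_def)
  qed
  have "N c x3 = (y1 - N c x1) + (y2 - N c x2)" 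
    using y(1) unfolding x3_def Nsub y_def by (simp only: algebra_simps)
  then have "N c (N c x3) = 0" by (simp only: Nadd c1 c2 add_0_left)
  then have x3: "N c x3 = 0" by (rule Nker)
  have "x = x1 + x2 + x3" by (simp add: x3_def)
  then show ?thesis using x1 x2 x3 unfolding N0 by blast
qed

text \<open>Equal cubics have the same multiset of roots. Summing an arbitrary \<open>h\<close> says
  so without naming a permutation.\<close>

lemma roots3_sum_eq:
  fixes a b c a' b' c' :: complex and h :: "complex \<Rightarrow> real"
  assumes "\<And>x. (x - a) * (x - b) * (x - c) = (x - a') * (x - b') * (x - c')"
  shows "h a + h b + h c = h a' + h b' + h c'"
proof -
  have two: "h b + h c = h b' + h c'" if "b + c = b' + c'" "b * c = b' * c'" for b c b' c'
  proof -
    have "(b - b') * (b - c') = 0" using that by algebra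
    then consider "b = b'" | "b = c'" by auto
    then show ?thesis using that by cases auto
  qed
  have e3: "a * b * c = a' * b' * c'" using assms[of 0] by simp
  have 1: "(1 - a) * (1 - b) * (1 - c) = (1 - a') * (1 - b') * (1 - c')" by (rule assms)
  have 2: "(- 1 - a) * (- 1 - b) * (- 1 - c) = (- 1 - a') * (- 1 - b') * (- 1 - c')" by (rule assms)
  have "2 * (a + b + c) = 2 * (a' + b' + c')" using 1 2 e3 by algebra
  then have e1: "a + b + c = a' + b' + c'" by (rule double_cancel)
  have "2 * (a * b + a * c + b * c) = 2 * (a' * b' + a' * c' + b' * c')" using 1 2 e3 by algebra
  then have e2: "a * b + a * c + b * c = a' * b' + a' * c' + b' * c'" by (rule double_cancel)
  have "(a - a') * (a - b') * (a - c') = 0" using assms[of a] by simp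
  then consider "a = a'" | "a = b'" | "a = c'" by auto
  then show ?thesis
  proof cases
    case 1
    have "b + c = b' + c'" using e1 1 by simp
    moreover have "b * c = b' * c'" using e2 calculation 1 by algebra
    ultimately show ?thesis using two[of b c b' c'] 1 by simp
  next
    case 2
    have "b + c = a' + c'" using e1 2 by simp
    moreover have "b * c = a' * c'" using e2 calculation 2 by algebra
    ultimately show ?thesis using two[of b c a' c'] 2 by simp
  next
    case 3
    have "b + c = a' + b'" using e1 3 by simp
    moreover have "b * c = a' * b'" using e2 calculation 3 by algebra
    ultimately show ?thesis using two[of b c a' b'] 3 by simp
  qed
qed

text \<open>An eigenbasis is found among the eigencomponents of the standard basis vectors, by
  multilinearity of the determinant.\<close>

lemma unitarizable_diagonal:
  fixes A P :: cmat3
  assumes P: "invertible P" and U: "unitary3 (P ** A ** matrix_inv P)"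
    and char: "\<forall>x. charpoly3 A x = (x - a) * (x - b) * (x - c)"
  obtains R :: cmat3 and \<nu> :: "3 \<Rightarrow> complex"
  where "invertible R" "\<And>x j. (R *v (A *v x)) $ j = \<nu> j * (R *v x) $ j"
    "\<And>h :: complex \<Rightarrow> real. (\<Sum>j\<in>UNIV. h (\<nu> j)) = h a + h b + h c"
proof -
  define V where "V = P ** A ** matrix_inv P"
  have Pinv: "matrix_inv P ** P = mat 1" using P by (simp add: matrix_inv_left)
  have VP: "V *v (P *v x) = P *v (A *v x)" for x
  proof -
    have "V ** P = P ** A ** (matrix_inv P ** P)" by (simp add: V_def matrix_mul_assoc)
    then have "V ** P = P ** A" by (simp add: Pinv)
    then show ?thesis by (simp add: matrix_vector_mul_assoc)
  qed
  have Pscale: "P *v (k *s x) = k *s (P *v x)" for k x by (simp add: vec_eq_iff mat3_vec_nth algebra_simps)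
  have ker: "A *v x = \<mu> *s x" if "A *v (A *v x - \<mu> *s x) = \<mu> *s (A *v x - \<mu> *s x)" for \<mu> x
  proof -
    define u where "u = P *v (A *v x - \<mu> *s x)"
    have "V *v u = \<mu> *s u" unfolding u_def VP that Pscale ..
    moreover have "u = V *v (P *v x) - \<mu> *s (P *v x)"
      unfolding u_def VP Pscale[symmetric] by (simp add: matrix_vector_mult_diff_distrib)
    ultimately have "u = 0" using unitary3_kernel_square U unfolding V_def by blast
    then have "matrix_inv P *v u = 0" by simp
    then have "A *v x - \<mu> *s x = 0" unfolding u_def by (simp only: matrix_vector_mul_assoc Pinv matrix_vector_mul_lid)
    then show ?thesis by simp
  qed
  define E where "E = (\<lambda>x \<mu>. A *v x = \<mu> *s x \<and> \<mu> \<in> {a, b, c})"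
  have dec: "\<exists>x1 x2 x3. x = x1 + x2 + x3 \<and> E x1 a \<and> E x2 b \<and> E x3 c" for x
    using eigen_decomposition3[OF char ker, of x] unfolding E_def by simp
  have choose: "\<exists>y \<mu>. E y \<mu> \<and> f y \<noteq> 0" if "f x \<noteq> 0" "\<And>x y. f (x + y) = f x + (f y :: complex)" for f x
  proof -
    obtain x1 x2 x3 where x: "x = x1 + x2 + x3" "E x1 a" "E x2 b" "E x3 c" using dec by blast
    have "f x1 + f x2 + f x3 \<noteq> 0" using that x(1) by simp
    then have "f x1 \<noteq> 0 \<or> f x2 \<noteq> 0 \<or> f x3 \<noteq> 0" by auto
    then show ?thesis using x by blast
  qed
  have "det3 (axis 1 1) (axis 2 1) (axis 3 1) \<noteq> 0" by (simp add: det3_def axis_def)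
  then obtain x1 \<mu>1 where 1: "E x1 \<mu>1" "det3 x1 (axis 2 1) (axis 3 1) \<noteq> 0"
    using choose[of "\<lambda>x. det3 x (axis 2 1) (axis 3 1)"] det3_add1 by blast
  then obtain x2 \<mu>2 where 2: "E x2 \<mu>2" "det3 x1 x2 (axis 3 1) \<noteq> 0"
    using choose[of "\<lambda>x. det3 x1 x (axis 3 1)"] det3_add2 by blast
  then obtain x3 \<mu>3 where 3: "E x3 \<mu>3" "det3 x1 x2 x3 \<noteq> 0"
    using choose[of "\<lambda>x. det3 x1 x2 x"] det3_add3 by blast
  define \<nu> :: "3 \<Rightarrow> complex" where "\<nu> = (\<lambda>j. if j = 1 then \<mu>1 else if j = 2 then \<mu>2 else \<mu>3)"
  have \<nu>: "\<nu> 1 = \<mu>1" "\<nu> 2 = \<mu>2" "\<nu> 3 = \<mu>3" by (auto simp: \<nu>_def)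
  have eig: "A *v x1 = \<mu>1 *s x1" "A *v x2 = \<mu>2 *s x2" "A *v x3 = \<mu>3 *s x3" using 1 2 3 by (auto simp: E_def)
  \<comment> \<open>Applying \<open>mat x - A\<close> to the eigenbasis scales its determinant by
    the left side, so the eigenvalues found occur with the right multiplicities.\<close>
  have "(x - \<mu>1) * (x - \<mu>2) * (x - \<mu>3) = (x - a) * (x - b) * (x - c)" for x
  proof -
    have M: "(mat x - A) *v y = (x - \<mu>) *s y" if "A *v y = \<mu> *s y" for y \<mu>
      using that by (simp add: matrix_vector_mult_diff_rdistrib vec_eq_iff mat3_vec_nth mat_def forall_3 algebra_simps)
    have "det (mat x - A) * det3 x1 x2 x3 = (x - \<mu>1) * (x - \<mu>2) * (x - \<mu>3) * det3 x1 x2 x3"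
      unfolding det3_mult[symmetric] M[OF eig(1)] M[OF eig(2)] M[OF eig(3)] det3_scale ..
    then show ?thesis using 3(2) char by (simp add: charpoly3_def)
  qed
  then have h: "h \<mu>1 + h \<mu>2 + h \<mu>3 = h a + h b + h c" for h :: "complex \<Rightarrow> real"
    by (rule roots3_sum_eq)
  define X :: cmat3 where "X = (\<chi> i j. if j = 1 then x1$i else if j = 2 then x2$i else x3$i)"
  have Xe: "X$i$1 = x1$i" "X$i$2 = x2$i" "X$i$3 = x3$i" for i by (auto simp: X_def)
  have "det X = det3 x1 x2 x3" unfolding det_3 det3_def Xe by algebra
  then have X: "invertible X" using 3(2) by (simp add: invertible_det_nz)
  \<comment> \<open>The columns of \<open>X\<close> are the eigenvectors, so its inverse reads off
    eigencoordinates.\<close>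
  define R where "R = matrix_inv X"
  have R: "R ** X = mat 1" "X ** R = mat 1" using X by (simp_all add: R_def matrix_inv_left matrix_inv_right)
  define S :: cmat3 where "S = (\<chi> i j. if i = j then \<nu> i else 0)"
  have "A ** X = X ** S"
    using eig unfolding vec_eq_iff forall_3
    by (simp add: matrix_matrix_mult_def sum_3 Xe S_def \<nu> mat3_vec_nth mult_ac)
  then have "R ** A ** X = S" by (metis R(1) matrix_mul_assoc matrix_mul_lid)
  then have RA: "R ** A = S ** R" by (metis R(2) matrix_mul_assoc matrix_mul_rid)
  show ?thesis
  proof (rule that[of R \<nu>])
    show "invertible R" using R unfolding invertible_def by blast
    show "(R *v (A *v x)) $ j = \<nu> j * (R *v x) $ j" for x j
    proof -
      have "R *v (A *v x) = S *v (R *v x)" by (simp add: matrix_vector_mul_assoc RA)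
      moreover have "(S *v y) $ j = \<nu> j * y $ j" for y
        using exhaust_3[of j] by (auto simp: mat3_vec_nth S_def)
      ultimately show ?thesis by simp
    qed
    show "(\<Sum>j\<in>UNIV. h (\<nu> j)) = h a + h b + h c" for h :: "complex \<Rightarrow> real"
      using h[of h] by (simp add: sum_3 \<nu>)
  qed
qed

section \<open>Vector-valued modular forms\<close>

lemma Dsc_cong:
  assumes "\<And>w. w \<in> Hup \<Longrightarrow> f w = h w" "z \<in> Hup"
  shows "Dsc k f z = Dsc k h z"
proof -
  have "eventually (\<lambda>w. f w = h w) (nhds z)"
    using eventually_nhds_in_open[OF open_Hup assms(2)] by eventually_elim (rule assms(1))
  then show ?thesis using deriv_cong_ev[OF _ refl] assms by (metis Dsc_def)
qed

lemma Hup_derivative: "f holomorphic_on Hup \<Longrightarrow> z \<in> Hup \<Longrightarrow> (f has_field_derivative deriv f z) (at z)"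
  using holomorphic_derivI open_Hup by blast

lemma deriv_eq_Dsc: "deriv f z = 2 * of_real pi * \<i> * (Dsc k f z - of_real k * Pfun z * f z)"
  by (simp add: Dsc_def)

lemma Dsc_holomorphic: "f holomorphic_on Hup \<Longrightarrow> Dsc k f holomorphic_on Hup"
  unfolding Dsc_def[abs_def] by (intro holomorphic_intros holomorphic_deriv Pfun_holomorphic) auto

lemma mat_vec_holomorphic:
  assumes "\<And>i. (\<lambda>z. F z $ i) holomorphic_on Hup"
  shows "(\<lambda>z. ((M::cmat3) *v F z) $ j) holomorphic_on Hup"
  unfolding mat3_vec_nth by (intro holomorphic_intros assms)

lemma Dsc_mat_vec:
  assumes F: "\<And>i. (\<lambda>z. F z $ i) holomorphic_on Hup" and z: "z \<in> Hup"
  shows "Dsc k (\<lambda>w. ((M::cmat3) *v F w) $ j) z = (M *v Dvec k F z) $ j"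
proof -
  note d = Hup_derivative[OF F z]
  have "((\<lambda>w. M$j$1 * F w$1 + M$j$2 * F w$2 + M$j$3 * F w$3) has_field_derivative
      M$j$1 * deriv (\<lambda>w. F w$1) z + M$j$2 * deriv (\<lambda>w. F w$2) z + M$j$3 * deriv (\<lambda>w. F w$3) z) (at z)"
    by (auto intro!: derivative_eq_intros d)
  from DERIV_imp_deriv[OF this] show ?thesis
    using z by (simp add: Dsc_def Dvec_def mat3_vec_nth field_simps)
qed

lemma Dvec_holomorphic:
  assumes "\<And>i. (\<lambda>z. F z $ i) holomorphic_on Hup"
  shows "(\<lambda>z. Dvec k F z $ i) holomorphic_on Hup"
  by (rule holomorphic_transform[OF Dsc_holomorphic[OF assms]]) (simp add: Dvec_def)

text \<open>Vanishes for all \<open>g\<close> exactly when \<open>P\<close> is quasimodular. Before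
  that is known, its holomorphy still allows it to be differentiated as a coefficient.\<close>

definition slashP_defect :: "mat2 \<Rightarrow> complex \<Rightarrow> complex" where
  "slashP_defect g z = slashP g z - Pfun z"

lemma slashP_defect_holomorphic:
  assumes "g \<in> SL2Z"
  shows "slashP_defect g holomorphic_on Hup"
proof -
  have "mob g holomorphic_on Hup"
    unfolding holomorphic_on_open[OF open_Hup] using mob_has_derivative[OF assms] by blast
  then have "(Pfun \<circ> mob g) holomorphic_on Hup"
    by (rule holomorphic_on_compose_gen[OF _ Pfun_holomorphic]) (use mob_in_Hup assms in blast)
  then have 1: "(\<lambda>z. Pfun (mob g z)) holomorphic_on Hup" by (simp add: o_def)
  have 2: "jfac g holomorphic_on Hup" unfolding jfac_def[abs_def] by (intro holomorphic_intros)
  show ?thesis unfolding slashP_defect_def[abs_def] slashP_def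
    by (intro holomorphic_intros 1 2 Pfun_holomorphic) (use jfac_nonzero assms in auto)
qed

text \<open>Two functions \<open>F\<close> and \<open>G\<close> are needed to iterate: after one
  derivative, the vector on the right is no longer \<open>D F\<close> but \<open>D F\<close> plus a
  multiple of \<open>F\<close>.\<close>

lemma Dvec_mob:
  assumes F: "\<And>i. (\<lambda>z. F z $ i) holomorphic_on Hup" and G: "\<And>i. (\<lambda>z. G z $ i) holomorphic_on Hup"
    and g: "g \<in> SL2Z"
    and tr: "\<And>z. z \<in> Hup \<Longrightarrow> F (mob g z) = jfac g z powr of_real k *s (M *v G z)"
    and z: "z \<in> Hup"
  shows "Dvec k F (mob g z) = jfac g z powr of_real (k + 2) *s
            (M *v (Dvec k G z + (of_real k * slashP_defect g z) *s G z))"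
proof -
  have "Dvec k F (mob g z) $ i = (jfac g z powr of_real (k + 2) *s
            (M *v (Dvec k G z + (of_real k * slashP_defect g z) *s G z))) $ i" for i
  proof -
    define h where "h = (\<lambda>z. (M *v G z) $ i)"
    have "Dsc k (\<lambda>w. F w $ i) (mob g z) = jfac g z powr of_real (k + 2) *
            (deriv h z / (2 * of_real pi * \<i>) + of_real k * slashP g z * h z)"
      by (rule Dsc_mob[OF F _ g _ z]) (auto simp: h_def tr intro: mat_vec_holomorphic G)
    also have "deriv h z / (2 * of_real pi * \<i>) + of_real k * slashP g z * h z
        = Dsc k h z + of_real k * slashP_defect g z * h z"
      by (simp add: Dsc_def slashP_defect_def algebra_simps)
    also have "Dsc k h z = (M *v Dvec k G z) $ i"
      unfolding h_def by (rule Dsc_mat_vec[OF G z])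
    finally show ?thesis
      using mob_in_Hup[OF g z] by (simp add: Dvec_def[of k F] h_def mat3_vec_nth algebra_simps)
  qed
  then show ?thesis by (simp add: vec_eq_iff)
qed

section \<open>The Wronskian of a vector of functions\<close>

definition wronskian :: "real \<Rightarrow> (complex \<Rightarrow> complex^3) \<Rightarrow> complex \<Rightarrow> complex" where
  "wronskian k F z = det3 (F z) (Dvec k F z) (Dvec (k + 2) (Dvec k F) z)"

text \<open>No property of \<open>P\<close> is used here: replacing \<open>P\<close> by its slash only changes \<open>D F\<close> and
  \<open>D\<^sup>2 F\<close> by lower order terms, which cancel in the determinant.\<close>

lemma wronskian_mob:
  assumes F: "\<And>i. (\<lambda>z. F z $ i) holomorphic_on Hup" and g: "g \<in> SL2Z"
    and tr: "\<And>z. z \<in> Hup \<Longrightarrow> F (mob g z) = jfac g z powr of_real k *s (M *v F z)"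
    and z: "z \<in> Hup"
  shows "wronskian k F (mob g z) = jfac g z powr of_real (3 * k + 6) * (det M * wronskian k F z)"
proof -
  define F1 where "F1 = Dvec k F"
  define d where "d = (\<lambda>z. of_real k * slashP_defect g z)"
  \<comment> \<open>\<open>G1\<close> and \<open>G2\<close> are what the first and second
    derivatives become under \<open>g\<close>, up to the automorphy factor and
    \<open>M\<close>.\<close>
  define G1 where "G1 = (\<lambda>z. F1 z + d z *s F z)"
  have d: "d holomorphic_on Hup" unfolding d_def by (intro holomorphic_intros slashP_defect_holomorphic g)
  have F1: "(\<lambda>z. F1 z $ i) holomorphic_on Hup" for i unfolding F1_def by (rule Dvec_holomorphic[OF F])
  have G1: "(\<lambda>z. G1 z $ i) holomorphic_on Hup" for i
    unfolding G1_def vector_add_component vector_smult_component by (intro holomorphic_intros F F1 d)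
  have tr1: "F1 (mob g z) = jfac g z powr of_real (k + 2) *s (M *v G1 z)" if "z \<in> Hup" for z
    unfolding F1_def G1_def d_def by (rule Dvec_mob[OF F F g tr that])
  define G2 where "G2 = Dvec (k + 2) G1 z + (of_real (k + 2) * slashP_defect g z) *s G1 z"
  have tr2: "Dvec (k + 2) F1 (mob g z) = jfac g z powr of_real (k + 2 + 2) *s (M *v G2)"
    unfolding G2_def by (rule Dvec_mob[OF F1 G1 g tr1 z])
  have "\<exists>a b. G2 = Dvec (k + 2) F1 z + a *s F1 z + b *s F z"
  proof -
    define J where "J = 2 * of_real pi * \<i>"
    have J: "J \<noteq> 0" by (simp add: J_def)
    have comp: "Dvec (k + 2) G1 z $ i = Dvec (k + 2) F1 z $ i + d z * F1 z $ i
        + (deriv d z / J + 2 * Pfun z * d z) * F z $ i" for i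
    proof -
      have "((\<lambda>z. F1 z $ i + d z * F z $ i) has_field_derivative
          deriv (\<lambda>z. F1 z $ i) z + (deriv d z * F z $ i + deriv (\<lambda>z. F z $ i) z * d z)) (at z)"
        using Hup_derivative[OF F1 z] Hup_derivative[OF F z] Hup_derivative[OF d z]
        by (intro DERIV_add DERIV_mult)
      then have D: "deriv (\<lambda>z. G1 z $ i) z = deriv (\<lambda>z. F1 z $ i) z + (deriv d z * F z $ i + deriv (\<lambda>z. F z $ i) z * d z)"
        unfolding G1_def vector_add_component vector_smult_component by (rule DERIV_imp_deriv)
      have dF: "deriv (\<lambda>z. F z $ i) z = J * (F1 z $ i - of_real k * Pfun z * F z $ i)"
        using z unfolding J_def by (simp add: F1_def Dvec_def deriv_eq_Dsc[of _ _ k])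
      show ?thesis
        using z J unfolding Dvec_def Dsc_def
        by (simp add: D J_def[symmetric] dF) (simp add: G1_def field_simps)
    qed
    show ?thesis
      by (rule exI[of _ "d z + of_real (k + 2) * slashP_defect g z"],
          rule exI[of _ "deriv d z / J + 2 * Pfun z * d z + of_real (k + 2) * slashP_defect g z * d z"])
         (simp add: vec_eq_iff G2_def comp, simp add: G1_def algebra_simps)
  qed
  then obtain a b where G2: "G2 = Dvec (k + 2) F1 z + a *s F1 z + b *s F z" by blast
  have j: "jfac g z powr of_real (3 * k + 6) = jfac g z powr of_real k * jfac g z powr of_real (k + 2) * jfac g z powr of_real (k + 2 + 2)"
    by (simp add: powr_add[symmetric] algebra_simps)
  have "wronskian k F (mob g z) = jfac g z powr of_real (3 * k + 6) * (det M * det3 (F z) (G1 z) G2)"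
    unfolding wronskian_def F1_def[symmetric] tr[OF z] tr1[OF z] tr2 det3_scale det3_mult j ..
  also have "det3 (F z) (G1 z) G2 = wronskian k F z"
    unfolding wronskian_def F1_def[symmetric] G2 G1_def by (simp add: det3_def algebra_simps)
  finally show ?thesis .
qed

lemma det3_has_derivative:
  assumes "\<And>i. ((\<lambda>z. x z $ i) has_field_derivative x' $ i) (at z)"
    "\<And>i. ((\<lambda>z. y z $ i) has_field_derivative y' $ i) (at z)"
    "\<And>i. ((\<lambda>z. w z $ i) has_field_derivative w' $ i) (at z)"
  shows "((\<lambda>z. det3 (x z) (y z) (w z)) has_field_derivative
     det3 x' (y z) (w z) + det3 (x z) y' (w z) + det3 (x z) (y z) w') (at z)"
  unfolding det3_def by (auto intro!: derivative_eq_intros assms simp: algebra_simps)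

lemma det3_holomorphic:
  assumes "\<And>i. (\<lambda>z. x z $ i) holomorphic_on S" "\<And>i. (\<lambda>z. y z $ i) holomorphic_on S"
    "\<And>i. (\<lambda>z. w z $ i) holomorphic_on S"
  shows "(\<lambda>z. det3 (x z) (y z) (w z)) holomorphic_on S"
  unfolding det3_def by (intro holomorphic_intros assms)

lemma wronskian_holomorphic:
  assumes "\<And>i. (\<lambda>z. F z $ i) holomorphic_on Hup"
  shows "wronskian k F holomorphic_on Hup"
  unfolding wronskian_def[abs_def] by (intro det3_holomorphic Dvec_holomorphic assms)

text \<open>Each of the six terms contains one factor from each coordinate, so the three exponents
  add up in every term.\<close>

lemma det3_qexp:
  assumes "\<And>j. qexp (l j) (\<lambda>z. x z $ j)" "\<And>j. qexp (l j) (\<lambda>z. y z $ j)" "\<And>j. qexp (l j) (\<lambda>z. w z $ j)"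
  shows "qexp (\<Sum>j\<in>UNIV. l j) (\<lambda>z. det3 (x z) (y z) (w z))"
proof -
  have *: "qexp (\<Sum>j\<in>UNIV. l j) (\<lambda>z. f z * (g z * h z))" if "qexp (l 1) f" "qexp (l 2) g" "qexp (l 3) h" for f g h
    using qexp_mult[OF that(1) qexp_mult[OF that(2,3)]] by (simp add: sum_3 add_ac)
  have "qexp (\<Sum>j\<in>UNIV. l j) (\<lambda>z. (x z $ 1 * (y z $ 2 * w z $ 3) + (-1) * (x z $ 1 * (w z $ 2 * y z $ 3)))
     + ((y z $ 1 * (w z $ 2 * x z $ 3) + (-1) * (w z $ 1 * (y z $ 2 * x z $ 3)))
     + (w z $ 1 * (x z $ 2 * y z $ 3) + (-1) * (y z $ 1 * (x z $ 2 * w z $ 3)))))"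
    by (intro qexp_add qexp_cmult * assms)
  then show ?thesis by (rule qexp_cong[THEN iffD1, rotated]) (simp add: det3_def algebra_simps)
qed

subsection \<open>Solutions of a monic third order equation\<close>

definition mlde_vector :: "real \<Rightarrow> (complex \<Rightarrow> complex) \<Rightarrow> (complex \<Rightarrow> complex) \<Rightarrow> (complex \<Rightarrow> complex^3) \<Rightarrow> bool" where
  "mlde_vector k M4 M6 F \<longleftrightarrow> (\<forall>i. (\<lambda>z. F z $ i) holomorphic_on Hup) \<and>
     (\<forall>z\<in>Hup. Dvec (k + 4) (Dvec (k + 2) (Dvec k F)) z = - (M4 z *s Dvec k F z + M6 z *s F z))"

lemma fundamental_system3_vector:
  assumes "fundamental_system3 k M4 M6 (\<lambda>i z. F z $ i)"
  shows "mlde_vector k M4 M6 F"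
    and "\<And>c. (\<And>z. z \<in> Hup \<Longrightarrow> (\<Sum>i\<in>UNIV. c i * F z $ i) = 0) \<Longrightarrow> c i = 0"
proof -
  have sol: "mlde3_sol k M4 M6 (\<lambda>z. F z $ i)" for i
    using assms unfolding fundamental_system3_def by blast
  show "mlde_vector k M4 M6 F"
    unfolding mlde_vector_def
  proof (intro conjI allI ballI)
    show "(\<lambda>z. F z $ i) holomorphic_on Hup" for i using sol by (simp add: mlde3_sol_def)
    fix z assume z: "z \<in> Hup"
    have 1: "Dvec k F w $ i = Dsc k (\<lambda>w. F w $ i) w" if "w \<in> Hup" for w i
      using that by (simp add: Dvec_def)
    have 2: "Dvec (k + 2) (Dvec k F) w $ i = Dsc (k + 2) (Dsc k (\<lambda>w. F w $ i)) w" if "w \<in> Hup" for w i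
      using that Dsc_cong[OF 1 that] by (simp add: Dvec_def[of "k + 2"])
    have 3: "Dvec (k + 4) (Dvec (k + 2) (Dvec k F)) z $ i = Dsc (k + 4) (Dsc (k + 2) (Dsc k (\<lambda>w. F w $ i))) z" for i
      using z Dsc_cong[OF 2 z] by (simp add: Dvec_def[of "k + 4"])
    have eq0: "Dsc_pow k 3 (\<lambda>w. F w $ i) z + M4 z * Dsc_pow k 1 (\<lambda>w. F w $ i) z + M6 z * F z $ i = 0" for i
      using sol[of i] z unfolding mlde3_sol_def by blast
    have pow: "Dsc_pow k 3 (\<lambda>w. F w $ i) z = Dsc (k + 4) (Dsc (k + 2) (Dsc k (\<lambda>w. F w $ i))) z"
      "Dsc_pow k 1 (\<lambda>w. F w $ i) z = Dsc k (\<lambda>w. F w $ i) z" for i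
      by (simp_all add: eval_nat_numeral)
    have "Dvec (k + 4) (Dvec (k + 2) (Dvec k F)) z $ i + M4 z * Dvec k F z $ i + M6 z * F z $ i = 0" for i
      using eq0[of i] unfolding 3 1[OF z] pow .
    then have "Dvec (k + 4) (Dvec (k + 2) (Dvec k F)) z $ i = - (M4 z * Dvec k F z $ i + M6 z * F z $ i)" for i
      unfolding add.assoc by (rule eq_neg_iff_add_eq_0[THEN iffD2])
    then show "Dvec (k + 4) (Dvec (k + 2) (Dvec k F)) z = - (M4 z *s Dvec k F z + M6 z *s F z)"
      by (simp add: vec_eq_iff)
  qed
  show "c i = 0" if "\<And>z. z \<in> Hup \<Longrightarrow> (\<Sum>i\<in>UNIV. c i * F z $ i) = 0" for c i
    using assms that unfolding fundamental_system3_def by blast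
qed

text \<open>Abel's formula as an algebraic identity. Repeated vectors kill every contribution except
  the diagonal ones; as the third order equation has no second order term, these come from
  \<open>P\<close> alone: \<open>a\<close>, \<open>b\<close>, \<open>c\<close> stand for
  \<open>P\<close> times the weights \<open>k\<close>, \<open>k + 2\<close>, \<open>k + 4\<close>,
  whose sum is \<open>3 * k + 6\<close>.\<close>

lemma det3_ode:
  "det3 (J *s (y - a *s x)) y w + det3 x (J *s (w - b *s y)) w + det3 x y (J *s (- (m *s y + n *s x) - c *s w))
    = - (J * (a + b + c)) * det3 x y w"
  unfolding det3_def vector_smult_component vector_minus_component vector_uminus_component vector_add_component
  by algebra

lemma Dsc_wronskian:
  assumes mlde: "mlde_vector k M4 M6 F" and z: "z \<in> Hup"
  shows "Dsc (3 * k + 6) (wronskian k F) z = 0"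
proof -
  define F1 where "F1 = Dvec k F"
  define F2 where "F2 = Dvec (k + 2) F1"
  define J where "J = 2 * of_real pi * \<i>"
  have J: "J \<noteq> 0" by (simp add: J_def)
  have F: "(\<lambda>z. F z $ i) holomorphic_on Hup" for i using mlde by (simp add: mlde_vector_def)
  have F1: "(\<lambda>z. F1 z $ i) holomorphic_on Hup" for i unfolding F1_def by (rule Dvec_holomorphic[OF F])
  have F2: "(\<lambda>z. F2 z $ i) holomorphic_on Hup" for i unfolding F2_def by (rule Dvec_holomorphic[OF F1])
  have d: "((\<lambda>z. G z $ i) has_field_derivative (J *s (Dvec l G z - (of_real l * Pfun z) *s G z)) $ i) (at z)"
    if "\<And>i. (\<lambda>z. G z $ i) holomorphic_on Hup" for G l i
    using Hup_derivative[OF that z, of i] z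
    unfolding J_def by (simp add: deriv_eq_Dsc[of _ _ l] Dvec_def right_diff_distrib mult.assoc)
  have F3: "Dvec (k + 4) F2 z = - (M4 z *s F1 z + M6 z *s F z)"
    using mlde z unfolding mlde_vector_def F1_def F2_def by blast
  have "deriv (wronskian k F) z = - (J * of_real (3 * k + 6) * Pfun z) * wronskian k F z"
    unfolding wronskian_def[abs_def] F1_def[symmetric] F2_def[symmetric]
    using DERIV_imp_deriv[OF det3_has_derivative[OF d[OF F, of _ k] d[OF F1, of _ "k + 2"] d[OF F2, of _ "k + 4"]]]
    unfolding F3 F1_def[symmetric] F2_def[symmetric] det3_ode
    by (simp add: algebra_simps)
  then show ?thesis using J by (simp add: Dsc_def J_def[symmetric])
qed

text \<open>A zero at \<open>z0\<close> gives a nontrivial combination of the components whose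
  initial data at \<open>z0\<close> vanish to second order. It solves the same equation, hence
  vanishes identically, against independence.\<close>

lemma wronskian_nonzero:
  assumes mlde: "mlde_vector k M4 M6 F" and M: "M4 holomorphic_on Hup" "M6 holomorphic_on Hup"
    and indep: "\<And>c i. (\<And>z. z \<in> Hup \<Longrightarrow> (\<Sum>i\<in>UNIV. c i * F z $ i) = 0) \<Longrightarrow> c i = 0"
    and z: "z0 \<in> Hup"
  shows "wronskian k F z0 \<noteq> 0"
proof
  define F1 where "F1 = Dvec k F"
  define F2 where "F2 = Dvec (k + 2) F1"
  define J where "J = 2 * of_real pi * \<i>"
  assume "wronskian k F z0 = 0"
  then have w0: "det3 (F z0) (F1 z0) (F2 z0) = 0" by (simp add: wronskian_def F1_def F2_def)
  obtain c :: "complex^3" where c: "c \<noteq> 0"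
    "(\<Sum>i\<in>UNIV. c$i * F z0 $ i) = 0" "(\<Sum>i\<in>UNIV. c$i * F1 z0 $ i) = 0" "(\<Sum>i\<in>UNIV. c$i * F2 z0 $ i) = 0"
    by (rule det3_eq_0_kernel[OF w0])
  have F: "(\<lambda>z. F z $ i) holomorphic_on Hup" for i using mlde by (simp add: mlde_vector_def)
  have F1: "(\<lambda>z. F1 z $ i) holomorphic_on Hup" for i unfolding F1_def by (rule Dvec_holomorphic[OF F])
  have F2: "(\<lambda>z. F2 z $ i) holomorphic_on Hup" for i unfolding F2_def by (rule Dvec_holomorphic[OF F1])
  define pr where "pr = (\<lambda>(G :: complex \<Rightarrow> complex^3) z. \<Sum>i\<in>UNIV. c$i * G z $ i)"
  have d: "deriv (pr G) z = J * (pr (Dvec l G) z - of_real l * Pfun z * pr G z)"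
    if "\<And>i. (\<lambda>z. G z $ i) holomorphic_on Hup" "z \<in> Hup" for G l z
  proof -
    have "((\<lambda>z. G z $ i) has_field_derivative J * (Dvec l G z $ i - of_real l * Pfun z * G z $ i)) (at z)" for i
      using Hup_derivative[OF that(1) that(2), of i] that(2)
      unfolding J_def by (simp add: deriv_eq_Dsc[of _ _ l] Dvec_def)
    then have "(pr G has_field_derivative (\<Sum>i\<in>UNIV. c$i * (J * (Dvec l G z $ i - of_real l * Pfun z * G z $ i)))) (at z)"
      unfolding pr_def by (auto intro!: derivative_eq_intros simp: mult.commute)
    from DERIV_imp_deriv[OF this] show ?thesis
      by (simp add: pr_def sum_3 algebra_simps)
  qed
  \<comment> \<open>The companion system for this combination: \<open>Y\<close> holds it and its
    first two Serre derivatives, and \<open>m\<close> is the coefficient matrix, with the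
    \<open>P\<close> terms of the Serre derivatives on the diagonal.\<close>
  define Y :: "3 \<Rightarrow> complex \<Rightarrow> complex" where "Y = (\<lambda>i. if i = 1 then pr F else if i = 2 then pr F1 else pr F2)"
  define m :: "3 \<Rightarrow> 3 \<Rightarrow> complex \<Rightarrow> complex" where
    "m = (\<lambda>i j. if i = 1 then (if j = 1 then (\<lambda>z. - (J * of_real k * Pfun z)) else if j = 2 then (\<lambda>_. J) else (\<lambda>_. 0))
       else if i = 2 then (if j = 2 then (\<lambda>z. - (J * of_real (k + 2) * Pfun z)) else if j = 3 then (\<lambda>_. J) else (\<lambda>_. 0))
       else (if j = 1 then (\<lambda>z. - J * M6 z) else if j = 2 then (\<lambda>z. - J * M4 z) else (\<lambda>z. - (J * of_real (k + 4) * Pfun z))))"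
  have Y: "Y 1 = pr F" "Y 2 = pr F1" "Y 3 = pr F2" by (auto simp: Y_def)
  have "pr F z = 0" if zz: "z \<in> Hup" for z
  proof -
      have 1: "Y i holomorphic_on Hup" for i
        using F F1 F2 unfolding Y_def pr_def by (auto intro!: holomorphic_intros)
      have 2: "m i j holomorphic_on Hup" for i j
        using M Pfun_holomorphic unfolding m_def by (simp; intro conjI impI holomorphic_intros)
      have 3: "Y i z0 = 0" for i using c unfolding Y_def pr_def by auto
      have 4: "deriv (Y i) z = (\<Sum>j\<in>UNIV. m i j z * Y j z)" if z: "z \<in> Hup" for i z
      proof -
      have F3: "pr (Dvec (k + 4) F2) z = - (M4 z * pr F1 z + M6 z * pr F z)"
      proof -
        have eq: "Dvec (k + 4) F2 z = - (M4 z *s F1 z + M6 z *s F z)"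
          using mlde z unfolding mlde_vector_def F1_def F2_def by blast
        show ?thesis unfolding pr_def eq by (simp add: sum_3 algebra_simps)
      qed
      consider "i = 1" | "i = 2" | "i = 3" using exhaust_3 by blast
      then show ?thesis
      proof cases
        case 1
        then show ?thesis using d[OF F z, of k] by (simp add: sum_3 Y m_def F1_def algebra_simps)
      next
        case 2
        then show ?thesis using d[OF F1 z, of "k + 2"] by (simp add: sum_3 Y m_def F2_def algebra_simps)
      next
        case 3
        then show ?thesis using d[OF F2 z, of "k + 4"] unfolding F3 by (simp add: sum_3 Y m_def algebra_simps)
      qed
      qed
    have "Y 1 z = 0"
      by (rule linear_ode_zero[OF open_Hup connected_Hup 1 2 4 z 3 zz])
    then show ?thesis by (simp add: Y)
  qed
  then have "c $ i = 0" for i by (intro indep[of "\<lambda>i. c $ i"]) (simp add: pr_def)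
  then show False using c(1) by (simp add: vec_eq_iff)
qed

subsection \<open>The spaces of vector-valued forms\<close>

lemma moderate_growthI:
  "N > 0 \<Longrightarrow> c > 0 \<Longrightarrow> (\<And>x y. y > c \<Longrightarrow> norm (f (Complex x y)) \<le> y powr N) \<Longrightarrow> moderate_growth f"
  unfolding moderate_growth_def by blast

text \<open>The bound \<open>y powr N\<close> carries no constant, so the scalar is absorbed by one
  more power of \<open>y\<close>, once \<open>y\<close> exceeds \<open>norm a\<close>.\<close>

lemma moderate_growth_cmult:
  assumes "moderate_growth f"
  shows "moderate_growth (\<lambda>z. a * f z)"
proof -
  obtain N c where N: "N > 0" "c > 0" "\<And>x y. y > c \<Longrightarrow> norm (f (Complex x y)) \<le> y powr N"
    using assms unfolding moderate_growth_def by blast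
  have "norm (a * f (Complex x y)) \<le> y powr (N + 1)" if "y > max c (norm a)" for x y
  proof -
    have "norm a * norm (f (Complex x y)) \<le> y * y powr N"
      using that N by (intro mult_mono) auto
    moreover have "y powr (N + 1) = y * y powr N" using that N by (simp add: powr_add)
    ultimately show ?thesis by (simp add: norm_mult)
  qed
  then show ?thesis using N(1,2) by (intro moderate_growthI[of "N + 1" "max c (norm a)"]) auto
qed

lemma moderate_growth_add:
  assumes "moderate_growth f" "moderate_growth h"
  shows "moderate_growth (\<lambda>z. f z + h z)"
proof -
  obtain N c where N: "N > 0" "c > 0" "\<And>x y. y > c \<Longrightarrow> norm (f (Complex x y)) \<le> y powr N"
    using assms(1) unfolding moderate_growth_def by blast
  obtain N' c' where N': "N' > 0" "c' > 0" "\<And>x y. y > c' \<Longrightarrow> norm (h (Complex x y)) \<le> y powr N'"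
    using assms(2) unfolding moderate_growth_def by blast
  have "norm (f (Complex x y) + h (Complex x y)) \<le> y powr (N + N' + 1)" if y: "y > max 2 (max c c')" for x y
  proof -
    have "norm (f (Complex x y) + h (Complex x y)) \<le> y powr N + y powr N'"
      using y by (intro norm_triangle_le add_mono N N') auto
    also have "\<dots> \<le> y powr (N + N') + y powr (N + N')"
      using y N N' by (intro add_mono powr_mono) auto
    also have "\<dots> = 2 * y powr (N + N')" by simp
    also have "\<dots> \<le> y * y powr (N + N')" using y by (intro mult_right_mono) auto
    also have "\<dots> = y powr (N + N' + 1)" using y by (simp add: powr_add)
    finally show ?thesis .
  qed
  then show ?thesis using N(1) N'(1) by (intro moderate_growthI[of "N + N' + 1" "max 2 (max c c')"]) auto
qed

text \<open>Carries the multiplier over to the matrix side of the transformation law, leaving only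
  the power of \<open>jfac\<close> as scalar factor.\<close>

definition twist :: "(mat2 \<Rightarrow> complex) \<Rightarrow> (mat2 \<Rightarrow> cmat3) \<Rightarrow> mat2 \<Rightarrow> cmat3" where
  "twist v \<rho> g = (\<chi> i j. v g * \<rho> g $ i $ j)"

lemma twist_mult: "twist v \<rho> g *v x = v g *s (\<rho> g *v x)"
  by (simp add: vec_eq_iff mat3_vec_nth twist_def algebra_simps)

lemma Hk_iff:
  assumes v: "\<And>g. g \<in> SL2Z \<Longrightarrow> v g \<noteq> 0"
  shows "F \<in> Hk k \<rho> v \<longleftrightarrow> (\<forall>z. z \<notin> Hup \<longrightarrow> F z = 0) \<and>
      (\<forall>i. (\<lambda>z. F z $ i) holomorphic_on Hup) \<and> (\<forall>i. moderate_growth (\<lambda>z. F z $ i)) \<and>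
      (\<forall>g\<in>SL2Z. \<forall>z\<in>Hup. F (mob g z) = jfac g z powr of_real k *s (twist v \<rho> g *v F z))"
proof -
  have "(inverse (v g) * inverse (jfac g z powr of_real k)) *s x = y \<longleftrightarrow>
      x = jfac g z powr of_real k *s (v g *s y)" if "g \<in> SL2Z" "z \<in> Hup" for g z and x y :: "complex^3"
  proof -
    have "jfac g z powr of_real k \<noteq> 0" using jfac_nonzero[OF that] by simp
    then show ?thesis using v[OF that(1)] by (simp add: vec_eq_iff field_simps)
  qed
  then show ?thesis unfolding Hk_def twist_mult by simp
qed

text \<open>Row \<open>j\<close> of \<open>R\<close> extracts a component on which translation acts
  by \<open>ee (lam j)\<close>. The range of \<open>lam j\<close> makes moderate growth equivalent
  to an expansion with exponent \<open>lam j\<close>.\<close>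

locale cusp_diagonal =
  fixes \<rho> :: "mat2 \<Rightarrow> cmat3" and v :: "mat2 \<Rightarrow> complex" and R :: cmat3 and lam :: "3 \<Rightarrow> real"
  assumes v_nonzero: "\<And>g. g \<in> SL2Z \<Longrightarrow> v g \<noteq> 0"
    and R_invertible: "invertible R"
    and lam_ge: "\<And>j. 0 \<le> lam j" and lam_less: "\<And>j. lam j < 1"
    and diagonal: "\<And>x j. (R *v (twist v \<rho> Tmat *v x)) $ j = ee (lam j) * (R *v x) $ j"
begin

lemma Hk_off: "F \<in> Hk k \<rho> v \<Longrightarrow> z \<notin> Hup \<Longrightarrow> F z = 0"
  by (simp add: Hk_iff[OF v_nonzero])

lemma Hk_holomorphic: "F \<in> Hk k \<rho> v \<Longrightarrow> (\<lambda>z. F z $ i) holomorphic_on Hup"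
  by (simp add: Hk_iff[OF v_nonzero])

lemma Hk_mob: "F \<in> Hk k \<rho> v \<Longrightarrow> g \<in> SL2Z \<Longrightarrow> z \<in> Hup \<Longrightarrow>
    F (mob g z) = jfac g z powr of_real k *s (twist v \<rho> g *v F z)"
  by (simp add: Hk_iff[OF v_nonzero])

lemma Hk_qexp:
  assumes F: "F \<in> Hk k \<rho> v"
  shows "qexp (lam j) (\<lambda>z. (R *v F z) $ j)"
proof (rule qexpI[OF _ _ lam_ge lam_less])
  show "(\<lambda>z. (R *v F z) $ j) holomorphic_on Hup" by (rule mat_vec_holomorphic[OF Hk_holomorphic[OF F]])
  have "moderate_growth (\<lambda>z. F z $ i)" for i using F by (simp add: Hk_iff[OF v_nonzero])
  then show "moderate_growth (\<lambda>z. (R *v F z) $ j)"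
    unfolding mat3_vec_nth by (intro moderate_growth_add moderate_growth_cmult)
  show "(R *v F (z + 1)) $ j = ee (lam j) * (R *v F z) $ j" if "z \<in> Hup" for z
    using Hk_mob[OF F SL2Z_generators(1) that] by (simp add: diagonal)
qed

text \<open>The converse of the expansion: growth only has to be checked in eigencoordinates, since
  the inverse of \<open>R\<close> is constant.\<close>

lemma HkI:
  assumes off: "\<And>z. z \<notin> Hup \<Longrightarrow> F z = 0"
    and q: "\<And>j. qexp (lam j) (\<lambda>z. (R *v F z) $ j)"
    and tr: "\<And>g z. g \<in> SL2Z \<Longrightarrow> z \<in> Hup \<Longrightarrow> F (mob g z) = jfac g z powr of_real k *s (twist v \<rho> g *v F z)"
  shows "F \<in> Hk k \<rho> v"
proof -
  have F: "F z = matrix_inv R *v (R *v F z)" for z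
    by (simp add: matrix_vector_mul_assoc matrix_inv_left[OF R_invertible])
  have "(\<lambda>z. (matrix_inv R *v (R *v F z)) $ i) holomorphic_on Hup" for i
    by (rule mat_vec_holomorphic[OF qexp_holomorphic[OF q]])
  then have 1: "(\<lambda>z. F z $ i) holomorphic_on Hup" for i by (simp only: F[symmetric])
  have "moderate_growth (\<lambda>z. (matrix_inv R *v (R *v F z)) $ i)" for i
    unfolding mat3_vec_nth[of "matrix_inv R"]
    by (intro moderate_growth_add moderate_growth_cmult qexp_moderate_growth[OF q lam_ge])
  then have 2: "moderate_growth (\<lambda>z. F z $ i)" for i by (simp only: F[symmetric])
  show ?thesis by (simp add: Hk_iff[OF v_nonzero] off 1 2 tr)
qed

lemma Hk_zero: "0 \<in> Hk k \<rho> v"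
  by (rule HkI) (auto simp: mat3_vec_nth qexp_zero vec_eq_iff)

lemma Hk_add:
  assumes "F \<in> Hk k \<rho> v" "G \<in> Hk k \<rho> v"
  shows "F + G \<in> Hk k \<rho> v"
proof (rule HkI)
  show "qexp (lam j) (\<lambda>z. (R *v (F + G) z) $ j)" for j
    using qexp_add[OF Hk_qexp[OF assms(1)] Hk_qexp[OF assms(2)], of j]
    by (simp add: matrix_vector_right_distrib)
qed (simp_all add: Hk_off[OF assms(1)] Hk_off[OF assms(2)] Hk_mob[OF assms(1)] Hk_mob[OF assms(2)]
       matrix_vector_right_distrib vector_add_ldistrib)

lemma Hk_sum: "finite A \<Longrightarrow> (\<And>i. i \<in> A \<Longrightarrow> F i \<in> Hk k \<rho> v) \<Longrightarrow> (\<Sum>i\<in>A. F i) \<in> Hk k \<rho> v"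
  by (induction A rule: finite_induct) (auto intro: Hk_zero Hk_add)

lemma Hk_mult:
  assumes f: "f \<in> MF n" and F: "F \<in> Hk k \<rho> v" and k': "k' = k + of_int n"
  shows "(\<lambda>z. f z *s F z) \<in> Hk k' \<rho> v"
proof (rule HkI)
  have lin: "M *v (c *s x) = c *s (M *v x)" for M :: cmat3 and c x
    by (simp add: vec_eq_iff mat3_vec_nth algebra_simps)
  show "qexp (lam j) (\<lambda>z. (R *v (f z *s F z)) $ j)" for j
    using qexp_mult[OF _ Hk_qexp[OF F, of j], of 0 f] f by (simp add: MF_iff lin)
  show "f z *s F z = 0" if "z \<notin> Hup" for z using Hk_off[OF F that] by simp
  fix g z assume g: "g \<in> SL2Z" and z: "z \<in> Hup"
  have "jfac g z powr of_real k' = jfac g z powi n * jfac g z powr of_real k"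
    using jfac_nonzero[OF g z] by (simp add: k' powr_add complex_powr_of_int)
  then show "f (mob g z) *s F (mob g z) = jfac g z powr of_real k' *s (twist v \<rho> g *v (f z *s F z))"
    unfolding MF_mob[OF f g z] Hk_mob[OF F g z] lin by (simp add: vec_eq_iff)
qed

lemma Dvec_qexp:
  assumes F: "F \<in> Hk k \<rho> v"
  shows "qexp (lam j) (\<lambda>z. (R *v Dvec l F z) $ j)"
  using qexp_Dsc[OF Hk_qexp[OF F, of j], of l]
  by (rule qexp_cong[THEN iffD1, rotated]) (rule Dsc_mat_vec[OF Hk_holomorphic[OF F]])

lemma Hk_Dvec:
  assumes quasi: "quasimodular_P" and F: "F \<in> Hk k \<rho> v"
  shows "Dvec k F \<in> Hk (k + 2) \<rho> v"
proof (rule HkI[OF _ Dvec_qexp[OF F]])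
  show "Dvec k F z = 0" if "z \<notin> Hup" for z using that by (simp add: Dvec_def)
  fix g z assume g: "g \<in> SL2Z" and z: "z \<in> Hup"
  have "slashP_defect g z = 0" using quasi g z by (simp add: slashP_defect_def quasimodular_P_def)
  then show "Dvec k F (mob g z) = jfac g z powr of_real (k + 2) *s (twist v \<rho> g *v Dvec k F z)"
    using Dvec_mob[OF Hk_holomorphic[OF F] Hk_holomorphic[OF F] g Hk_mob[OF F g] z] by simp
qed

end

lemma eq_zero_at_puncture:
  assumes "continuous_on (ball 0 1) f" "\<And>q. q \<in> ball 0 1 - {0} \<Longrightarrow> f q = (0::complex)"
  shows "f (0::complex) = 0"
proof -
  have "isCont f 0" using assms(1) by (simp add: continuous_on_eq_continuous_at)
  then have 1: "(f \<longlongrightarrow> f 0) (at 0)" by (simp add: isCont_def)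
  have "eventually (\<lambda>q. q \<in> ball 0 1 - {0::complex}) (at 0)" by (rule eventually_at_in_open) auto
  then have "eventually (\<lambda>q. 0 = f q) (at 0)" by eventually_elim (simp add: assms(2))
  then have "(f \<longlongrightarrow> 0) (at 0)" using Lim_transform_eventually[OF tendsto_const] by blast
  then show ?thesis using tendsto_unique[OF _ 1] by simp
qed

text \<open>The equation \<open>weight\<close> makes \<open>3 * k + 6\<close>, the weight of the
  Wronskian, equal to 12 times the sum of the exponents.\<close>

locale fundamental_vector = cusp_diagonal +
  fixes k :: real and F0 :: "complex \<Rightarrow> complex^3" and M4 M6 :: "complex \<Rightarrow> complex"
  assumes F0: "F0 \<in> Hk k \<rho> v"
    and M4: "M4 \<in> MF 4" and M6: "M6 \<in> MF 6"
    and fundamental: "fundamental_system3 k M4 M6 (\<lambda>i z. F0 z $ i)"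
    and weight: "k = 4 * (\<Sum>j\<in>UNIV. lam j) - 2"
begin

definition W where "W = wronskian k F0"
definition F1 where "F1 = Dvec k F0"
definition F2 where "F2 = Dvec (k + 2) F1"

lemma W_eq: "W z = det3 (F0 z) (F1 z) (F2 z)"
  by (simp add: W_def wronskian_def F1_def F2_def)

lemma W_nonzero:
  assumes "z \<in> Hup"
  shows "W z \<noteq> 0"
  unfolding W_def
proof (rule wronskian_nonzero[OF fundamental_system3_vector(1)[OF fundamental] MF_holomorphic[OF M4]
      MF_holomorphic[OF M6] _ assms])
  show "c i = 0" if "\<And>z. z \<in> Hup \<Longrightarrow> (\<Sum>i\<in>UNIV. c i * F0 z $ i) = 0" for c i
    using fundamental_system3_vector(2)[OF fundamental, of c i] that by blast
qed

lemma W_holomorphic: "W holomorphic_on Hup"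
  unfolding W_def by (rule wronskian_holomorphic[OF Hk_holomorphic[OF F0]])

lemma Dsc_W: "z \<in> Hup \<Longrightarrow> Dsc (3 * k + 6) W z = 0"
  unfolding W_def by (rule Dsc_wronskian[OF fundamental_system3_vector(1)[OF fundamental]])

lemma W_mob:
  assumes "g \<in> SL2Z" "z \<in> Hup"
  shows "W (mob g z) = jfac g z powr of_real (3 * k + 6) * (det (twist v \<rho> g) * W z)"
  unfolding W_def
  by (rule wronskian_mob[OF Hk_holomorphic[OF F0] assms(1) Hk_mob[OF F0 assms(1)] assms(2)])

text \<open>Read off from the transformation law, because \<open>W\<close> does not vanish at the
  image of \<open>\<i>\<close>.\<close>

lemma det_twist_nonzero:
  assumes "g \<in> SL2Z"
  shows "det (twist v \<rho> g) \<noteq> 0"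
  using W_mob[OF assms i_in_Hup] W_nonzero[OF mob_in_Hup[OF assms i_in_Hup]] by auto

text \<open>Both \<open>P\<close> and its slash are the logarithmic derivative of the Wronskian, up to the factor
  \<open>3 k + 6 = 12 * (lam 1 + lam 2 + lam 3)\<close>.\<close>

lemma quasimodular:
  assumes "(\<Sum>j\<in>UNIV. lam j) \<noteq> 0"
  shows "quasimodular_P"
  unfolding quasimodular_P_def
proof (intro ballI)
  fix g z assume g: "g \<in> SL2Z" and z: "z \<in> Hup"
  define w where "w = 3 * k + 6"
  have w: "w \<noteq> 0" using assms weight by (simp add: w_def)
  define d where "d = det (twist v \<rho> g)"
  define h where "h = (\<lambda>z. d * W z)"
  have h: "h holomorphic_on Hup" unfolding h_def by (intro holomorphic_intros W_holomorphic)
  have "Dsc w W (mob g z) = jfac g z powr of_real (w + 2) *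
            (deriv h z / (2 * of_real pi * \<i>) + of_real w * slashP g z * h z)"
    by (rule Dsc_mob[OF W_holomorphic h g _ z]) (simp only: W_mob[OF g] h_def d_def w_def)
  moreover have "Dsc w W (mob g z) = 0" unfolding w_def by (rule Dsc_W[OF mob_in_Hup[OF g z]])
  moreover have "jfac g z powr of_real (w + 2) \<noteq> 0" using jfac_nonzero[OF g z] by simp
  ultimately have "deriv h z / (2 * of_real pi * \<i>) + of_real w * slashP g z * h z = 0"
    by (metis mult_eq_0_iff)
  moreover have "deriv h z = d * deriv W z"
    unfolding h_def using Hup_derivative[OF W_holomorphic z] by (intro DERIV_imp_deriv DERIV_cmult)
  ultimately have "d * (deriv W z / (2 * of_real pi * \<i>) + of_real w * slashP g z * W z) = 0"
    by (simp add: h_def algebra_simps)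
  then have "deriv W z / (2 * of_real pi * \<i>) + of_real w * slashP g z * W z = 0"
    using det_twist_nonzero[OF g] by (simp add: d_def)
  moreover have "deriv W z / (2 * of_real pi * \<i>) + of_real w * Pfun z * W z = 0"
    using Dsc_W[OF z] by (simp add: Dsc_def w_def)
  ultimately have "of_real w * slashP g z * W z = of_real w * Pfun z * W z"
    by (metis add_left_imp_eq)
  then show "slashP g z = Pfun z" using w W_nonzero[OF z] by simp
qed

text \<open>Let \<open>l\<close> be the sum of the exponents. Inserting \<open>q^l * V\<close> into
  \<open>D W = 0\<close> gives an equation for \<open>V\<close> whose residue at 0 is
  \<open>l + 12 * l * Pq 0 = 0\<close>. So it is regular there, and \<open>V 0 = 0\<close> would
  force \<open>V\<close> to vanish throughout the disc.\<close>

lemma W_expansion: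
  obtains V where "V holomorphic_on ball 0 1" "\<And>q. q \<in> ball 0 1 \<Longrightarrow> V q \<noteq> 0"
    "\<And>z. z \<in> Hup \<Longrightarrow> det R * W z = exp (2 * of_real pi * \<i> * of_real (\<Sum>j\<in>UNIV. lam j) * z) * V (qq z)"
proof -
  define l where "l = (\<Sum>j\<in>UNIV. lam j)"
  have dR: "det R \<noteq> 0" using R_invertible by (simp add: invertible_det_nz)
  define W' where "W' = (\<lambda>z. det R * W z)"
  have F1h: "(\<lambda>z. F1 z $ i) holomorphic_on Hup" for i
    unfolding F1_def by (rule Dvec_holomorphic[OF Hk_holomorphic[OF F0]])
  have q1: "qexp (lam j) (\<lambda>z. (R *v F1 z) $ j)" for j unfolding F1_def by (rule Dvec_qexp[OF F0])
  have q2: "qexp (lam j) (\<lambda>z. (R *v F2 z) $ j)" for j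
    using qexp_Dsc[OF q1[of j], of "k + 2"] unfolding F2_def
    by (rule qexp_cong[THEN iffD1, rotated]) (rule Dsc_mat_vec[OF F1h])
  have "qexp l W'"
    unfolding l_def W'_def W_eq det3_mult[symmetric] by (intro det3_qexp Hk_qexp[OF F0] q1 q2)
  then obtain V where V: "V holomorphic_on ball 0 1"
      "\<And>z. z \<in> Hup \<Longrightarrow> W' z = exp (2 * of_real pi * \<i> * of_real l * z) * V (qq z)"
    unfolding qexp_def by blast
  have Vnz: "V q \<noteq> 0" if q: "q \<in> ball 0 1 - {0}" for q
  proof -
    have "qq (Ln q / (2 * of_real pi * \<i>)) = q" "Ln q / (2 * of_real pi * \<i>) \<in> Hup"
      using qq_log[of "Ln q" q] q by auto
    then show ?thesis using V(2) W_nonzero dR unfolding W'_def by (metis mult_eq_0_iff)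
  qed
  \<comment> \<open>The logarithmic derivative of \<open>phi\<close> to the power
    \<open>24 * l\<close>, the expected shape of \<open>V\<close>.\<close>
  define m where "m = (\<lambda>q. of_real (24 * l) * deriv phi q / phi q)"
  have m: "m holomorphic_on ball 0 1" unfolding m_def
    by (intro holomorphic_intros holomorphic_deriv phi_holomorphic) (auto simp: phi_nonzero)
  have dV: "deriv V holomorphic_on ball 0 1" by (intro holomorphic_deriv V) auto
  have ode': "deriv V q - m q * V q = 0" if q: "q \<in> ball 0 1 - {0}" for q
  proof -
    define z where "z = Ln q / (2 * of_real pi * \<i>)"
    have z: "qq z = q" "z \<in> Hup" unfolding z_def using qq_log[of "Ln q" q] q by auto
    have "deriv W' z = det R * deriv W z"
      unfolding W'_def using Hup_derivative[OF W_holomorphic z(2)] by (intro DERIV_imp_deriv DERIV_cmult)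
    then have "Dsc (12 * l) W' z = det R * Dsc (12 * l) W z"
      by (simp add: Dsc_def W'_def algebra_simps)
    also have "Dsc (12 * l) W z = 0" using Dsc_W[OF z(2)] by (simp add: weight l_def)
    finally have "exp (2 * of_real pi * \<i> * of_real l * z) *
      (of_real l * V q + q * deriv V q + of_real (12 * l) * Pq q * V q) = 0"
      using Dsc_qexp[OF V z(2), of "12 * l"] z(1) by simp
    then have "of_real l * V q + q * deriv V q + of_real (12 * l) * Pq q * V q = 0" by simp
    then have "q * (deriv V q - m q * V q) = 0"
      using phi_nonzero q by (simp add: Pq_def m_def field_simps)
    then show ?thesis using q by simp
  qed
  \<comment> \<open>Cancelling \<open>q\<close> was possible only off the origin; continuity
    restores the equation there.\<close>
  have "deriv V 0 - m 0 * V 0 = 0"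
    by (rule eq_zero_at_puncture[of "\<lambda>q. deriv V q - m q * V q", OF _ ode'])
       (intro holomorphic_on_imp_continuous_on holomorphic_intros V m dV)
  then have ode: "deriv V q = m q * V q" if "q \<in> ball 0 1" for q
    using ode'[of q] that by (cases "q = 0") auto
  have "V 0 \<noteq> 0"
  proof
    assume V0: "V 0 = 0"
    have "V (1/2) = 0"
      by (rule linear_ode1_zero[OF open_ball connected_ball V(1) m ode _ V0]) auto
    moreover have "(1/2 :: complex) \<in> ball 0 1 - {0}" by simp
    ultimately show False using Vnz by blast
  qed
  then have "V q \<noteq> 0" if "q \<in> ball 0 1" for q using Vnz that by (cases "q = 0") auto
  then show ?thesis using that[OF V(1)] V(2) unfolding W'_def l_def by blast
qed

text \<open>Numerator and \<open>W\<close> acquire the same \<open>det (twist v \<rho> g)\<close>,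
  so the quotient has trivial multiplier. Both carry \<open>q\<close> to the sum of the exponents,
  and the remaining factor \<open>V\<close> of the denominator has no zero, not even at
  \<open>q = 0\<close>.\<close>

lemma det3_div_W_MF:
  assumes A: "A \<in> Hk a \<rho> v" and B: "B \<in> Hk b \<rho> v" and C: "C \<in> Hk c \<rho> v"
    and n: "a + b + c = 3 * k + 6 + of_int n"
  shows "(\<lambda>z. det3 (A z) (B z) (C z) / W z) \<in> MF n"
  unfolding MF_iff
proof (intro conjI allI impI ballI)
  show "det3 (A z) (B z) (C z) / W z = 0" if "z \<notin> Hup" for z
    using Hk_off[OF A that] by (simp add: det3_def)
  have dR: "det R \<noteq> 0" using R_invertible by (simp add: invertible_det_nz)
  obtain V where V: "V holomorphic_on ball 0 1" "\<And>q. q \<in> ball 0 1 \<Longrightarrow> V q \<noteq> 0"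
    "\<And>z. z \<in> Hup \<Longrightarrow> det R * W z = exp (2 * of_real pi * \<i> * of_real (\<Sum>j\<in>UNIV. lam j) * z) * V (qq z)"
    using W_expansion by blast
  have "qexp (\<Sum>j\<in>UNIV. lam j) (\<lambda>z. det R * det3 (A z) (B z) (C z))"
    unfolding det3_mult[symmetric] by (intro det3_qexp Hk_qexp[OF A] Hk_qexp[OF B] Hk_qexp[OF C])
  then obtain N where N: "N holomorphic_on ball 0 1"
    "\<And>z. z \<in> Hup \<Longrightarrow> det R * det3 (A z) (B z) (C z) = exp (2 * of_real pi * \<i> * of_real (\<Sum>j\<in>UNIV. lam j) * z) * N (qq z)"
    unfolding qexp_def by blast
  show "qexp 0 (\<lambda>z. det3 (A z) (B z) (C z) / W z)"
    unfolding qexp0_iff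
  proof (intro exI[of _ "\<lambda>q. N q / V q"] conjI ballI)
    show "(\<lambda>q. N q / V q) holomorphic_on ball 0 1" by (intro holomorphic_intros N V)
    fix z assume z: "z \<in> Hup"
    have "det3 (A z) (B z) (C z) / W z = (det R * det3 (A z) (B z) (C z)) / (det R * W z)" using dR by simp
    then show "det3 (A z) (B z) (C z) / W z = N (qq z) / V (qq z)"
      unfolding N(2)[OF z] V(3)[OF z] by simp
  qed
  fix g z assume g: "g \<in> SL2Z" and z: "z \<in> Hup"
  define j where "j = jfac g z"
  have j: "j \<noteq> 0" using jfac_nonzero[OF g z] by (simp add: j_def)
  have "j powr of_real a * j powr of_real b * j powr of_real c = j powr of_real (a + b + c)"
    by (simp add: powr_add)
  also have "\<dots> = j powi n * j powr of_real (3 * k + 6)"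
    unfolding n using j by (simp add: powr_add[of j "of_real (3 * k + 6)" "of_int n", simplified] complex_powr_of_int)
  finally have "det3 (A (mob g z)) (B (mob g z)) (C (mob g z)) =
      (j powi n * j powr of_real (3 * k + 6)) * (det (twist v \<rho> g) * det3 (A z) (B z) (C z))"
    unfolding Hk_mob[OF A g z] Hk_mob[OF B g z] Hk_mob[OF C g z] det3_scale det3_mult j_def by simp
  moreover have "W (mob g z) = j powr of_real (3 * k + 6) * (det (twist v \<rho> g) * W z)"
    using W_mob[OF g z] by (simp add: j_def)
  moreover have "j powr of_real (3 * k + 6) \<noteq> 0" using j by simp
  ultimately show "det3 (A (mob g z)) (B (mob g z)) (C (mob g z)) / W (mob g z) =
      jfac g z powi n * (det3 (A z) (B z) (C z) / W z)"
    using det_twist_nonzero[OF g] by (simp add: j_def)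
qed

lemma coefficients_unique:
  assumes "z \<in> Hup" "a *s F0 z + b *s F1 z + c *s F2 z = a' *s F0 z + b' *s F1 z + c' *s F2 z"
  shows "a = a' \<and> b = b' \<and> c = c'"
proof -
  have 0: "(a - a') *s F0 z + (b - b') *s F1 z + (c - c') *s F2 z = 0"
    using assms(2) unfolding vec_eq_iff by (simp add: algebra_simps)
  have "(a - a') * W z = det3 ((a - a') *s F0 z + (b - b') *s F1 z + (c - c') *s F2 z) (F1 z) (F2 z)"
    "(b - b') * W z = det3 (F0 z) ((a - a') *s F0 z + (b - b') *s F1 z + (c - c') *s F2 z) (F2 z)"
    "(c - c') * W z = det3 (F0 z) (F1 z) ((a - a') *s F0 z + (b - b') *s F1 z + (c - c') *s F2 z)"
    unfolding W_eq det3_def vector_add_component vector_smult_component by algebra+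
  then have "(a - a') * W z = 0" "(b - b') * W z = 0" "(c - c') * W z = 0"
    unfolding 0 by (simp_all add: det3_def)
  then show ?thesis using W_nonzero[OF assms(1)] by simp
qed

end

subsection \<open>The graded module\<close>

lemma Dvec_zero: "Dvec l 0 = 0"
  by (simp add: Dvec_def Dsc_def fun_eq_iff vec_eq_iff)

lemma Dmod_single:
  "Dmod k (\<lambda>n. if n = i then F else 0) = (\<lambda>n. if n = i + 2 then Dvec (k + of_int i) F else 0)"
  by (rule ext) (auto simp: Dmod_def Dvec_zero)

lemma act_single:
  assumes "a \<in> Mring"
  shows "act a (\<lambda>n. if n = i then F else 0) = (\<lambda>n z. a (n - i) z *s F z)"
proof (intro ext)
  fix n z
  have fin: "finite {j. a j \<noteq> 0}" using assms by (simp add: Mring_def)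
  have "act a (\<lambda>n. if n = i then F else 0) n z = (\<Sum>j\<in>{j. a j \<noteq> 0}. if j = n - i then a (n - i) z *s F z else 0)"
    unfolding act_def by (intro sum.cong) auto
  also have "\<dots> = (if n - i \<in> {j. a j \<noteq> 0} then a (n - i) z *s F z else 0)"
    using fin by (simp add: sum.delta)
  also have "\<dots> = a (n - i) z *s F z" by auto
  finally show "act a (\<lambda>n. if n = i then F else 0) n z = a (n - i) z *s F z" .
qed

lemma sum_fun_at: "(\<Sum>i\<in>A. f i) x = (\<Sum>i\<in>A. f i x)"
  by (induction A rule: infinite_finite_induct) auto

context cusp_diagonal
begin

lemma Hmod_add:
  assumes "G \<in> Hmod k \<rho> v" "H \<in> Hmod k \<rho> v"
  shows "G + H \<in> Hmod k \<rho> v"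
proof -
  have "{n. (G + H) n \<noteq> 0} \<subseteq> {n. G n \<noteq> 0} \<union> {n. H n \<noteq> 0}" by auto
  then have "finite {n. (G + H) n \<noteq> 0}" using assms by (auto simp: Hmod_def intro: finite_subset)
  then show ?thesis using assms Hk_add by (auto simp: Hmod_def)
qed

lemma Hmod_sum: "finite A \<Longrightarrow> (\<And>i. i \<in> A \<Longrightarrow> G i \<in> Hmod k \<rho> v) \<Longrightarrow> (\<Sum>i\<in>A. G i) \<in> Hmod k \<rho> v"
proof (induction A rule: finite_induct)
  case empty
  then show ?case by (simp add: Hmod_def zero_fun_def Hk_zero[unfolded zero_fun_def])
next
  case (insert i A)
  then have eq: "sum G (insert i A) = G i + sum G A" by (intro sum.insert)
  have "G i \<in> Hmod k \<rho> v" "sum G A \<in> Hmod k \<rho> v" using insert by blast+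
  then show ?case unfolding eq by (rule Hmod_add)
qed

lemma Hmod_act:
  assumes a: "a \<in> Mring" and G: "G \<in> Hmod k \<rho> v"
  shows "act a G \<in> Hmod k \<rho> v"
proof -
  have fa: "finite {j. a j \<noteq> 0}" and fG: "finite {n. G n \<noteq> 0}" using a G by (auto simp: Mring_def Hmod_def)
  have eq: "act a G n = (\<Sum>j\<in>{j. a j \<noteq> 0}. (\<lambda>z. a j z *s G (n - j) z))" for n
    by (rule ext) (simp add: act_def sum_fun_at)
  have "{n. act a G n \<noteq> 0} \<subseteq> (\<lambda>(i, j). i + j) ` ({j. a j \<noteq> 0} \<times> {n. G n \<noteq> 0})"
  proof
    fix n assume "n \<in> {n. act a G n \<noteq> 0}"
    then obtain j where j: "a j \<noteq> 0" "(\<lambda>z. a j z *s G (n - j) z) \<noteq> 0" unfolding eq by (auto elim: sum.not_neutral_contains_not_neutral)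
    then have "G (n - j) \<noteq> 0" by (auto simp: fun_eq_iff)
    then show "n \<in> (\<lambda>(i, j). i + j) ` ({j. a j \<noteq> 0} \<times> {n. G n \<noteq> 0})"
      using j(1) by (intro image_eqI[of _ _ "(j, n - j)"]) auto
  qed
  then have "finite {n. act a G n \<noteq> 0}" using fa fG finite_subset by blast
  moreover have "act a G n \<in> Hk (k + of_int n) \<rho> v" for n
    unfolding eq
  proof (rule Hk_sum[OF fa])
    fix j
    have "a j \<in> MF j" "G (n - j) \<in> Hk (k + of_int (n - j)) \<rho> v"
      using a G unfolding Mring_def Hmod_def by blast+
    then show "(\<lambda>z. a j z *s G (n - j) z) \<in> Hk (k + of_int n) \<rho> v" by (rule Hk_mult) simp
  qed
  ultimately show ?thesis by (simp add: Hmod_def)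
qed

lemma Hmod_Dmod:
  assumes quasi: "quasimodular_P" and G: "G \<in> Hmod k \<rho> v"
  shows "Dmod k G \<in> Hmod k \<rho> v"
proof -
  have "{n. Dmod k G n \<noteq> 0} \<subseteq> (\<lambda>n. n + 2) ` {n. G n \<noteq> 0}"
  proof
    fix n assume "n \<in> {n. Dmod k G n \<noteq> 0}"
    then have "G (n - 2) \<noteq> 0" by (auto simp: Dmod_def Dvec_zero)
    then show "n \<in> (\<lambda>n. n + 2) ` {n. G n \<noteq> 0}" by (intro image_eqI[of _ _ "n - 2"]) auto
  qed
  then have "finite {n. Dmod k G n \<noteq> 0}" using G finite_subset unfolding Hmod_def by blast
  moreover have "Dmod k G n \<in> Hk (k + of_int n) \<rho> v" for n
  proof -
    have "G (n - 2) \<in> Hk (k + of_int (n - 2)) \<rho> v" using G unfolding Hmod_def by blast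
    from Hk_Dvec[OF quasi this] show ?thesis by (simp add: Dmod_def)
  qed
  ultimately show ?thesis by (simp add: Hmod_def)
qed

end

lemma cdim_eq_card:
  assumes I: "finite I" and mem: "\<And>p. p \<in> I \<Longrightarrow> e p \<in> V"
    and span: "\<And>G. G \<in> V \<Longrightarrow> \<exists>c. \<forall>z. G z = (\<Sum>p\<in>I. c p *s e p z)"
    and indep: "\<And>c p. (\<And>z. (\<Sum>p\<in>I. c p *s e p z) = 0) \<Longrightarrow> p \<in> I \<Longrightarrow> c p = 0"
  shows "cdim V = card I"
proof -
  interpret vs: vector_space fscale
    by unfold_locales (auto simp: fscale_def fun_eq_iff vec_eq_iff algebra_simps)
  have comb: "(\<Sum>p\<in>J. fscale (c p) (e p)) z = (\<Sum>p\<in>J. c p *s e p z)" for J c z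
    by (simp add: sum_fun_at fscale_def)
  \<comment> \<open>\<open>dim\<close> concerns sets, so repetitions in the family must be excluded
    first.\<close>
  have inj: "inj_on e I"
  proof (rule inj_onI, rule ccontr)
    fix p q assume pq: "p \<in> I" "q \<in> I" "e p = e q" "p \<noteq> q"
    define c :: "'a \<Rightarrow> complex" where "c = (\<lambda>r. if r = p then 1 else if r = q then -1 else 0)"
    have "(\<Sum>r\<in>I. c r *s e r z) = 0" for z
    proof -
      have "(\<Sum>r\<in>I. c r *s e r z) = (\<Sum>r\<in>{p, q}. c r *s e r z)"
        using I pq by (intro sum.mono_neutral_right) (auto simp: c_def)
      also have "\<dots> = 0" using pq by (simp add: c_def)
      finally show ?thesis .
    qed
    then have "c p = 0" using indep pq(1) by blast
    then show False by (simp add: c_def)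
  qed
  have "vs.dim V = card I"
  proof (rule vs.dim_unique[of "e ` I"])
    show "e ` I \<subseteq> V" using mem by blast
    show "V \<subseteq> vs.span (e ` I)"
    proof
      fix G assume "G \<in> V"
      then obtain c where "\<forall>z. G z = (\<Sum>p\<in>I. c p *s e p z)" using span by blast
      then have "G = (\<Sum>p\<in>I. fscale (c p) (e p))" by (simp add: fun_eq_iff comb)
      then show "G \<in> vs.span (e ` I)" by (simp add: vs.span_sum vs.span_scale vs.span_base)
    qed
    show "vs.independent (e ` I)"
    proof
      assume "vs.dependent (e ` I)"
      then obtain u where u: "\<exists>w\<in>e ` I. u w \<noteq> 0" "(\<Sum>w\<in>e ` I. fscale (u w) w) = 0"
        using vs.dependent_finite[of "e ` I"] I by auto
      then have "(\<Sum>p\<in>I. fscale (u (e p)) (e p)) = 0" by (simp add: sum.reindex[OF inj])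
      then have "(\<Sum>p\<in>I. u (e p) *s e p z) = 0" for z
        using comb[of "\<lambda>p. u (e p)" I z] by simp
      then have "u (e p) = 0" if "p \<in> I" for p using indep[of "\<lambda>p. u (e p)"] that by blast
      then show False using u(1) by blast
    qed
    show "card (e ` I) = card I" by (rule card_image[OF inj])
  qed
  then show ?thesis by (simp add: cdim_def)
qed

text \<open>In generating functions: \<open>(1 + t + t^2) / ((1 - t^2) * (1 - t^3)) = 1 / ((1 - t) *
  (1 - t^2))\<close>.\<close>

lemma MF_dim_sum:
  "MF_dim k + (if 1 \<le> k then MF_dim (k - 1) else 0) + (if 2 \<le> k then MF_dim (k - 2) else 0) = k div 2 + 1"
proof (induction k rule: less_induct)
  case (less k)
  show ?case
  proof (cases "k < 8")
    case True
    then have "k \<in> {0, 1, 2, 3, 4, 5, 6, 7}" by auto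
    then show ?thesis by (elim insertE emptyE) (simp_all add: MF_dim_def)
  next
    case False
    have step: "MF_dim (i + 6) = MF_dim i + 1" for i by (simp add: MF_dim_def)
    \<comment> \<open>From 8 on, all of \<open>k\<close>, \<open>k - 1\<close>, \<open>k - 2\<close>
      are at least 6, so one period can be removed from each summand.\<close>
    obtain l where l: "k = l + 8" using False by (metis add.commute le_Suc_ex not_less)
    have "MF_dim k = MF_dim (l + 2) + 1" "MF_dim (k - 1) = MF_dim (l + 1) + 1" "MF_dim (k - 2) = MF_dim l + 1"
      using step[of "l + 2"] step[of "l + 1"] step[of l] by (simp_all add: l add.commute)
    moreover have "MF_dim (l + 2) + MF_dim (l + 1) + MF_dim l = (l + 2) div 2 + 1"
      using less.IH[of "l + 2"] l by simp
    ultimately show ?thesis by (simp add: l)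
  qed
qed

section \<open>Free basis, cyclicity and dimensions\<close>

context fundamental_vector
begin

lemma Hk_F1: "quasimodular_P \<Longrightarrow> F1 \<in> Hk (k + 2) \<rho> v"
  unfolding F1_def by (rule Hk_Dvec[OF _ F0])

lemma Hk_F2: "quasimodular_P \<Longrightarrow> F2 \<in> Hk (k + 4) \<rho> v"
  unfolding F2_def using Hk_Dvec[OF _ Hk_F1] by (simp add: add.assoc)

text \<open>Cramer's rule pointwise. Replacing one of \<open>F0\<close>, \<open>F1\<close>,
  \<open>F2\<close> by \<open>G\<close> changes the weight of the determinant by \<open>n\<close>,
  \<open>n - 2\<close> or \<open>n - 4\<close>; off the half-plane both sides are zero.\<close>

lemma decomposition:
  assumes quasi: "quasimodular_P" and G: "G \<in> Hk (k + of_int n) \<rho> v"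
  shows "\<exists>a\<in>MF n. \<exists>b\<in>MF (n - 2). \<exists>c\<in>MF (n - 4). \<forall>z. G z = a z *s F0 z + b z *s F1 z + c z *s F2 z"
proof (intro bexI allI)
  note F = F0 Hk_F1[OF quasi] Hk_F2[OF quasi]
  show "(\<lambda>z. det3 (G z) (F1 z) (F2 z) / W z) \<in> MF n"
    by (rule det3_div_W_MF[OF G F(2,3)]) simp
  show "(\<lambda>z. det3 (F0 z) (G z) (F2 z) / W z) \<in> MF (n - 2)"
    by (rule det3_div_W_MF[OF F(1) G F(3)]) simp
  show "(\<lambda>z. det3 (F0 z) (F1 z) (G z) / W z) \<in> MF (n - 4)"
    by (rule det3_div_W_MF[OF F(1,2) G]) simp
  show "G z = (det3 (G z) (F1 z) (F2 z) / W z) *s F0 z + (det3 (F0 z) (G z) (F2 z) / W z) *s F1 z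
      + (det3 (F0 z) (F1 z) (G z) / W z) *s F2 z" for z
  proof (cases "z \<in> Hup")
    case True
    then have nz: "W z \<noteq> 0" by (rule W_nonzero)
    have "W z * G z $ i = det3 (G z) (F1 z) (F2 z) * F0 z $ i + det3 (F0 z) (G z) (F2 z) * F1 z $ i
      + det3 (F0 z) (F1 z) (G z) * F2 z $ i" for i
      using arg_cong[OF cramer3[of "F0 z" "F1 z" "F2 z" "G z"], of "\<lambda>x. x $ i"] by (simp add: W_eq)
    then have "G z $ i = (det3 (G z) (F1 z) (F2 z) * F0 z $ i + det3 (F0 z) (G z) (F2 z) * F1 z $ i
      + det3 (F0 z) (F1 z) (G z) * F2 z $ i) / W z" for i
      using nz by (metis nonzero_mult_div_cancel_left)
    then show ?thesis by (simp add: vec_eq_iff add_divide_distrib)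
  next
    case False
    then show ?thesis using Hk_off[OF G] Hk_off[OF F0] by (simp add: F1_def F2_def Dvec_def)
  qed
qed

definition B where "B = (\<lambda>n::int. if n = 0 then F0 else 0)"

lemma Dmod_B: "Dmod k B = (\<lambda>n. if n = 2 then F1 else 0)"
  and Dmod_Dmod_B: "Dmod k (Dmod k B) = (\<lambda>n. if n = 4 then F2 else 0)"
proof -
  show 1: "Dmod k B = (\<lambda>n. if n = 2 then F1 else 0)"
    unfolding B_def Dmod_single by (simp add: F1_def cong: if_cong)
  show "Dmod k (Dmod k B) = (\<lambda>n. if n = 4 then F2 else 0)"
    unfolding 1 Dmod_single by (simp add: F2_def cong: if_cong)
qed

lemma B_in_Hmod: "B \<in> Hmod k \<rho> v"
proof -
  have "finite {n. B n \<noteq> 0}" by (rule finite_subset[of _ "{0}"]) (auto simp: B_def)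
  then show ?thesis using F0 Hk_zero by (auto simp: Hmod_def B_def)
qed

lemma act_combination:
  assumes "a \<in> Mring" "b \<in> Mring" "c \<in> Mring"
  shows "act a B + act b (Dmod k B) + act c (Dmod k (Dmod k B)) =
    (\<lambda>n z. a n z *s F0 z + b (n - 2) z *s F1 z + c (n - 4) z *s F2 z)"
  unfolding Dmod_Dmod_B unfolding Dmod_B unfolding B_def act_single[OF assms(1)] act_single[OF assms(2)] act_single[OF assms(3)]
  by (simp add: fun_eq_iff)

lemma Hmod_spanned:
  assumes quasi: "quasimodular_P" and G: "G \<in> Hmod k \<rho> v"
  shows "\<exists>a\<in>Mring. \<exists>b\<in>Mring. \<exists>c\<in>Mring. G = act a B + act b (Dmod k B) + act c (Dmod k (Dmod k B))"
proof -
  have fin: "finite {n. G n \<noteq> 0}" and Gk: "\<And>n. G n \<in> Hk (k + of_int n) \<rho> v" using G by (auto simp: Hmod_def)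
  \<comment> \<open>The clause for \<open>G n = 0\<close> makes the chosen coefficients vanish
    outside the finite support of \<open>G\<close>, as membership in \<open>Mring\<close>
    demands.\<close>
  have "\<exists>a b c. a \<in> MF n \<and> b \<in> MF (n - 2) \<and> c \<in> MF (n - 4) \<and> (G n = 0 \<longrightarrow> a = 0 \<and> b = 0 \<and> c = 0) \<and>
      (\<forall>z. G n z = a z *s F0 z + b z *s F1 z + c z *s F2 z)" for n
  proof (cases "G n = 0")
    case True
    then show ?thesis by (intro exI[of _ 0]) (simp add: MF_zero)
  next
    case False
    then show ?thesis using decomposition[OF quasi Gk[of n]] by blast
  qed
  then obtain a b c where abc: "\<And>n. a n \<in> MF n" "\<And>n. b n \<in> MF (n - 2)" "\<And>n. c n \<in> MF (n - 4)"
      "\<And>n. G n = 0 \<Longrightarrow> a n = 0 \<and> b n = 0 \<and> c n = 0"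
      "\<And>n z. G n z = a n z *s F0 z + b n z *s F1 z + c n z *s F2 z"
    by metis
  \<comment> \<open>In degree \<open>n\<close> the coefficients of \<open>F1\<close> and
    \<open>F2\<close> have weight \<open>n - 2\<close> and \<open>n - 4\<close>; reindexing makes
    index and weight agree.\<close>
  have shift: "(\<lambda>n. x (n + i)) \<in> Mring" if "\<And>n. x n \<in> MF (n - i)" "\<And>n. G n = 0 \<Longrightarrow> x n = 0" for x i
  proof -
    have "{n. x (n + i) \<noteq> 0} \<subseteq> (\<lambda>n. n - i) ` {n. G n \<noteq> 0}"
    proof
      fix n assume "n \<in> {n. x (n + i) \<noteq> 0}"
      then have "G (n + i) \<noteq> 0" using that(2) by blast
      then show "n \<in> (\<lambda>n. n - i) ` {n. G n \<noteq> 0}" by (intro image_eqI[of _ _ "n + i"]) auto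
    qed
    then have "finite {n. x (n + i) \<noteq> 0}" using fin finite_subset by blast
    moreover have "x (n + i) \<in> MF n" for n using that(1)[of "n + i"] by simp
    ultimately show ?thesis by (simp add: Mring_def)
  qed
  have "(\<lambda>n. a (n + 0)) \<in> Mring" by (rule shift) (use abc in auto)
  then have a: "a \<in> Mring" by simp
  have b: "(\<lambda>n. b (n + 2)) \<in> Mring" by (rule shift) (use abc in auto)
  have c: "(\<lambda>n. c (n + 4)) \<in> Mring" by (rule shift) (use abc in auto)
  have "G = act a B + act (\<lambda>n. b (n + 2)) (Dmod k B) + act (\<lambda>n. c (n + 4)) (Dmod k (Dmod k B))"
    unfolding act_combination[OF a b c] by (intro ext) (simp add: abc(5))
  then show ?thesis using a b c by blast
qed

lemma Hmod_coefficients_unique: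
  assumes m: "a \<in> Mring" "b \<in> Mring" "c \<in> Mring" "a' \<in> Mring" "b' \<in> Mring" "c' \<in> Mring"
    and eq: "act a B + act b (Dmod k B) + act c (Dmod k (Dmod k B)) =
      act a' B + act b' (Dmod k B) + act c' (Dmod k (Dmod k B))"
  shows "a = a' \<and> b = b' \<and> c = c'"
proof -
  have off: "x n z = 0" if "x \<in> Mring" "z \<notin> Hup" for x n z
  proof -
    have "x n \<in> MF n" using that(1) by (simp add: Mring_def)
    then show ?thesis using that(2) by (rule MF_off)
  qed
  have "a n z = a' n z \<and> b (n - 2) z = b' (n - 2) z \<and> c (n - 4) z = c' (n - 4) z" for n z
  proof (cases "z \<in> Hup")
    case True
    have "a n z *s F0 z + b (n - 2) z *s F1 z + c (n - 4) z *s F2 z =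
      a' n z *s F0 z + b' (n - 2) z *s F1 z + c' (n - 4) z *s F2 z"
      using eq unfolding act_combination[OF m(1-3)] act_combination[OF m(4-6)] by (rule fun_cong[OF fun_cong])
    then show ?thesis by (rule coefficients_unique[OF True])
  next
    case False
    then show ?thesis by (simp add: off[OF m(1)] off[OF m(2)] off[OF m(3)] off[OF m(4)] off[OF m(5)] off[OF m(6)])
  qed
  note * = this
  have "a n z = a' n z" "b n z = b' n z" "c n z = c' n z" for n z
    using *[of n z] *[of "n + 2" z] *[of "n + 4" z] by simp_all
  then show ?thesis by (simp add: fun_eq_iff)
qed

text \<open>Spanning uses only the first three powers of \<open>D\<close>; the other inclusion is
  closure of the module under \<open>D\<close>, where the law of \<open>P\<close> enters.\<close>

lemma Hmod_cyclic:
  assumes quasi: "quasimodular_P"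
  shows "Hmod k \<rho> v = {(\<Sum>j<N. act (a j) ((Dmod k ^^ j) B)) | N a. \<forall>j<N. a j \<in> Mring}"
proof (intro equalityI subsetI)
  fix G assume "G \<in> Hmod k \<rho> v"
  then obtain a b c where abc: "a \<in> Mring" "b \<in> Mring" "c \<in> Mring"
    "G = act a B + act b (Dmod k B) + act c (Dmod k (Dmod k B))"
    using Hmod_spanned[OF quasi] by blast
  define x where "x = (\<lambda>j::nat. if j = 0 then a else if j = 1 then b else c)"
  have "G = (\<Sum>j<3. act (x j) ((Dmod k ^^ j) B))"
    unfolding abc(4) by (simp add: eval_nat_numeral x_def)
  moreover have "\<forall>j<3. x j \<in> Mring" using abc by (simp add: x_def)
  ultimately show "G \<in> {(\<Sum>j<N. act (a j) ((Dmod k ^^ j) B)) | N a. \<forall>j<N. a j \<in> Mring}" by blast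
next
  fix G assume "G \<in> {(\<Sum>j<N. act (a j) ((Dmod k ^^ j) B)) | N a. \<forall>j<N. a j \<in> Mring}"
  then obtain N a where G: "G = (\<Sum>j<N::nat. act (a j) ((Dmod k ^^ j) B))" "\<forall>j<N. a j \<in> Mring" by blast
  have "(Dmod k ^^ j) B \<in> Hmod k \<rho> v" for j
    by (induction j) (auto intro: B_in_Hmod Hmod_Dmod[OF quasi])
  then show "G \<in> Hmod k \<rho> v" unfolding G(1) using G(2) by (intro Hmod_sum Hmod_act) auto
qed

lemma cdim_Hk:
  assumes quasi: "quasimodular_P"
  shows "cdim (Hk (k + 2 * of_nat n) \<rho> v) = n div 2 + 1"
proof -
  \<comment> \<open>For \<open>t > n\<close> the coefficient weight is negative and its space is
    zero; the truncated difference \<open>n - t\<close> would wrongly give weight 0.\<close>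
  define d where "d = (\<lambda>t::nat. if t \<le> n then MF_dim (n - t) else 0)"
  define wt where "wt = (\<lambda>t::nat. 2 * int n - 2 * int t)"
  have "\<exists>b. MF_basis (d t) b (wt t)" for t
  proof (cases "t \<le> n")
    case True
    then have "wt t = 2 * int (n - t)" by (simp add: wt_def)
    then show ?thesis using MF_basis_exists[OF quasi, of "n - t"] True by (simp add: d_def)
  next
    case False
    then have "MF_basis 0 (\<lambda>_. 0) (wt t)" using MF_negative[OF quasi] by (intro MF_basis_0) (auto simp: wt_def)
    then show ?thesis using False by (auto simp: d_def)
  qed
  then obtain b where b: "\<And>t. MF_basis (d t) (b t) (wt t)" by metis
  define Fs where "Fs = (\<lambda>t::nat. if t = 0 then F0 else if t = 1 then F1 else F2)"
  define I where "I = Sigma {0, 1, 2::nat} (\<lambda>t. {..<d t})"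
  define e where "e = (\<lambda>(t, i) z. b t i z *s Fs t z)"
  have wt: "wt 0 = 2 * int n" "wt 1 = 2 * int n - 2" "wt 2 = 2 * int n - 4" by (auto simp: wt_def)
  have sum: "(\<Sum>p\<in>I. c p *s e p z) = (\<Sum>i<d 0. c (0, i) * b 0 i z) *s F0 z +
     (\<Sum>i<d 1. c (1, i) * b 1 i z) *s F1 z + (\<Sum>i<d 2. c (2, i) * b 2 i z) *s F2 z" for c z
  proof -
    have "(\<Sum>p\<in>I. c p *s e p z) = (\<Sum>(t, i)\<in>I. c (t, i) *s (b t i z *s Fs t z))"
      by (intro sum.cong) (auto simp: e_def)
    also have "\<dots> = (\<Sum>t\<in>{0, 1, 2}. \<Sum>i<d t. c (t, i) *s (b t i z *s Fs t z))"
      unfolding I_def by (rule sum.Sigma[symmetric]) auto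
    also have "\<dots> = (\<Sum>t\<in>{0, 1, 2}. (\<Sum>i<d t. c (t, i) * b t i z) *s Fs t z)"
      by (intro sum.cong refl) (simp add: vec_eq_iff sum_distrib_right mult.assoc)
    also have "\<dots> = (\<Sum>i<d 0. c (0, i) * b 0 i z) *s F0 z +
     (\<Sum>i<d 1. c (1, i) * b 1 i z) *s F1 z + (\<Sum>i<d 2. c (2, i) * b 2 i z) *s F2 z"
      by (simp add: Fs_def add.assoc)
    finally show ?thesis .
  qed
  have "cdim (Hk (k + of_int (2 * int n)) \<rho> v) = card I"
  proof (rule cdim_eq_card)
    show "finite I" by (simp add: I_def)
    show "e p \<in> Hk (k + of_int (2 * int n)) \<rho> v" if p: "p \<in> I" for p
    proof -
      obtain t i where ti: "p = (t, i)" "t \<in> {0, 1, 2}" "i < d t" using p by (auto simp: I_def)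
      have bt: "b t i \<in> MF (wt t)" using b ti(3) by (simp add: MF_basis_def)
      have e: "e p = (\<lambda>z. b t i z *s Fs t z)" by (simp add: e_def ti(1))
      consider "t = 0" | "t = 1" | "t = 2" using ti(2) by auto
      then show ?thesis
      proof cases
        case 1
        show ?thesis unfolding e by (rule Hk_mult[OF bt]) (use F0 in \<open>simp_all add: 1 Fs_def wt\<close>)
      next
        case 2
        show ?thesis unfolding e
          by (rule Hk_mult[OF bt, of _ "k + 2"]) (use Hk_F1[OF quasi] in \<open>simp_all add: 2 Fs_def wt_def\<close>)
      next
        case 3
        show ?thesis unfolding e
          by (rule Hk_mult[OF bt, of _ "k + 4"]) (use Hk_F2[OF quasi] in \<open>simp_all add: 3 Fs_def wt_def\<close>)
      qed
    qed
    show "\<exists>c. \<forall>z. G z = (\<Sum>p\<in>I. c p *s e p z)" if G: "G \<in> Hk (k + of_int (2 * int n)) \<rho> v" for G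
    proof -
      obtain x y w where xyw: "x \<in> MF (wt 0)" "y \<in> MF (wt 1)" "w \<in> MF (wt 2)"
        "\<forall>z. G z = x z *s F0 z + y z *s F1 z + w z *s F2 z"
        using decomposition[OF quasi G] unfolding wt by blast
      have span: "\<exists>c. \<forall>z. f z = (\<Sum>i<d t. c i * b t i z)" if "f \<in> MF (wt t)" for f t
        using b[of t] that unfolding MF_basis_def by (elim conjE) (erule (1) bspec)
      obtain c0 where c0: "\<forall>z. x z = (\<Sum>i<d 0. c0 i * b 0 i z)" using span[OF xyw(1)] by blast
      obtain c1 where c1: "\<forall>z. y z = (\<Sum>i<d 1. c1 i * b 1 i z)" using span[OF xyw(2)] by blast
      obtain c2 where c2: "\<forall>z. w z = (\<Sum>i<d 2. c2 i * b 2 i z)" using span[OF xyw(3)] by blast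
      define c where "c = (\<lambda>(t :: nat, i). if t = 0 then c0 i else if t = 1 then c1 i else c2 i :: complex)"
      have "G z = (\<Sum>p\<in>I. c p *s e p z)" for z
        unfolding sum using xyw(4) c0 c1 c2 by (simp add: c_def)
      then show ?thesis by blast
    qed
    show "c p = 0" if 0: "\<And>z. (\<Sum>p\<in>I. c p *s e p z) = 0" and p: "p \<in> I" for c p
    proof -
      have "(\<Sum>i<d 0. c (0, i) * b 0 i z) = 0 \<and> (\<Sum>i<d 1. c (1, i) * b 1 i z) = 0 \<and> (\<Sum>i<d 2. c (2, i) * b 2 i z) = 0"
        if "z \<in> Hup" for z
        by (rule coefficients_unique[OF that]) (use 0[of z] in \<open>simp add: sum\<close>)
      then have z: "(\<Sum>i<d t. c (t, i) * b t i z) = 0" if "t \<in> {0, 1, 2}" "z \<in> Hup" for t z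
        using that by auto
      obtain t i where ti: "p = (t, i)" "t \<in> {0, 1, 2}" "i < d t" using p by (auto simp: I_def)
      have "\<forall>c. (\<forall>z\<in>Hup. (\<Sum>i<d t. c i * b t i z) = 0) \<longrightarrow> (\<forall>i<d t. c i = 0)"
        using b[of t] unfolding MF_basis_def by blast
      from spec[OF this, of "\<lambda>i. c (t, i)"] show ?thesis using z[OF ti(2)] ti by simp
    qed
  qed
  also have "card I = d 0 + d 1 + d 2" unfolding I_def by (subst card_SigmaI) auto
  also have "\<dots> = n div 2 + 1" unfolding d_def using MF_dim_sum[of n] by (simp only: zero_le diff_zero if_True)
  finally show ?thesis by simp
qed

end

section \<open>The exceptional case of a scalar \<open>\<rho>(T)\<close>\<close>

text \<open>The group is generated by \<open>T\<close> and the lower triangular unipotent matrix,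
  which is conjugate to the inverse of \<open>T\<close>; a conjugate of a scalar matrix is the same
  scalar.\<close>

lemma rep_scalar_of_T:
  assumes rep: "representation3 \<rho>" and T: "\<And>x. \<rho> Tmat *v x = c *s x"
  shows "g \<in> SL2Z \<Longrightarrow> \<exists>c. \<forall>x. \<rho> g *v x = c *s x"
proof -
  have mult: "\<rho> (g ** h) *v x = \<rho> g *v (\<rho> h *v x)" if "g \<in> SL2Z" "h \<in> SL2Z" for g h x
    using rep that by (simp add: representation3_def matrix_vector_mul_assoc)
  have one: "\<rho> (mat 1) *v x = x" for x using rep by (simp add: representation3_def)
  have smul: "A *v (s *s x) = s *s (A *v x)" for A :: cmat3 and s x
    by (simp add: vec_eq_iff mat3_vec_nth algebra_simps)
  have comp: "\<exists>c. \<forall>x. \<rho> (g ** h) *v x = c *s x"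
    if g: "\<exists>c. \<forall>x. \<rho> g *v x = c *s x" and h: "\<exists>c. \<forall>x. \<rho> h *v x = c *s x"
      and SL: "g \<in> SL2Z" "h \<in> SL2Z" for g h
  proof -
    obtain a b where "\<forall>x. \<rho> g *v x = a *s x" "\<forall>x. \<rho> h *v x = b *s x" using g h by blast
    then have "\<forall>x. \<rho> (g ** h) *v x = (a * b) *s x" using SL by (simp add: mult)
    then show ?thesis by blast
  qed
  have TTi: "c *s (\<rho> Tinv *v x) = x" for x
  proof -
    have "Tmat ** Tinv = mat 1" by (simp add: mat2_eq_iff)
    then show ?thesis using mult[of Tmat Tinv x] by (simp add: T one)
  qed
  have "c \<noteq> 0"
  proof
    assume "c = 0"
    then have "(axis 1 1 :: complex^3) = 0" using TTi[of "axis 1 1"] by simp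
    then show False by (simp add: axis_eq_0_iff)
  qed
  then have Ti: "\<rho> Tinv *v x = inverse c *s x" for x
    using arg_cong[OF TTi[of x], of "\<lambda>y. inverse c *s y"] by simp
  define Sinv where "Sinv = Smat ** (Smat ** Smat)"
  have SinvSL: "Sinv \<in> SL2Z" unfolding Sinv_def by (intro SL2Z_mult) auto
  define L where "L = Smat ** (Tinv ** Sinv)"
  have LSL: "L \<in> SL2Z" unfolding L_def by (intro SL2Z_mult SinvSL) auto
  have L: "\<rho> L *v x = inverse c *s x" for x
  proof -
    have "Smat ** Sinv = mat 1" by (simp add: mat2_eq_iff Sinv_def)
    then have "\<rho> Smat *v (\<rho> Sinv *v x) = x" using mult[of Smat Sinv x] SinvSL by (simp add: one)
    then show ?thesis unfolding L_def using SinvSL by (simp add: mult SL2Z_mult Ti smul)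
  qed
  \<comment> \<open>\<open>L\<close> has rows (1, 0) and (1, 1), and this product of unipotent
    matrices is \<open>S\<close>.\<close>
  have Seq: "Smat = Tinv ** (L ** Tinv)" by (simp add: mat2_eq_iff L_def Sinv_def)
  show "\<exists>c. \<forall>x. \<rho> g *v x = c *s x" if "g \<in> SL2Z"
    using that
  proof (induction rule: SL2Z_induct)
    case T
    then show ?case using assms(2) by blast
  next
    case Tinv
    then show ?case using Ti by blast
  next
    case S
    have "\<exists>c. \<forall>x. \<rho> (Tinv ** (L ** Tinv)) *v x = c *s x"
      using Ti L by (intro comp SL2Z_mult LSL) auto
    then show ?case using Seq by simp
  next
    case (mult g h)
    then show ?case using comp by blast
  qed
qed

text \<open>Scalars preserve every line; the first coordinate axis is a proper nonzero one.\<close>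

lemma not_irreducible3_scalar:
  assumes "\<And>g. g \<in> SL2Z \<Longrightarrow> \<exists>c. \<forall>x. \<rho> g *v x = c *s x"
  shows "\<not> irreducible3 \<rho>"
proof
  define L :: "(complex^3) set" where "L = range (\<lambda>c. c *s axis 1 1)"
  assume "irreducible3 \<rho>"
  moreover have "invariant3 \<rho> L"
    unfolding invariant3_def csubspace3_def
  proof (intro conjI ballI allI)
    show "0 \<in> L" unfolding L_def by (rule image_eqI[of _ _ 0]) auto
    show "x + y \<in> L" if "x \<in> L" "y \<in> L" for x y
    proof -
      obtain a b where "x = a *s axis 1 1" "y = b *s axis 1 1" using \<open>x \<in> L\<close> \<open>y \<in> L\<close> unfolding L_def by blast
      then have "x + y = (a + b) *s axis 1 1" by (simp add: vector_sadd_rdistrib)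
      then show ?thesis unfolding L_def by blast
    qed
    show scale: "c *s x \<in> L" if "x \<in> L" for c x
    proof -
      obtain a where "x = a *s axis 1 1" using \<open>x \<in> L\<close> unfolding L_def by blast
      then have "c *s x = (c * a) *s axis 1 1" by simp
      then show ?thesis unfolding L_def by blast
    qed
    show "\<rho> g *v x \<in> L" if "g \<in> SL2Z" "x \<in> L" for g x
      using assms[OF \<open>g \<in> SL2Z\<close>] scale[OF \<open>x \<in> L\<close>] by force
  qed
  ultimately have "L = {0} \<or> L = UNIV" unfolding irreducible3_def by blast
  moreover have "axis 1 1 \<in> L" unfolding L_def by (rule image_eqI[of _ _ 1]) auto
  moreover have "axis 2 1 \<notin> L"
  proof
    assume "axis 2 1 \<in> L"
    then obtain a :: complex where "axis 2 1 = a *s (axis 1 1 :: complex^3)" unfolding L_def by blast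
    from arg_cong[OF this, of "\<lambda>x. x $ 2"] show False by (simp add: axis_def)
  qed
  ultimately show False by (auto simp: axis_eq_0_iff)
qed

section \<open>The exponents at the cusp and the conclusion\<close>

theorem theorem4p9:
  fixes \<rho> :: "mat2 \<Rightarrow> cmat3" and v :: "mat2 \<Rightarrow> complex" and m :: real
    and r1 r2 r3 :: real and F0 :: "complex \<Rightarrow> complex^3"
  defines "lam1 \<equiv> frac (r1 + m / 12)" and "lam2 \<equiv> frac (r2 + m / 12)" and "lam3 \<equiv> frac (r3 + m / 12)"
  defines "k0 \<equiv> 4 * (lam1 + lam2 + lam3) - 2"
  defines "B0 \<equiv> (\<lambda>n::int. if n = 0 then F0 else 0)"
  assumes rep: "representation3 \<rho>"
    and Tdet: "T_determined \<rho>" and Tunit: "T_unitarizable \<rho>"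
    and mult: "multiplier_system k0 v" and cusp: "cusp_parameter v m"
    and r_range: "0 \<le> r1" "r1 < 1" "0 \<le> r2" "r2 < 1" "0 \<le> r3" "r3 < 1"
    and eigen: "\<forall>x. charpoly3 (\<rho> Tmat) x = (x - ee r1) * (x - ee r2) * (x - ee r3)"
    and grading: "\<forall>n::int. (n < 0 \<or> odd n) \<longrightarrow> Hk (k0 + of_int n) \<rho> v = {0}"
    and F0_in: "F0 \<in> Hk k0 \<rho> v" and F0_nz: "F0 \<noteq> 0"
    and F0_fund: "\<exists>M4\<in>MF 4. \<exists>M6\<in>MF 6. fundamental_system3 k0 M4 M6 (\<lambda>i z. F0 z $ i)"
  shows "(B0 \<in> Hmod k0 \<rho> v \<and> Dmod k0 B0 \<in> Hmod k0 \<rho> v \<and> Dmod k0 (Dmod k0 B0) \<in> Hmod k0 \<rho> v \<and>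
          (\<forall>G\<in>Hmod k0 \<rho> v. \<exists>a\<in>Mring. \<exists>b\<in>Mring. \<exists>c\<in>Mring.
              G = act a B0 + act b (Dmod k0 B0) + act c (Dmod k0 (Dmod k0 B0))) \<and>
          (\<forall>a\<in>Mring. \<forall>b\<in>Mring. \<forall>c\<in>Mring. \<forall>a'\<in>Mring. \<forall>b'\<in>Mring. \<forall>c'\<in>Mring.
              act a B0 + act b (Dmod k0 B0) + act c (Dmod k0 (Dmod k0 B0)) =
              act a' B0 + act b' (Dmod k0 B0) + act c' (Dmod k0 (Dmod k0 B0))
              \<longrightarrow> a = a' \<and> b = b' \<and> c = c'))
       \<and> Hmod k0 \<rho> v = {(\<Sum>j<N. act (a j) ((Dmod k0 ^^ j) B0)) | N a. \<forall>j<N. a j \<in> Mring}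
       \<and> (\<forall>k::nat. cdim (Hk (k0 + 2 * of_nat k) \<rho> v) = k div 2 + 1)"
proof -
  have v_nz: "v g \<noteq> 0" if "g \<in> SL2Z" for g
    using mult that unfolding multiplier_system_def by fastforce
  obtain P where P: "invertible P" "unitary3 (P ** \<rho> Tmat ** matrix_inv P)"
    using Tunit unfolding T_unitarizable_def by blast
  obtain R :: cmat3 and \<nu> :: "3 \<Rightarrow> complex" where R: "invertible R"
    "\<And>x j. (R *v (\<rho> Tmat *v x)) $ j = \<nu> j * (R *v x) $ j"
    "\<And>h :: complex \<Rightarrow> real. (\<Sum>j\<in>UNIV. h (\<nu> j)) = h (ee r1) + h (ee r2) + h (ee r3)"
    using unitarizable_diagonal[OF P eigen] by blast
  have vT: "v Tmat = ee (m / 12)" using cusp by (simp add: cusp_parameter_def)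
  \<comment> \<open>\<open>h\<close> sends an eigenvalue \<open>\<mu>\<close> of
    \<open>\<rho> Tmat\<close> to the exponent in [0,1) of \<open>v Tmat * \<mu>\<close>. As a
    function of the eigenvalue it can be summed over the eigenbasis.\<close>
  define h where "h = (\<lambda>\<mu>. THE l. 0 \<le> l \<and> l < 1 \<and> ee l = v Tmat * \<mu>)"
  have h_ee: "h (ee r) = frac (r + m / 12)" for r
    unfolding h_def
  proof (rule the_equality)
    have e: "ee (frac (r + m / 12)) = v Tmat * ee r" by (simp add: ee_frac ee_add vT)
    then show "0 \<le> frac (r + m / 12) \<and> frac (r + m / 12) < 1 \<and> ee (frac (r + m / 12)) = v Tmat * ee r"
      by (simp add: frac_lt_1)
    show "l = frac (r + m / 12)" if "0 \<le> l \<and> l < 1 \<and> ee l = v Tmat * ee r" for l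
      using that e by (intro ee_inj) (auto simp: frac_lt_1)
  qed
  have \<nu>_mem: "\<nu> j \<in> {ee r1, ee r2, ee r3}" for j
  proof -
    \<comment> \<open>The sum identity for the indicator of the complement counts the
      \<open>\<nu> j\<close> that are not among the three given eigenvalues.\<close>
    have "(\<Sum>j\<in>UNIV. if \<nu> j \<in> {ee r1, ee r2, ee r3} then 0 else 1 :: real) = 0"
      using R(3)[of "\<lambda>\<mu>. if \<mu> \<in> {ee r1, ee r2, ee r3} then 0 else 1"] by simp
    then show ?thesis by (simp add: sum_nonneg_eq_0_iff split: if_splits)
  qed
  define lam where "lam = (\<lambda>j. h (\<nu> j))"
  have lam: "0 \<le> lam j \<and> lam j < 1 \<and> ee (lam j) = v Tmat * \<nu> j" for j
    using \<nu>_mem[of j] by (auto simp: lam_def h_ee frac_lt_1 ee_frac ee_add vT)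
  \<comment> \<open>The eigenbasis may list the eigenvalues in another order, so only the symmetric
    sum is compared.\<close>
  have lam_sum: "(\<Sum>j\<in>UNIV. lam j) = lam1 + lam2 + lam3"
    unfolding lam_def R(3) h_ee lam1_def lam2_def lam3_def ..
  obtain M4 M6 where M: "M4 \<in> MF 4" "M6 \<in> MF 6" "fundamental_system3 k0 M4 M6 (\<lambda>i z. F0 z $ i)"
    using F0_fund by blast
  interpret fundamental_vector \<rho> v R lam k0 F0 M4 M6
  proof
    show "(R *v (twist v \<rho> Tmat *v x)) $ j = ee (lam j) * (R *v x) $ j" for x j
    proof -
      have "(R *v (c *s y)) $ j = c * (R *v y) $ j" for c y by (simp add: mat3_vec_nth algebra_simps)
      then show ?thesis by (simp add: twist_mult R(2) lam)
    qed
  qed (use v_nz R(1) lam F0_in M in \<open>auto simp: k0_def lam_sum\<close>)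
  \<comment> \<open>Nonnegative exponents with sum zero all vanish, so every eigenvalue of the
    diagonalisable \<open>\<rho> Tmat\<close> is the inverse of \<open>v Tmat\<close>.\<close>
  have "(\<Sum>j\<in>UNIV. lam j) \<noteq> 0"
  proof
    assume "(\<Sum>j\<in>UNIV. lam j) = 0"
    then have "lam j = 0" for j using lam by (simp add: sum_nonneg_eq_0_iff)
    then have \<nu>: "\<nu> j = inverse (v Tmat)" for j
      using lam[of j] v_nz[of Tmat] by (simp add: field_simps)
    have "\<rho> Tmat *v x = inverse (v Tmat) *s x" for x
    proof -
      have "R *v (\<rho> Tmat *v x) = R *v (inverse (v Tmat) *s x)"
        by (simp add: vec_eq_iff R(2) \<nu>) (simp add: mat3_vec_nth algebra_simps)
      then have "matrix_inv R *v (R *v (\<rho> Tmat *v x)) = matrix_inv R *v (R *v (inverse (v Tmat) *s x))" by simp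
      moreover have "matrix_inv R *v (R *v y) = y" for y
        by (simp add: matrix_vector_mul_assoc matrix_inv_left[OF R(1)])
      ultimately show ?thesis by simp
    qed
    then have "\<not> irreducible3 \<rho>" using not_irreducible3_scalar rep_scalar_of_T[OF rep] by blast
    then show False using Tdet by (simp add: T_determined_def)
  qed
  then have quasi: "quasimodular_P" by (rule quasimodular)
  have B0: "B0 = B" by (simp add: B0_def B_def)
  have D: "Dmod k0 B \<in> Hmod k0 \<rho> v" by (rule Hmod_Dmod[OF quasi B_in_Hmod])
  have unique: "\<forall>a\<in>Mring. \<forall>b\<in>Mring. \<forall>c\<in>Mring. \<forall>a'\<in>Mring. \<forall>b'\<in>Mring. \<forall>c'\<in>Mring.
      act a B + act b (Dmod k0 B) + act c (Dmod k0 (Dmod k0 B)) =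
      act a' B + act b' (Dmod k0 B) + act c' (Dmod k0 (Dmod k0 B)) \<longrightarrow> a = a' \<and> b = b' \<and> c = c'"
    by (intro ballI impI Hmod_coefficients_unique)
  show ?thesis
    unfolding B0
    by (rule conjI[OF conjI[OF B_in_Hmod conjI[OF D conjI[OF Hmod_Dmod[OF quasi D] conjI[OF ballI[OF Hmod_spanned[OF quasi]] unique]]]]
          conjI[OF Hmod_cyclic[OF quasi] allI[OF cdim_Hk[OF quasi]]]])
qed

end
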